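(* Let $(\varepsilon_u)_{u\in\mathbb Z}$ be an i.i.d. sequence of real random variables, let $f\colon\mathbb R^{\mathbb Z}\to\mathbb R$ be measurable, and let $h\colon\mathbb R\times\mathbb R\to\mathbb R$ be measurable and symmetric. Let $X_j=f((\varepsilon_{j-k})_{k\in\mathbb Z})$ and $U_n=\sum_{1\le i<j\le n}h(X_i,X_j)$. Then for all $1\le p<2$, $$\left\|\sup_{n\ge 1}\frac{1}{n^{3/2}\sqrt{\operatorname{LL}(n)}}\bigl|U_n-\mathbb E[U_n]\bigr|\right\|_{p}\le c_p\Bigl(\theta_{0,2}+\sum_{\ell\ge 1}\ell^{1/2}\theta_{\ell,2}\Bigr),$$ where $c_p$ depends only on $p$.
   Context: Notation: $L(x)=\max\{\ln x,1\}$ and $\operatorname{LL}(x)=L(L(x))$. $V_{j,\ell}:=(\varepsilon_u)_{u=j-\ell}^{j+\ell}$ for $j\in\mathbb Z$, $\ell\ge 0$. $X_0$ is integrable and the measurable function $f_\ell\colon\mathbb R^{2\ell+1}\to\mathbb R$ is such that $\mathbb E[X_j\mid V_{j,\ell}]=f_\ell(V_{j,\ell})$ a.s. (by stationarity it can be chosen independent of $j$). Symmetric means $h(x,y)=h(y,x)$ for all $x,y$. The dependence coefficients are, for $\ell\ge1$, $$\theta_{\ell,2}:=\sup_{j\ge 0}\bigl\|h(f_\ell(V_{0,\ell}),f_\ell(V_{j,\ell}))-h(f_{\ell-1}(V_{0,\ell-1}),f_{\ell-1}(V_{j,\ell-1}))\bigr\|_2,$$ and $\theta_{0,2}:=\sup_{j\ge0}\|h(f_0(V_{0,0}),f_0(V_{j,0}))\|_2$,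 where $\|Y\|_p=(\mathbb E|Y|^p)^{1/p}$.
   Formalization: Added assumption: for each j ≥ 1, h(f_ℓ(V_{0,ℓ}), f_ℓ(V_{j,ℓ})) converges in probability to h(X_0, X_j) as ℓ → ∞ (automatic for continuous h); for merely measurable symmetric h the printed inequality fails. *)

theory Defs
  imports "HOL-Probability.Probability"
begin

definition L :: "real \<Rightarrow> real" where
  "L x = max (ln x) 1"

definition LL :: "real \<Rightarrow> real" where
  "LL x = L (L x)"

text \<open>Norms take values in \<open>[0, \<infinity>]\<close>, so that no integrability has to be presupposed.\<close>

definition ennpowr :: "ennreal \<Rightarrow> real \<Rightarrow> ennreal" where
  "ennpowr x r = (if x = \<infinity> then \<infinity> else ennreal (enn2real x powr r))"

definition Lp_norm :: "'a measure \<Rightarrow> real \<Rightarrow> ('a \<Rightarrow> ennreal) \<Rightarrow> ennreal" where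
  "Lp_norm M p Y = ennpowr (\<integral>\<^sup>+ \<omega>. ennpowr (Y \<omega>) p \<partial>M) (1 / p)"

definition shift_process ::
    "(int \<Rightarrow> 'a \<Rightarrow> real) \<Rightarrow> ((int \<Rightarrow> real) \<Rightarrow> real) \<Rightarrow> int \<Rightarrow> 'a \<Rightarrow> real" where
  "shift_process eps f j \<omega> = f (\<lambda>k. eps (j - k) \<omega>)"

text \<open>
  The vector \<open>V\<^sub>j\<^sub>,\<^sub>l = (eps\<^sub>u)\<close>, \<open>j - l \<le> u \<le> j + l\<close>, is indexed by the offset \<open>u - j\<close>, so that
  \<open>V\<^sub>j\<^sub>,\<^sub>l\<close> takes values in the same space for every \<open>j\<close>; that space plays the role of
  real space of dimension \<open>2l + 1\<close>.
\<close>

definition window_space :: "nat \<Rightarrow> (int \<Rightarrow> real) measure" where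
  "window_space l = PiM {- int l..int l} (\<lambda>_. borel)"

definition window :: "(int \<Rightarrow> 'a \<Rightarrow> real) \<Rightarrow> int \<Rightarrow> nat \<Rightarrow> 'a \<Rightarrow> (int \<Rightarrow> real)" where
  "window eps j l \<omega> = (\<lambda>k\<in>{- int l..int l}. eps (j + k) \<omega>)"

definition window_sigma :: "'a measure \<Rightarrow> (int \<Rightarrow> 'a \<Rightarrow> real) \<Rightarrow> int \<Rightarrow> nat \<Rightarrow> 'a measure" where
  "window_sigma M eps j l = vimage_algebra (space M) (window eps j l) (window_space l)"

locale bernoulli_ustat = prob_space M for M :: "'a measure" +
  fixes eps :: "int \<Rightarrow> 'a \<Rightarrow> real"
    and f :: "(int \<Rightarrow> real) \<Rightarrow> real"
    and h :: "real \<Rightarrow> real \<Rightarrow> real"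
    and fl :: "nat \<Rightarrow> (int \<Rightarrow> real) \<Rightarrow> real"
  assumes eps_indep: "indep_vars (\<lambda>_. borel) eps UNIV"
    and eps_ident: "\<And>u v. distr M borel (eps u) = distr M borel (eps v)"
    and f_measurable: "f \<in> borel_measurable (PiM UNIV (\<lambda>_. borel))"
    and h_measurable: "case_prod h \<in> borel_measurable (borel \<Otimes>\<^sub>M borel)"
    and h_symmetric: "\<And>x y. h x y = h y x"
    and X0_integrable: "integrable M (shift_process eps f 0)"
    and fl_measurable: "\<And>l. fl l \<in> borel_measurable (window_space l)"
    and fl_cond_exp: "\<And>j l. AE \<omega> in M.
      real_cond_exp M (window_sigma M eps j l) (shift_process eps f j) \<omega> = fl l (window eps j l \<omega>)"

definition kernel_approx ::
    "(int \<Rightarrow> 'a \<Rightarrow> real) \<Rightarrow> (real \<Rightarrow> real \<Rightarrow> real) \<Rightarrow> (nat \<Rightarrow> (int \<Rightarrow> real) \<Rightarrow> real) \<Rightarrow>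
      nat \<Rightarrow> nat \<Rightarrow> 'a \<Rightarrow> real" where
  "kernel_approx eps h fl l j \<omega> =
    h (fl l (window eps 0 l \<omega>)) (fl l (window eps (int j) l \<omega>))"

text \<open>
  Convergence in probability of \<open>h (f\<^sub>l(V\<^sub>0\<^sub>,\<^sub>l), f\<^sub>l(V\<^sub>j\<^sub>,\<^sub>l))\<close> to \<open>h (X\<^sub>0, X\<^sub>j)\<close>. It is automatic
  when \<open>h\<close> is continuous, since \<open>f\<^sub>l(V\<^sub>j\<^sub>,\<^sub>l) \<rightarrow> X\<^sub>j\<close> almost surely, but not for merely measurable \<open>h\<close>.
  The coefficients \<open>\<theta>\<^sub>l\<^sub>,\<^sub>2\<close> only see the values of \<open>h\<close> at the approximations, so without this
  condition they do not control \<open>h (X\<^sub>i, X\<^sub>j)\<close>: if \<open>eps\<close> are fair bits,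
  \<open>X\<^sub>j = (\<Sum>k\<ge>0. 2\<^sup>-\<^sup>k\<^sup>-\<^sup>1 eps\<^sub>j\<^sub>-\<^sub>k)\<close>, and \<open>h (x, y)\<close> is \<open>0\<close> when \<open>x\<close> or \<open>y\<close> is a dyadic rational and
  \<open>x + y\<close> otherwise, then all \<open>f\<^sub>l(V\<^sub>j\<^sub>,\<^sub>l)\<close> are dyadic and every \<open>\<theta>\<^sub>l\<^sub>,\<^sub>2\<close> vanishes, whereas
  almost surely \<open>h (X\<^sub>i, X\<^sub>j) = X\<^sub>i + X\<^sub>j\<close> is not constant.
\<close>

definition kernel_approximable ::
    "'a measure \<Rightarrow> (int \<Rightarrow> 'a \<Rightarrow> real) \<Rightarrow> ((int \<Rightarrow> real) \<Rightarrow> real) \<Rightarrow> (real \<Rightarrow> real \<Rightarrow> real) \<Rightarrow>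
      (nat \<Rightarrow> (int \<Rightarrow> real) \<Rightarrow> real) \<Rightarrow> bool" where
  "kernel_approximable M eps f h fl \<longleftrightarrow>
    (\<forall>j\<ge>1. \<forall>\<delta>>0. (\<lambda>l. measure M {\<omega> \<in> space M.
        \<bar>kernel_approx eps h fl l j \<omega>
          - h (shift_process eps f 0 \<omega>) (shift_process eps f (int j) \<omega>)\<bar> > \<delta>}) \<longlonglongrightarrow> 0)"

primrec theta2 ::
    "'a measure \<Rightarrow> (int \<Rightarrow> 'a \<Rightarrow> real) \<Rightarrow> (real \<Rightarrow> real \<Rightarrow> real) \<Rightarrow>
      (nat \<Rightarrow> (int \<Rightarrow> real) \<Rightarrow> real) \<Rightarrow> nat \<Rightarrow> ennreal" where
  "theta2 M eps h fl 0 =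
    (SUP j. Lp_norm M 2 (\<lambda>\<omega>. ennreal \<bar>kernel_approx eps h fl 0 j \<omega>\<bar>))"
| "theta2 M eps h fl (Suc l) =
    (SUP j. Lp_norm M 2 (\<lambda>\<omega>. ennreal
      \<bar>kernel_approx eps h fl (Suc l) j \<omega> - kernel_approx eps h fl l j \<omega>\<bar>))"

definition ustat ::
    "(int \<Rightarrow> 'a \<Rightarrow> real) \<Rightarrow> ((int \<Rightarrow> real) \<Rightarrow> real) \<Rightarrow> (real \<Rightarrow> real \<Rightarrow> real) \<Rightarrow> nat \<Rightarrow> 'a \<Rightarrow> real" where
  "ustat eps f h n \<omega> =
    (\<Sum>(i, j)\<in>{(i, j). 1 \<le> i \<and> i < j \<and> j \<le> n}.
      h (shift_process eps f (int i) \<omega>) (shift_process eps f (int j) \<omega>))"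

text \<open>
  If the right-hand side is infinite, the bound is trivial for \<open>c > 0\<close>. If it is finite, then
  under \<open>kernel_approximable\<close> every \<open>h (X\<^sub>i, X\<^sub>j)\<close> with \<open>i < j\<close> is square integrable, so the
  convention that the Bochner integral of a non-integrable function is \<open>0\<close> plays no role.
\<close>

definition maximal_bound ::
    "'a measure \<Rightarrow> (int \<Rightarrow> 'a \<Rightarrow> real) \<Rightarrow> ((int \<Rightarrow> real) \<Rightarrow> real) \<Rightarrow> (real \<Rightarrow> real \<Rightarrow> real) \<Rightarrow>
      (nat \<Rightarrow> (int \<Rightarrow> real) \<Rightarrow> real) \<Rightarrow> real \<Rightarrow> real \<Rightarrow> bool" where
  "maximal_bound M eps f h fl p c \<longleftrightarrow>
    Lp_norm M p (\<lambda>\<omega>. SUP n\<in>{1..}. ennreal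
      (1 / (real n powr (3 / 2) * sqrt (LL (real n)))
        * \<bar>ustat eps f h n \<omega> - (\<integral>\<omega>'. ustat eps f h n \<omega>' \<partial>M)\<bar>))
    \<le> ennreal c * (theta2 M eps h fl 0
        + (\<Sum>l. ennreal (real (Suc l) powr (1 / 2)) * theta2 M eps h fl (Suc l)))"

end

theory Submission
  imports Defs "HOL-Library.Discrete_Functions"
begin

text \<open>
  Telescoping over \<open>l\<close> writes \<open>h (X\<^sub>i, X\<^sub>j)\<close> as the almost sure sum of the increments of
  \<open>h (f\<^sub>l(V\<^sub>i\<^sub>,\<^sub>l), f\<^sub>l(V\<^sub>j\<^sub>,\<^sub>l))\<close>; by the triangle inequality it suffices to bound the maximal function of each
  level by a multiple of \<open>m\<^sup>1\<^sup>/\<^sup>2 \<theta>\<^sub>l\<^sub>,\<^sub>2\<close>, \<open>m = 2l + 1\<close>. The windows of level \<open>l\<close> are \<open>m\<close>-dependent, so Hoeffding's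
  decomposition of the increment with respect to the law of one window leaves a linear part
  \<open>(n - 1) \<Sum>\<^sub>j g(V\<^sub>j\<^sub>,\<^sub>l)\<close>, which splits into \<open>m\<close> i.i.d. sums along the residue classes modulo \<open>m\<close>, and a
  remainder that is degenerate on the pairs at distance at least \<open>m\<close>. The remainder is of order
  \<open>n m\<close> in \<open>L\<^sup>2\<close>, so it is negligible against \<open>n\<^sup>3\<^sup>/\<^sup>2\<close> without iterated logarithm, and second moments along
  the subsequence \<open>n = m q\<^sup>2\<close> suffice. For the i.i.d. sums one truncates at
  \<open>(n / LL n)\<^sup>1\<^sup>/\<^sup>2\<close>: the truncated part obeys a maximal Bernstein inequality, and the absolute values of the
  excess, weighted by \<open>(n LL n)\<^sup>-\<^sup>1\<^sup>/\<^sup>2\<close>, have a sum in \<open>L\<^sup>p\<close> for every \<open>p < 2\<close>.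
\<close>

text \<open>The power \<open>l^(1/2)\<close> arises in the same size from both parts. The linear
  part has \<open>m\<close> class sums of about \<open>n / m\<close> terms, each of order
  \<open>(n / m)^(1/2)\<close>, in total \<open>(m n)^(1/2)\<close> up to the iterated logarithm.
  The far pairs of the remainder have second moment of order \<open>(m n)^2\<close>; divided by
  \<open>n^3\<close> at \<open>n = m q^2\<close> this is \<open>m / q^2\<close>, so summing over
  \<open>q\<close> costs a factor \<open>m^(1/2)\<close> in L2. Pairs closer than \<open>m\<close>
  carry no orthogonality, but column \<open>j\<close> has at most \<open>min j m\<close> of them,
  and the sum of \<open>min j m / j^(3/2)\<close> is again of order \<open>m^(1/2)\<close>. The
  restriction \<open>p < 2\<close> enters through the excess over the truncation level: a value
  \<open>z\<close> exceeds the levels of many dyadic blocks, and their contributions are bounded by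
  a geometric sum of powers \<open>2 - q\<close> of the levels, which needs \<open>q < 2\<close>.
  Telescoping alone only yields the limit of the approximations. That this limit is
  \<open>h (X_i, X_j)\<close> is what \<open>kernel_approximable\<close> supplies: almost sure
  limits and limits in probability agree.\<close>

section \<open>Norms\<close>

lemma ennpowr_ennreal: "0 \<le> x \<Longrightarrow> ennpowr (ennreal x) r = ennreal (x powr r)"
  by (simp add: ennpowr_def)

lemma ennpowr_top [simp]: "ennpowr \<infinity> r = \<infinity>" "ennpowr top r = top"
  by (simp_all add: ennpowr_def)

lemma ennpowr_zero [simp]: "ennpowr 0 r = 0"
  by (simp add: ennpowr_def)

lemma ennpowr_mono: "0 \<le> r \<Longrightarrow> x \<le> y \<Longrightarrow> ennpowr x r \<le> ennpowr y r"
  by (cases x; cases y) (auto simp: ennpowr_ennreal powr_mono2 top_unique ennreal_neg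
      intro!: ennreal_leI)

lemma ennpowr_ennpowr:
  assumes "r * s = 1"
  shows "ennpowr (ennpowr x r) s = x"
  using assms by (cases x) (auto simp: ennpowr_ennreal powr_powr)

text \<open>Powers with exponents \<open>r\<close> and \<open>1 / r\<close> are mutually inverse
  monotone maps of [0, \<infinity>], hence adjoint. This turns bounds on a norm into bounds on a
  moment, and it is why powers commute with suprema.\<close>

lemma ennpowr_le_iff:
  assumes "0 < r"
  shows "ennpowr x r \<le> y \<longleftrightarrow> x \<le> ennpowr y (1 / r)"
proof
  assume "ennpowr x r \<le> y"
  then have "ennpowr (ennpowr x r) (1 / r) \<le> ennpowr y (1 / r)"
    using assms by (intro ennpowr_mono) auto
  then show "x \<le> ennpowr y (1 / r)"
    using assms by (simp add: ennpowr_ennpowr)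
next
  assume "x \<le> ennpowr y (1 / r)"
  then have "ennpowr x r \<le> ennpowr (ennpowr y (1 / r)) r"
    using assms by (intro ennpowr_mono) auto
  then show "ennpowr x r \<le> y"
    using assms by (simp add: ennpowr_ennpowr)
qed

lemma ennpowr_SUP:
  assumes "0 < r"
  shows "ennpowr (SUP i\<in>I. f i) r = (SUP i\<in>I. ennpowr (f i) r)"
proof (rule antisym)
  show "ennpowr (SUP i\<in>I. f i) r \<le> (SUP i\<in>I. ennpowr (f i) r)"
    unfolding ennpowr_le_iff[OF assms]
  proof (rule SUP_least)
    fix i assume "i \<in> I"
    then have "ennpowr (f i) r \<le> (SUP i\<in>I. ennpowr (f i) r)"
      by (rule SUP_upper)
    then show "f i \<le> ennpowr (SUP i\<in>I. ennpowr (f i) r) (1 / r)"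
      by (simp only: ennpowr_le_iff[OF assms])
  qed
  show "(SUP i\<in>I. ennpowr (f i) r) \<le> ennpowr (SUP i\<in>I. f i) r"
    using assms by (intro SUP_least ennpowr_mono SUP_upper) auto
qed

lemma ennpowr_mult: "0 < r \<Longrightarrow> ennpowr (x * y) r = ennpowr x r * ennpowr y r"
proof (cases x; cases y)
  fix a b assume "0 < r" "0 \<le> a" "x = ennreal a" "0 \<le> b" "y = ennreal b"
  then show ?thesis
    by (simp add: ennpowr_ennreal powr_mult flip: ennreal_mult)
qed (auto simp: ennpowr_ennreal ennreal_top_mult ennreal_mult_top)

lemma measurable_ennpowr [measurable]: "(\<lambda>x. ennpowr x r) \<in> borel_measurable borel"
  unfolding ennpowr_def by measurable

text \<open>Convexity on the positive half-line covers two positive points. If one of them is 0, it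
  remains that \<open>w powr p \<le> w\<close> for a weight \<open>w\<close> between 0 and
  1.\<close>

lemma powr_convex_sum:
  fixes x y u v p :: real
  assumes "1 \<le> p" "0 \<le> x" "0 \<le> y" "0 \<le> u" "0 \<le> v" "u + v = 1"
  shows "(u * x + v * y) powr p \<le> u * x powr p + v * y powr p"
proof -
  have small: "(w * z) powr p \<le> w * z powr p" if "0 \<le> w" "w \<le> 1" "0 \<le> z" for w z :: real
  proof -
    have "w powr p \<le> w"
      using powr_mono'[of 1 p w] that assms by simp
    then show ?thesis
      using that by (simp add: powr_mult mult_right_mono)
  qed
  consider "x = 0" | "y = 0" | "x > 0" "y > 0"
    using assms by linarith
  then show ?thesis
  proof cases
    case 3
    then have "((1 - v) * x + v * y) powr p \<le> (1 - v) * x powr p + v * y powr p"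
      using convex_onD[OF powr_convex[of p], of v x y] assms by simp
    moreover have "1 - v = u"
      using assms by simp
    ultimately show ?thesis
      by (simp only:)
  qed (use assms small[of u x] small[of v y] in auto)
qed

lemma ennpowr_convex:
  fixes x y :: ennreal and u v p :: real
  assumes "1 \<le> p" "0 < u" "0 < v" "u + v = 1"
  shows "ennpowr (ennreal u * x + ennreal v * y) p
       \<le> ennreal u * ennpowr x p + ennreal v * ennpowr y p"
proof (cases x; cases y)
  fix a b assume "0 \<le> a" "x = ennreal a" "0 \<le> b" "y = ennreal b"
  then have eq: "ennreal u * x + ennreal v * y = ennreal (u * a + v * b)"
      "ennreal u * ennpowr x p + ennreal v * ennpowr y p = ennreal (u * a powr p + v * b powr p)"
    using assms by (simp_all add: ennpowr_ennreal ennreal_mult)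
  have "0 \<le> u * a + v * b"
    using assms \<open>0 \<le> a\<close> \<open>0 \<le> b\<close> by simp
  then show ?thesis
    unfolding eq using assms \<open>0 \<le> a\<close> \<open>0 \<le> b\<close>
    by (subst ennpowr_ennreal) (auto intro!: ennreal_leI powr_convex_sum simp del: ennreal_plus)
qed (use assms in \<open>auto simp: ennreal_mult_top\<close>)

lemma Lp_norm_le_iff:
  assumes "0 < p" "0 \<le> a"
  shows "Lp_norm M p Y \<le> ennreal a \<longleftrightarrow> (\<integral>\<^sup>+\<omega>. ennpowr (Y \<omega>) p \<partial>M) \<le> ennreal (a powr p)"
  using assms by (simp add: Lp_norm_def ennpowr_le_iff ennpowr_ennreal)

lemma Lp_norm_mono_AE:
  assumes "0 < p" "AE \<omega> in M. Y \<omega> \<le> Z \<omega>"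
  shows "Lp_norm M p Y \<le> Lp_norm M p Z"
  unfolding Lp_norm_def using assms
  by (intro ennpowr_mono nn_integral_mono_AE) (auto intro: ennpowr_mono elim!: eventually_mono)

lemma Lp_norm_mono:
  assumes "0 < p" "\<And>\<omega>. \<omega> \<in> space M \<Longrightarrow> Y \<omega> \<le> Z \<omega>"
  shows "Lp_norm M p Y \<le> Lp_norm M p Z"
  using assms by (intro Lp_norm_mono_AE) auto

lemma Lp_norm_cong:
  assumes "\<And>\<omega>. \<omega> \<in> space M \<Longrightarrow> Y \<omega> = Z \<omega>"
  shows "Lp_norm M p Y = Lp_norm M p Z"
  unfolding Lp_norm_def using assms by (auto cong: nn_integral_cong)

lemma Lp_norm_cmult:
  assumes "0 < p" and [measurable]: "Y \<in> borel_measurable M"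
  shows "Lp_norm M p (\<lambda>\<omega>. c * Y \<omega>) = c * Lp_norm M p Y"
  using assms by (simp add: Lp_norm_def ennpowr_mult nn_integral_cmult ennpowr_ennpowr)

text \<open>Minkowski's inequality from convexity of the power: \<open>Y + Z\<close> is
  \<open>a' + b'\<close> times a convex combination of \<open>Y / a'\<close> and
  \<open>Z / b'\<close>, with weights \<open>u\<close> and \<open>v\<close> proportional to
  \<open>a'\<close> and \<open>b'\<close>. Both quotients have p-th moment at most 1.\<close>

lemma Lp_norm_add_le:
  assumes p: "1 \<le> p" and [measurable]: "Y \<in> borel_measurable M" "Z \<in> borel_measurable M"
  shows "Lp_norm M p (\<lambda>\<omega>. Y \<omega> + Z \<omega>) \<le> Lp_norm M p Y + Lp_norm M p Z"
proof (cases "Lp_norm M p Y = \<infinity> \<or> Lp_norm M p Z = \<infinity>")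
  case False
  then obtain a b where a: "0 \<le> a" "Lp_norm M p Y = ennreal a"
    and b: "0 \<le> b" "Lp_norm M p Z = ennreal b"
    by (cases "Lp_norm M p Y"; cases "Lp_norm M p Z") auto
  show ?thesis
  proof (rule ennreal_le_epsilon)
    fix e :: real assume e: "0 < e"
    \<comment> \<open>Enlarging both norms by \<open>e / 2\<close> makes them positive, so that
      division is possible even when a norm is 0.\<close>
    define a' b' where "a' = a + e / 2" and "b' = b + e / 2"
    have pos: "0 < a'" "0 < b'"
      using a b e by (auto simp: a'_def b'_def)
    have Y: "(\<integral>\<^sup>+\<omega>. ennpowr (Y \<omega>) p \<partial>M) \<le> ennreal (a' powr p)"
      using a pos p e by (subst Lp_norm_le_iff[symmetric]) (auto simp: a'_def intro!: ennreal_leI)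
    have Z: "(\<integral>\<^sup>+\<omega>. ennpowr (Z \<omega>) p \<partial>M) \<le> ennreal (b' powr p)"
      using b pos p e by (subst Lp_norm_le_iff[symmetric]) (auto simp: b'_def intro!: ennreal_leI)
    define u v where "u = a' / (a' + b')" and "v = b' / (a' + b')"
    have uv: "0 < u" "0 < v" "u + v = 1"
      using pos by (auto simp: u_def v_def add_divide_distrib[symmetric])
    define s where "s = ennreal ((a' + b') powr p)"
    have bound: "ennpowr (Y \<omega> + Z \<omega>) p \<le> s * (ennreal (u * (1 / a') powr p) * ennpowr (Y \<omega>) p
        + ennreal (v * (1 / b') powr p) * ennpowr (Z \<omega>) p)" for \<omega>
    proof -
      have "(a' + b') * u * (1 / a') = 1" "(a' + b') * v * (1 / b') = 1"
        using pos by (auto simp: u_def v_def)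
      then have "ennreal (a' + b') * ennreal u * ennreal (1 / a') = 1"
           "ennreal (a' + b') * ennreal v * ennreal (1 / b') = 1"
        using pos uv by (metis add_nonneg_nonneg divide_nonneg_pos ennreal_1 ennreal_mult less_imp_le
            mult_nonneg_nonneg zero_le_one)+
      then have "ennreal (a' + b') * (ennreal u * (ennreal (1 / a') * Y \<omega>)) = Y \<omega>"
           "ennreal (a' + b') * (ennreal v * (ennreal (1 / b') * Z \<omega>)) = Z \<omega>"
        by (simp_all only: mult.assoc[symmetric] mult_1_left)
      then have "Y \<omega> + Z \<omega> = ennreal (a' + b') *
          (ennreal u * (ennreal (1 / a') * Y \<omega>) + ennreal v * (ennreal (1 / b') * Z \<omega>))"
        by (simp only: distrib_left)
      then have "ennpowr (Y \<omega> + Z \<omega>) p = s * ennpowr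
          (ennreal u * (ennreal (1 / a') * Y \<omega>) + ennreal v * (ennreal (1 / b') * Z \<omega>)) p"
        using p pos by (simp add: ennpowr_mult ennpowr_ennreal s_def del: ennreal_plus)
      also have "\<dots> \<le> s * (ennreal u * ennpowr (ennreal (1 / a') * Y \<omega>) p
          + ennreal v * ennpowr (ennreal (1 / b') * Z \<omega>) p)"
        using uv p by (intro mult_left_mono ennpowr_convex) auto
      also have "\<dots> = s * (ennreal (u * (1 / a') powr p) * ennpowr (Y \<omega>) p
          + ennreal (v * (1 / b') powr p) * ennpowr (Z \<omega>) p)"
        using p pos uv by (simp add: ennpowr_mult ennpowr_ennreal ennreal_mult mult.assoc)
      finally show ?thesis .
    qed
    have "(\<integral>\<^sup>+\<omega>. ennpowr (Y \<omega> + Z \<omega>) p \<partial>M) \<le>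
        (\<integral>\<^sup>+\<omega>. s * (ennreal (u * (1 / a') powr p) * ennpowr (Y \<omega>) p
        + ennreal (v * (1 / b') powr p) * ennpowr (Z \<omega>) p) \<partial>M)"
      by (intro nn_integral_mono bound)
    also have "\<dots> =
        s * (ennreal (u * (1 / a') powr p) * (\<integral>\<^sup>+\<omega>. ennpowr (Y \<omega>) p \<partial>M)
        + ennreal (v * (1 / b') powr p) * (\<integral>\<^sup>+\<omega>. ennpowr (Z \<omega>) p \<partial>M))"
      by (simp add: nn_integral_cmult nn_integral_add)
    also have "\<dots> \<le> s * (ennreal (u * (1 / a') powr p) * ennreal (a' powr p)
        + ennreal (v * (1 / b') powr p) * ennreal (b' powr p))"
      by (intro mult_left_mono add_mono Y Z) auto
    also have "\<dots> = s * ennreal (u + v)"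
    proof -
      have "(1 / c) powr p * c powr p = 1" if "0 < c" for c :: real
        using that by (simp add: powr_mult[symmetric])
      then have "u * (1 / a') powr p * a' powr p = u" "v * (1 / b') powr p * b' powr p = v"
        using pos by (simp_all only: mult.assoc mult_1_right)
      then have "ennreal (u * (1 / a') powr p) * ennreal (a' powr p) = ennreal u"
          "ennreal (v * (1 / b') powr p) * ennreal (b' powr p) = ennreal v"
        using uv by (simp_all only: ennreal_mult[symmetric] powr_ge_zero mult_nonneg_nonneg less_imp_le)
      then show ?thesis
        using uv(1,2) by (simp only: ennreal_plus less_imp_le)
    qed
    finally have "(\<integral>\<^sup>+\<omega>. ennpowr (Y \<omega> + Z \<omega>) p \<partial>M) \<le> ennreal ((a' + b') powr p)"
      by (simp only: uv(3) s_def ennreal_1 mult_1_right)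
    then have "Lp_norm M p (\<lambda>\<omega>. Y \<omega> + Z \<omega>) \<le> ennreal (a' + b')"
      using pos p by (subst Lp_norm_le_iff) auto
    then show "Lp_norm M p (\<lambda>\<omega>. Y \<omega> + Z \<omega>) \<le> Lp_norm M p Y + Lp_norm M p Z + ennreal e"
    proof -
      have "ennreal (a' + b') = ennreal (a + b + e)"
        by (rule arg_cong[where f = ennreal]) (simp add: a'_def b'_def)
      also have "\<dots> = ennreal a + ennreal b + ennreal e"
        using a b e by simp
      finally show ?thesis
        using \<open>Lp_norm M p (\<lambda>\<omega>. Y \<omega> + Z \<omega>) \<le> ennreal (a' + b')\<close> a b by simp
    qed
  qed
qed auto

lemma Lp_norm_sum_le:
  assumes p: "1 \<le> p" and "\<And>i. i \<in> I \<Longrightarrow> Y i \<in> borel_measurable M"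
  shows "Lp_norm M p (\<lambda>\<omega>. \<Sum>i\<in>I. Y i \<omega>) \<le> (\<Sum>i\<in>I. Lp_norm M p (Y i))"
  using assms(2)
proof (induction I rule: infinite_finite_induct)
  case (insert i I)
  have "Lp_norm M p (\<lambda>\<omega>. Y i \<omega> + (\<Sum>i\<in>I. Y i \<omega>)) \<le> Lp_norm M p (Y i) + Lp_norm M p (\<lambda>\<omega>. \<Sum>i\<in>I. Y i \<omega>)"
    using insert.prems by (intro Lp_norm_add_le p borel_measurable_sum) auto
  also have "\<dots> \<le> Lp_norm M p (Y i) + (\<Sum>i\<in>I. Lp_norm M p (Y i))"
    using insert by (intro add_mono) auto
  finally show ?case
    using insert.hyps by simp
qed (simp_all add: Lp_norm_def)

text \<open>Powers commute with suprema, so this is monotone convergence; it carries the triangle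
  inequality from finite sums to series.\<close>

lemma Lp_norm_SUP:
  assumes p: "0 < p" and [measurable]: "\<And>n. Y n \<in> borel_measurable M"
    and inc: "\<And>\<omega>. incseq (\<lambda>n::nat. Y n \<omega>)"
  shows "Lp_norm M p (\<lambda>\<omega>. SUP n. Y n \<omega>) = (SUP n. Lp_norm M p (Y n))"
proof -
  have "(\<integral>\<^sup>+\<omega>. ennpowr (SUP n. Y n \<omega>) p \<partial>M) = (SUP n. \<integral>\<^sup>+\<omega>. ennpowr (Y n \<omega>) p \<partial>M)"
    unfolding ennpowr_SUP[OF p]
    by (intro nn_integral_monotone_convergence_SUP)
      (use inc p in \<open>auto simp: incseq_def le_fun_def intro!: ennpowr_mono\<close>)
  then show ?thesis
    using p by (simp add: Lp_norm_def ennpowr_SUP)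
qed

lemma Lp_norm_suminf_le:
  assumes p: "1 \<le> p" and [measurable]: "\<And>i::nat. Y i \<in> borel_measurable M"
  shows "Lp_norm M p (\<lambda>\<omega>. \<Sum>i. Y i \<omega>) \<le> (\<Sum>i. Lp_norm M p (Y i))"
proof -
  have "Lp_norm M p (\<lambda>\<omega>. \<Sum>i. Y i \<omega>) = (SUP n. Lp_norm M p (\<lambda>\<omega>. \<Sum>i<n. Y i \<omega>))"
    unfolding suminf_eq_SUP using p
    by (intro Lp_norm_SUP) (auto simp: incseq_def intro!: sum_mono2)
  also have "\<dots> \<le> (\<Sum>i. Lp_norm M p (Y i))"
  proof (rule SUP_least)
    fix n
    have "Lp_norm M p (\<lambda>\<omega>. \<Sum>i<n. Y i \<omega>) \<le> (\<Sum>i<n. Lp_norm M p (Y i))"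
      by (intro Lp_norm_sum_le p) auto
    also have "\<dots> \<le> (\<Sum>i. Lp_norm M p (Y i))"
      by (intro sum_le_suminf) auto
    finally show "Lp_norm M p (\<lambda>\<omega>. \<Sum>i<n. Y i \<omega>) \<le> (\<Sum>i. Lp_norm M p (Y i))" .
  qed
  finally show ?thesis .
qed

section \<open>Comparison of the p-norm with the 2-norm\<close>

lemma powr_le_add_square:
  fixes x p :: real
  assumes "0 \<le> x" "0 \<le> p" "p \<le> 2"
  shows "x powr p \<le> 1 + x\<^sup>2"
proof (cases "x \<le> 1")
  case True
  then have "x powr p \<le> 1"
    using assms by (intro powr_le1) auto
  then show ?thesis
    by (simp add: add_increasing2)
next
  case False
  then have "x powr p \<le> x powr 2"
    using assms by (intro powr_mono) auto
  then show ?thesis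
    using False assms by (simp add: powr_numeral)
qed

text \<open>After division by \<open>b\<close>, a number slightly above the 2-norm, the bound
  \<open>x^p \<le> 1 + x^2\<close> gives a p-th moment of at most \<open>2 * b powr p\<close>, and
  \<open>2 \<le> 2 powr p\<close> moves the factor 2 inside the power.\<close>

lemma (in prob_space) Lp_norm_le_L2_norm:
  assumes p: "1 \<le> p" "p \<le> 2" and [measurable]: "Y \<in> borel_measurable M"
  shows "Lp_norm M p Y \<le> 2 * Lp_norm M 2 Y"
proof (cases "Lp_norm M 2 Y")
  case (real a)
  show ?thesis
  proof (rule ennreal_le_epsilon)
    fix e :: real assume e: "0 < e"
    define b where "b = a + e / 2"
    have b: "0 < b"
      using real e by (simp add: b_def)
    have Y: "(\<integral>\<^sup>+\<omega>. ennpowr (Y \<omega>) 2 \<partial>M) \<le> ennreal (b powr 2)"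
      using real b e by (subst Lp_norm_le_iff[symmetric]) (auto simp: b_def)
    have bound: "ennpowr y p \<le> ennreal (b powr p) * (1 + ennreal (1 / b powr 2) * ennpowr y 2)"
      for y
    proof (cases y)
      case (real c)
      have "c powr p = b powr p * (c / b) powr p"
        using b real by (simp add: powr_divide)
      also have "\<dots> \<le> b powr p * (1 + (c / b)\<^sup>2)"
        using b real p by (intro mult_left_mono powr_le_add_square) auto
      finally have "c powr p \<le> b powr p * (1 + 1 / b powr 2 * c powr 2)"
        using b real by (simp add: powr_numeral power_divide)
      then have "ennreal (c powr p) \<le> ennreal (b powr p * (1 + 1 / b powr 2 * c powr 2))"
        by (rule ennreal_leI)
      also have "\<dots> = ennreal (b powr p) * (ennreal 1 + ennreal (1 / b powr 2) * ennreal (c powr 2))"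
        using b by (subst ennreal_mult[symmetric], simp, simp, subst ennreal_plus[symmetric])
          (auto simp: ennreal_mult)
      finally show ?thesis
        using real by (simp add: ennpowr_ennreal)
    qed (use b in \<open>auto simp: ennreal_mult_top\<close>)
    have "(\<integral>\<^sup>+\<omega>. ennpowr (Y \<omega>) p \<partial>M)
        \<le> (\<integral>\<^sup>+\<omega>. ennreal (b powr p) * (1 + ennreal (1 / b powr 2) * ennpowr (Y \<omega>) 2) \<partial>M)"
      by (intro nn_integral_mono bound)
    also have "\<dots> = ennreal (b powr p) * (1 + ennreal (1 / b powr 2) * (\<integral>\<^sup>+\<omega>. ennpowr (Y \<omega>) 2 \<partial>M))"
      by (simp add: nn_integral_cmult nn_integral_add emeasure_space_1)
    also have "\<dots> \<le> ennreal (b powr p) * (1 + ennreal (1 / b powr 2) * ennreal (b powr 2))"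
      by (intro mult_left_mono add_mono Y) auto
    also have "\<dots> = ennreal (b powr p * 2)"
    proof -
      have "ennreal (1 / b powr 2) * ennreal (b powr 2) = ennreal 1"
        using b by (subst ennreal_mult[symmetric]) auto
      then show ?thesis
        by (simp only: ennreal_1 one_add_one ennreal_numeral[symmetric] ennreal_mult[symmetric]
            powr_ge_zero zero_le_numeral)
    qed
    also have "\<dots> \<le> ennreal ((2 * b) powr p)"
    proof (rule ennreal_leI)
      have "(2::real) \<le> 2 powr p"
        using powr_mono[of 1 p "2::real"] p by simp
      then show "b powr p * 2 \<le> (2 * b) powr p"
        using b by (simp add: powr_mult mult.commute mult_left_mono)
    qed
    finally have "Lp_norm M p Y \<le> ennreal (2 * b)"
      using b p by (subst Lp_norm_le_iff) auto
    then show "Lp_norm M p Y \<le> 2 * Lp_norm M 2 Y + ennreal e"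
      using real e by (simp add: b_def distrib_left ennreal_mult)
  qed
qed (auto simp: ennreal_mult_top)

lemma L2_norm_le_iff:
  assumes "0 \<le> a"
  shows "Lp_norm M 2 (\<lambda>\<omega>. ennreal \<bar>Y \<omega>\<bar>) \<le> ennreal a \<longleftrightarrow> (\<integral>\<^sup>+\<omega>. ennreal ((Y \<omega>)\<^sup>2) \<partial>M) \<le> ennreal (a\<^sup>2)"
  using assms by (simp add: Lp_norm_le_iff ennpowr_ennreal powr_numeral)

lemma L2_norm_le_iff_integral:
  assumes "0 \<le> a" and [measurable]: "Y \<in> borel_measurable M"
  shows "Lp_norm M 2 (\<lambda>\<omega>. ennreal \<bar>Y \<omega>\<bar>) \<le> ennreal a \<longleftrightarrow>
    integrable M (\<lambda>\<omega>. (Y \<omega>)\<^sup>2) \<and> (\<integral>\<omega>. (Y \<omega>)\<^sup>2 \<partial>M) \<le> a\<^sup>2"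
proof -
  have "(\<integral>\<^sup>+\<omega>. ennreal ((Y \<omega>)\<^sup>2) \<partial>M) \<le> ennreal (a\<^sup>2) \<longleftrightarrow>
    integrable M (\<lambda>\<omega>. (Y \<omega>)\<^sup>2) \<and> (\<integral>\<omega>. (Y \<omega>)\<^sup>2 \<partial>M) \<le> a\<^sup>2"
  proof
    assume *: "(\<integral>\<^sup>+\<omega>. ennreal ((Y \<omega>)\<^sup>2) \<partial>M) \<le> ennreal (a\<^sup>2)"
    then have "(\<integral>\<^sup>+\<omega>. ennreal ((Y \<omega>)\<^sup>2) \<partial>M) < \<infinity>"
      by (rule order.strict_trans1) simp
    then have "integrable M (\<lambda>\<omega>. (Y \<omega>)\<^sup>2)"
      by (intro integrableI_nonneg) auto
    then show "integrable M (\<lambda>\<omega>. (Y \<omega>)\<^sup>2) \<and> (\<integral>\<omega>. (Y \<omega>)\<^sup>2 \<partial>M) \<le> a\<^sup>2"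
      using * by (simp add: nn_integral_eq_integral)
  next
    assume "integrable M (\<lambda>\<omega>. (Y \<omega>)\<^sup>2) \<and> (\<integral>\<omega>. (Y \<omega>)\<^sup>2 \<partial>M) \<le> a\<^sup>2"
    then show "(\<integral>\<^sup>+\<omega>. ennreal ((Y \<omega>)\<^sup>2) \<partial>M) \<le> ennreal (a\<^sup>2)"
      by (simp add: nn_integral_eq_integral)
  qed
  then show ?thesis
    by (simp add: L2_norm_le_iff assms(1))
qed

section \<open>Maximal inequalities for independent variables\<close>

text \<open>The joint law is a product, so Tonelli applies. The nonnegative extended setting spares
  all integrability conditions in the induction of the next lemma.\<close>

lemma (in prob_space) indep_var_nn_integral_mult:
  assumes indep: "indep_var S X T Y"
    and [measurable]: "f \<in> borel_measurable S" "g \<in> borel_measurable T"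
  shows "(\<integral>\<^sup>+\<omega>. f (X \<omega>) * g (Y \<omega>) \<partial>M) = (\<integral>\<^sup>+\<omega>. f (X \<omega>) \<partial>M) * (\<integral>\<^sup>+\<omega>. g (Y \<omega>) \<partial>M)"
proof -
  have [measurable]: "X \<in> measurable M S" "Y \<in> measurable M T"
    using indep by (auto dest: indep_var_rv1 indep_var_rv2)
  interpret Y: prob_space "distr M T Y"
    by (rule prob_space_distr) measurable
  have "(\<integral>\<^sup>+\<omega>. f (X \<omega>) * g (Y \<omega>) \<partial>M)
      = (\<integral>\<^sup>+z. f (fst z) * g (snd z) \<partial>distr M (S \<Otimes>\<^sub>M T) (\<lambda>\<omega>. (X \<omega>, Y \<omega>)))"
    by (subst nn_integral_distr) auto
  also have "\<dots> = (\<integral>\<^sup>+z. f (fst z) * g (snd z) \<partial>(distr M S X \<Otimes>\<^sub>M distr M T Y))"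
    using indep by (simp add: indep_var_distribution_eq)
  also have "\<dots> = (\<integral>\<^sup>+x. \<integral>\<^sup>+y. f x * g y \<partial>distr M T Y \<partial>distr M S X)"
    by (subst Y.nn_integral_fst[symmetric]) auto
  also have "\<dots> = (\<integral>\<^sup>+x. f x \<partial>distr M S X) * (\<integral>\<^sup>+y. g y \<partial>distr M T Y)"
    by (simp add: nn_integral_cmult nn_integral_multc)
  finally show ?thesis
    by (simp add: nn_integral_distr)
qed

text \<open>Doob's maximal inequality for the partial products, by induction on \<open>n\<close>. On
  \<open>H n\<close>, where the level \<open>c\<close> has already been reached, one more
  independent factor of mean at least 1 can only raise the integral. On
  \<open>H (Suc n) - H n\<close> the level is reached exactly at the last product, which is itself
  at least \<open>c\<close>.\<close>

lemma (in prob_space) maximal_inequality_prod: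
  fixes Q :: "nat \<Rightarrow> 'a \<Rightarrow> ennreal" and c :: ennreal
  assumes indep: "indep_vars (\<lambda>_. borel) Q UNIV"
    and ge1: "\<And>r. 1 \<le> (\<integral>\<^sup>+\<omega>. Q r \<omega> \<partial>M)"
  shows "c * emeasure M {\<omega>\<in>space M. \<exists>N\<le>n. c \<le> (\<Prod>r<N. Q r \<omega>)} \<le> (\<Prod>r<n. \<integral>\<^sup>+\<omega>. Q r \<omega> \<partial>M)"
proof -
  have [measurable]: "Q r \<in> borel_measurable M" for r
    using indep by (auto simp: indep_vars_def)
  define H where "H n = {\<omega>\<in>space M. \<exists>N\<le>n. c \<le> (\<Prod>r<N. Q r \<omega>)}" for n
  have [measurable]: "H n \<in> sets M" for n
    unfolding H_def by measurable
  have "c * emeasure M (H n) \<le> (\<integral>\<^sup>+\<omega>. (\<Prod>r<n. Q r \<omega>) * indicator (H n) \<omega> \<partial>M)"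
  proof (induction n)
    case 0
    have "c * emeasure M (H 0) = (\<integral>\<^sup>+\<omega>. c * indicator (H 0) \<omega> \<partial>M)"
      by (simp add: nn_integral_cmult_indicator)
    also have "\<dots> \<le> (\<integral>\<^sup>+\<omega>. (\<Prod>r<0. Q r \<omega>) * indicator (H 0) \<omega> \<partial>M)"
      by (intro nn_integral_mono) (auto simp: H_def indicator_def)
    finally show ?case .
  next
    case (Suc n)
    \<comment> \<open>The product on \<open>H n\<close> is rewritten as a measurable function of the
      first \<open>n\<close> coordinates, which are jointly independent of
      \<open>Q n\<close>.\<close>
    define a where "a x = (\<Prod>r<n. x r) * indicator {x. \<exists>N\<le>n. c \<le> (\<Prod>r<N. x r)} x"
      for x :: "nat \<Rightarrow> ennreal"
    have a: "a \<in> borel_measurable (PiM {..<n} (\<lambda>_. borel))"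
    proof -
      have 1: "{x\<in>space (PiM {..<n} (\<lambda>_. borel)). \<exists>N\<le>n. c \<le> (\<Prod>r<N. x r)} \<in> sets (PiM {..<n} (\<lambda>_. borel))"
      proof -
        have "(\<lambda>x. \<Prod>r<N. x r) \<in> borel_measurable (PiM {..<n} (\<lambda>_. borel :: ennreal measure))"
          if "N \<le> n" for N
          using that by (intro borel_measurable_prod_ennreal[where f = "\<lambda>r x. x r"] measurable_component_singleton) auto
        then have "(\<Union>N\<in>{..n}. {x\<in>space (PiM {..<n} (\<lambda>_. borel)). c \<le> (\<Prod>r<N. x r)})
            \<in> sets (PiM {..<n} (\<lambda>_. borel))"
          by (intro sets.finite_UN) auto
        then show ?thesis
          by (rule back_subst[where P = "\<lambda>A. A \<in> _"]) auto
      qed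
      have 2: "(\<lambda>x. \<Prod>r<n. x r) \<in> borel_measurable (PiM {..<n} (\<lambda>_. borel :: ennreal measure))"
        by (intro borel_measurable_prod_ennreal[where f = "\<lambda>r x. x r"] measurable_component_singleton) auto
      have "a \<in> borel_measurable (PiM {..<n} (\<lambda>_. borel)) \<longleftrightarrow>
        (\<lambda>x. (\<Prod>r<n. x r) * indicator {x\<in>space (PiM {..<n} (\<lambda>_. borel)). \<exists>N\<le>n. c \<le> (\<Prod>r<N. x r)} x)
          \<in> borel_measurable (PiM {..<n} (\<lambda>_. borel))"
        by (intro measurable_cong) (simp add: a_def indicator_def)
      then show ?thesis
        using borel_measurable_times_ennreal[OF 2 borel_measurable_indicator[OF 1]] by simp
    qed
    have a_eq: "a (\<lambda>r\<in>{..<n}. Q r \<omega>) = (\<Prod>r<n. Q r \<omega>) * indicator (H n) \<omega>" if "\<omega> \<in> space M" for \<omega>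
      using that by (auto simp: a_def H_def indicator_def intro!: arg_cong2[where f = "(*)"])
    have ind: "indep_var (PiM {..<n} (\<lambda>_. borel)) (\<lambda>\<omega>. \<lambda>r\<in>{..<n}. Q r \<omega>)
        (PiM {n} (\<lambda>_. borel)) (\<lambda>\<omega>. \<lambda>r\<in>{n}. Q r \<omega>)"
      by (rule indep_var_restrict[OF indep]) auto
    have "(\<integral>\<^sup>+\<omega>. (\<Prod>r<n. Q r \<omega>) * indicator (H n) \<omega> * Q n \<omega> \<partial>M)
        = (\<integral>\<^sup>+\<omega>. a (\<lambda>r\<in>{..<n}. Q r \<omega>) * (\<lambda>x. x n) (\<lambda>r\<in>{n}. Q r \<omega>) \<partial>M)"
      by (intro nn_integral_cong) (simp add: a_eq)
    also have "\<dots> = (\<integral>\<^sup>+\<omega>. a (\<lambda>r\<in>{..<n}. Q r \<omega>) \<partial>M) * (\<integral>\<^sup>+\<omega>. (\<lambda>x. x n) (\<lambda>r\<in>{n}. Q r \<omega>) \<partial>M)"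
      by (intro indep_var_nn_integral_mult[OF ind] a) measurable
    also have "\<dots> = (\<integral>\<^sup>+\<omega>. (\<Prod>r<n. Q r \<omega>) * indicator (H n) \<omega> \<partial>M) * (\<integral>\<^sup>+\<omega>. Q n \<omega> \<partial>M)"
      by (intro arg_cong2[where f = "(*)"] nn_integral_cong) (simp_all add: a_eq)
    finally have step: "(\<integral>\<^sup>+\<omega>. (\<Prod>r<n. Q r \<omega>) * indicator (H n) \<omega> * Q n \<omega> \<partial>M) = \<dots>" .
    have "c * emeasure M (H (Suc n)) = c * emeasure M (H n) + c * emeasure M (H (Suc n) - H n)"
    proof -
      have "emeasure M (H (Suc n)) = emeasure M (H n \<union> (H (Suc n) - H n))"
        by (rule arg_cong[where f = "emeasure M"]) (auto simp: H_def dest: le_SucI)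
      also have "\<dots> = emeasure M (H n) + emeasure M (H (Suc n) - H n)"
        by (rule plus_emeasure[symmetric]) auto
      finally show ?thesis
        by (simp add: distrib_left)
    qed
    also have "\<dots> \<le> (\<integral>\<^sup>+\<omega>. (\<Prod>r<n. Q r \<omega>) * indicator (H n) \<omega> * Q n \<omega> \<partial>M)
        + (\<integral>\<^sup>+\<omega>. (\<Prod>r<Suc n. Q r \<omega>) * indicator (H (Suc n) - H n) \<omega> \<partial>M)"
    proof (rule add_mono)
      show "c * emeasure M (H n) \<le> (\<integral>\<^sup>+\<omega>. (\<Prod>r<n. Q r \<omega>) * indicator (H n) \<omega> * Q n \<omega> \<partial>M)"
        unfolding step using mult_mono[OF Suc.IH ge1[of n]] by simp
      have "c * emeasure M (H (Suc n) - H n) = (\<integral>\<^sup>+\<omega>. c * indicator (H (Suc n) - H n) \<omega> \<partial>M)"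
        by (simp add: nn_integral_cmult_indicator)
      also have "\<dots> \<le> (\<integral>\<^sup>+\<omega>. (\<Prod>r<Suc n. Q r \<omega>) * indicator (H (Suc n) - H n) \<omega> \<partial>M)"
        by (intro nn_integral_mono) (auto simp: H_def indicator_def le_Suc_eq simp del: prod.lessThan_Suc)
      finally show "c * emeasure M (H (Suc n) - H n)
          \<le> (\<integral>\<^sup>+\<omega>. (\<Prod>r<Suc n. Q r \<omega>) * indicator (H (Suc n) - H n) \<omega> \<partial>M)" .
    qed
    also have "\<dots> = (\<integral>\<^sup>+\<omega>. (\<Prod>r<n. Q r \<omega>) * indicator (H n) \<omega> * Q n \<omega>
        + (\<Prod>r<Suc n. Q r \<omega>) * indicator (H (Suc n) - H n) \<omega> \<partial>M)"
      by (rule nn_integral_add[symmetric]) measurable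
    also have "\<dots> = (\<integral>\<^sup>+\<omega>. (\<Prod>r<Suc n. Q r \<omega>) * indicator (H (Suc n)) \<omega> \<partial>M)"
      by (intro nn_integral_cong) (auto simp: indicator_def H_def dest: le_SucI)
    finally show ?case .
  qed
  also have "\<dots> \<le> (\<integral>\<^sup>+\<omega>. (\<Prod>r<n. Q r \<omega>) \<partial>M)"
    by (intro nn_integral_mono) (auto simp: indicator_def)
  also have "\<dots> = (\<Prod>r<n. \<integral>\<^sup>+\<omega>. Q r \<omega> \<partial>M)"
    using indep by (intro indep_vars_nn_integral) (auto intro: indep_vars_subset)
  finally show ?thesis
    by (simp add: H_def)
qed

lemma exp_le_quadratic:
  fixes x :: real
  assumes "\<bar>x\<bar> \<le> 1"
  shows "exp x \<le> 1 + x + x\<^sup>2"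
proof (cases "0 \<le> x")
  case True
  then show ?thesis
    using assms by (intro exp_bound) auto
next
  case False
  define y where "y = - x"
  have y: "0 \<le> y" "y \<le> 1"
    using False assms by (auto simp: y_def)
  \<comment> \<open>For \<open>x = - y\<close> the claim amounts to
    \<open>1 \<le> (1 - y + y\<^sup>2) * exp y\<close>. The quadratic Taylor polynomial is already a
    sufficient lower bound for \<open>exp y\<close>, since in the product the terms of degree 1
    cancel and the rest is nonnegative.\<close>
  have "(1 - y + y\<^sup>2) * (1 + y + y\<^sup>2 / 2) = 1 + (y\<^sup>2 + y * y\<^sup>2 + y\<^sup>2 * y\<^sup>2) / 2"
    by (simp add: field_simps power2_eq_square)
  then have "1 \<le> (1 - y + y\<^sup>2) * (1 + y + y\<^sup>2 / 2)"
    using y by simp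
  also have "\<dots> \<le> (1 - y + y\<^sup>2) * exp y"
    using y by (intro mult_left_mono exp_lower_Taylor_quadratic) auto
  finally show ?thesis
    by (simp add: y_def exp_minus field_simps)
qed

text \<open>The maximal inequality is applied to the products of \<open>exp (t * Y r)\<close>.
  Centring and \<open>1 + x \<le> exp x\<close> give factors of mean at least 1;
  \<open>\<bar>t * Y r\<bar> \<le> 1\<close> allows the quadratic bound, so each mean is at most
  \<open>1 + t\<^sup>2 \<le> exp (t\<^sup>2)\<close>.\<close>

lemma (in prob_space) maximal_bernstein_one_sided:
  fixes Y :: "nat \<Rightarrow> 'a \<Rightarrow> real"
  assumes indep: "indep_vars (\<lambda>_. borel) Y UNIV"
    and bdd: "\<And>r \<omega>. r < n \<Longrightarrow> \<bar>Y r \<omega>\<bar> \<le> B"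
    and mean: "\<And>r. r < n \<Longrightarrow> expectation (Y r) = 0"
    and var: "\<And>r. r < n \<Longrightarrow> expectation (\<lambda>\<omega>. (Y r \<omega>)\<^sup>2) \<le> 1"
    and lam: "0 \<le> t" "t * B \<le> 1"
  shows "emeasure M {\<omega>\<in>space M. \<exists>N\<le>n. x \<le> (\<Sum>r<N. Y r \<omega>)} \<le> ennreal (exp (real n * t\<^sup>2 - t * x))"
proof -
  have [measurable]: "Y r \<in> borel_measurable M" for r
    using indep by (auto simp: indep_vars_def)
  \<comment> \<open>The hypotheses speak only of \<open>r < n\<close>; factors equal to 1 beyond
    \<open>n\<close> keep an independent family with means at least 1 over all indices.\<close>
  define Q where "Q r \<omega> = (if r < n then ennreal (exp (t * Y r \<omega>)) else 1)" for r \<omega>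
  have Q_indep: "indep_vars (\<lambda>_. borel) Q UNIV"
    unfolding Q_def
    by (rule indep_vars_compose2[OF indep, of "\<lambda>r y. if r < n then ennreal (exp (t * y)) else 1"]) auto
  have int1: "integrable M (Y r)" if "r < n" for r
    using bdd that by (intro integrable_const_bound[of _ B]) auto
  have int2: "integrable M (\<lambda>\<omega>. (Y r \<omega>)\<^sup>2)" if "r < n" for r
    using bdd that by (intro integrable_const_bound[of _ "B\<^sup>2"]) (auto simp: abs_le_square_iff[symmetric] intro!: order_trans[OF _ abs_ge_self])
  have tY: "\<bar>t * Y r \<omega>\<bar> \<le> 1" if "r < n" for r \<omega>
    using mult_left_mono[OF bdd[OF that, of \<omega>] lam(1)] lam by (simp add: abs_mult)
  have int3: "integrable M (\<lambda>\<omega>. exp (t * Y r \<omega>))" if "r < n" for r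
    using tY[OF that] by (intro integrable_const_bound[of _ "exp 1"]) (auto simp: abs_le_iff)
  have Q_eq: "(\<integral>\<^sup>+\<omega>. Q r \<omega> \<partial>M) = (if r < n then ennreal (expectation (\<lambda>\<omega>. exp (t * Y r \<omega>))) else 1)" for r
    using int3 by (simp add: Q_def nn_integral_eq_integral emeasure_space_1)
  have Q_ge: "1 \<le> (\<integral>\<^sup>+\<omega>. Q r \<omega> \<partial>M)" for r
  proof (cases "r < n")
    case True
    have "1 = expectation (\<lambda>\<omega>. 1 + t * Y r \<omega>)"
      using int1 mean True by (simp add: prob_space)
    also have "\<dots> \<le> expectation (\<lambda>\<omega>. exp (t * Y r \<omega>))"
      using True int1 int3 by (intro integral_mono) auto
    finally show ?thesis
      using True by (simp add: Q_eq)
  qed (simp add: Q_eq)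
  have Q_le: "(\<integral>\<^sup>+\<omega>. Q r \<omega> \<partial>M) \<le> ennreal (exp (t\<^sup>2))" if "r < n" for r
  proof -
    have "expectation (\<lambda>\<omega>. exp (t * Y r \<omega>)) \<le> expectation (\<lambda>\<omega>. 1 + t * Y r \<omega> + (t * Y r \<omega>)\<^sup>2)"
      using that int1 int2 int3 tY
      by (intro integral_mono exp_le_quadratic) (auto simp: power_mult_distrib)
    also have "\<dots> = 1 + t\<^sup>2 * expectation (\<lambda>\<omega>. (Y r \<omega>)\<^sup>2)"
      using that int1 int2 mean by (simp add: prob_space power_mult_distrib)
    also have "\<dots> \<le> 1 + t\<^sup>2"
      using var[OF that] mult_left_mono[of _ 1 "t\<^sup>2"] by simp
    also have "\<dots> \<le> exp (t\<^sup>2)"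
      by (rule exp_ge_add_one_self)
    finally show ?thesis
      using that by (simp add: Q_eq)
  qed
  have prod_Q: "(\<Prod>r<N. Q r \<omega>) = ennreal (exp (t * (\<Sum>r<N. Y r \<omega>)))" if "N \<le> n" for N \<omega>
  proof -
    have "(\<Prod>r<N. Q r \<omega>) = (\<Prod>r<N. ennreal (exp (t * Y r \<omega>)))"
      using that by (intro prod.cong) (auto simp: Q_def)
    also have "\<dots> = ennreal (\<Prod>r<N. exp (t * Y r \<omega>))"
      by (rule prod_ennreal) simp
    also have "(\<Prod>r<N. exp (t * Y r \<omega>)) = exp (t * (\<Sum>r<N. Y r \<omega>))"
      by (simp add: exp_sum sum_distrib_left)
    finally show ?thesis .
  qed
  define A where "A = {\<omega>\<in>space M. \<exists>N\<le>n. x \<le> (\<Sum>r<N. Y r \<omega>)}"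
  have [measurable]: "A \<in> sets M"
    unfolding A_def by measurable
  have "ennreal (exp (t * x)) * emeasure M A
      \<le> ennreal (exp (t * x)) * emeasure M {\<omega>\<in>space M. \<exists>N\<le>n. ennreal (exp (t * x)) \<le> (\<Prod>r<N. Q r \<omega>)}"
  proof (intro mult_left_mono emeasure_mono)
    show "A \<subseteq> {\<omega>\<in>space M. \<exists>N\<le>n. ennreal (exp (t * x)) \<le> (\<Prod>r<N. Q r \<omega>)}"
      unfolding A_def using lam(1) by (auto simp: prod_Q intro!: exI mult_left_mono)
    have [measurable]: "Q r \<in> borel_measurable M" for r
      using Q_indep by (auto simp: indep_vars_def)
    show "{\<omega>\<in>space M. \<exists>N\<le>n. ennreal (exp (t * x)) \<le> (\<Prod>r<N. Q r \<omega>)} \<in> sets M"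
      by measurable
  qed simp
  also have "\<dots> \<le> (\<Prod>r<n. \<integral>\<^sup>+\<omega>. Q r \<omega> \<partial>M)"
    by (rule maximal_inequality_prod[OF Q_indep Q_ge])
  also have "\<dots> \<le> (\<Prod>r<n. ennreal (exp (t\<^sup>2)))"
  proof -
    have "N \<le> n \<Longrightarrow> (\<Prod>r<N. \<integral>\<^sup>+\<omega>. Q r \<omega> \<partial>M) \<le> (\<Prod>r<N. ennreal (exp (t\<^sup>2)))" for N
    proof (induction N)
      case (Suc N)
      then show ?case
        using mult_mono[OF Suc.IH Q_le[of N]] by (simp add: mult.commute)
    qed simp
    then show ?thesis
      by blast
  qed
  also have "\<dots> = ennreal (exp (real n * t\<^sup>2))"
    by (simp add: ennreal_power exp_of_nat_mult)
  finally have *: "ennreal (exp (t * x)) * emeasure M A \<le> ennreal (exp (real n * t\<^sup>2))" .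
  have "emeasure M A = ennreal (exp (- (t * x))) * (ennreal (exp (t * x)) * emeasure M A)"
    by (simp add: mult.assoc[symmetric] ennreal_mult[symmetric] exp_minus)
  also have "\<dots> \<le> ennreal (exp (- (t * x))) * ennreal (exp (real n * t\<^sup>2))"
    by (intro mult_left_mono *) simp
  also have "\<dots> = ennreal (exp (real n * t\<^sup>2 - t * x))"
    by (simp add: ennreal_mult[symmetric] mult_exp_exp)
  finally show ?thesis
    by (simp add: A_def)
qed

lemma (in prob_space) maximal_bernstein:
  fixes Y :: "nat \<Rightarrow> 'a \<Rightarrow> real"
  assumes indep: "indep_vars (\<lambda>_. borel) Y UNIV"
    and bdd: "\<And>r \<omega>. r < n \<Longrightarrow> \<bar>Y r \<omega>\<bar> \<le> B"
    and mean: "\<And>r. r < n \<Longrightarrow> expectation (Y r) = 0"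
    and var: "\<And>r. r < n \<Longrightarrow> expectation (\<lambda>\<omega>. (Y r \<omega>)\<^sup>2) \<le> 1"
    and lam: "0 \<le> t" "t * B \<le> 1"
  shows "emeasure M {\<omega>\<in>space M. \<exists>N\<le>n. x \<le> \<bar>\<Sum>r<N. Y r \<omega>\<bar>}
    \<le> ennreal (2 * exp (real n * t\<^sup>2 - t * x))"
proof -
  have [measurable]: "Y r \<in> borel_measurable M" for r
    using indep by (auto simp: indep_vars_def)
  have "indep_vars (\<lambda>_. borel) (\<lambda>r \<omega>. - Y r \<omega>) UNIV"
    by (rule indep_vars_compose2[OF indep, of "\<lambda>r y. - y"]) auto
  then have neg: "emeasure M {\<omega>\<in>space M. \<exists>N\<le>n. x \<le> (\<Sum>r<N. - Y r \<omega>)}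
      \<le> ennreal (exp (real n * t\<^sup>2 - t * x))"
    by (rule maximal_bernstein_one_sided[where B = B]) (use assms in auto)
  have pos: "emeasure M {\<omega>\<in>space M. \<exists>N\<le>n. x \<le> (\<Sum>r<N. Y r \<omega>)}
      \<le> ennreal (exp (real n * t\<^sup>2 - t * x))"
    by (rule maximal_bernstein_one_sided[where B = B]) (use assms in auto)
  have "emeasure M {\<omega>\<in>space M. \<exists>N\<le>n. x \<le> \<bar>\<Sum>r<N. Y r \<omega>\<bar>}
    \<le> emeasure M ({\<omega>\<in>space M. \<exists>N\<le>n. x \<le> (\<Sum>r<N. Y r \<omega>)}
        \<union> {\<omega>\<in>space M. \<exists>N\<le>n. x \<le> (\<Sum>r<N. - Y r \<omega>)})"
    by (intro emeasure_mono) (auto simp: sum_negf abs_if split: if_splits)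
  also have "\<dots> \<le> emeasure M {\<omega>\<in>space M. \<exists>N\<le>n. x \<le> (\<Sum>r<N. Y r \<omega>)}
        + emeasure M {\<omega>\<in>space M. \<exists>N\<le>n. x \<le> (\<Sum>r<N. - Y r \<omega>)}"
    by (intro emeasure_subadditive) measurable
  also have "\<dots> \<le> ennreal (exp (real n * t\<^sup>2 - t * x)) + ennreal (exp (real n * t\<^sup>2 - t * x))"
    by (intro add_mono pos neg)
  also have "\<dots> = ennreal (2 * exp (real n * t\<^sup>2 - t * x))"
    by (subst ennreal_plus[symmetric]) auto
  finally show ?thesis .
qed

text \<open>
  Write \<open>W\<^sup>p = \<Sum>\<^sub>r w\<^sub>r W\<^sup>p\<^sup>-\<^sup>1\<close> and use that \<open>W - w\<^sub>r\<close> is independent of \<open>w\<^sub>r\<close> and that \<open>p - 1 \<le> 1\<close>.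
\<close>

lemma (in prob_space) powr_sum_nonneg_indep:
  fixes w :: "nat \<Rightarrow> 'a \<Rightarrow> real"
  assumes p: "1 \<le> p" "p < 2" and indep: "indep_vars (\<lambda>_. borel) w UNIV"
    and nonneg: "\<And>r \<omega>. 0 \<le> w r \<omega>"
  shows "(\<integral>\<^sup>+\<omega>. ennreal ((\<Sum>r<n. w r \<omega>) powr p) \<partial>M) \<le>
    2 * (\<Sum>r<n. \<integral>\<^sup>+\<omega>. ennreal (w r \<omega> powr p) \<partial>M)
      + (\<Sum>r<n. \<integral>\<^sup>+\<omega>. ennreal (w r \<omega>) \<partial>M) * (1 + 2 * (\<Sum>r<n. \<integral>\<^sup>+\<omega>. ennreal (w r \<omega>) \<partial>M))"
proof -
  have [measurable]: "w r \<in> borel_measurable M" for r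
    using indep by (auto simp: indep_vars_def)
  define V where "V r \<omega> = (\<Sum>s\<in>{..<n} - {r}. w s \<omega>)" for r \<omega>
  have [measurable]: "V r \<in> borel_measurable M" for r
    unfolding V_def by measurable
  have V_nonneg: "0 \<le> V r \<omega>" for r \<omega>
    unfolding V_def by (intro sum_nonneg nonneg)
  \<comment> \<open>The larger of \<open>a\<close> and \<open>b\<close> decides. If
    \<open>b \<le> a\<close> the sum is at most \<open>2 * a\<close>, and
    \<open>2 powr (p - 1) \<le> 2\<close>. Otherwise it is at most \<open>1 + 2 * b\<close>, whose
    power \<open>p - 1 \<le> 1\<close> is at most itself.\<close>
  have young: "(a + b) powr (p - 1) \<le> 2 * a powr (p - 1) + (1 + 2 * b)"
    if ab: "0 \<le> a" "0 \<le> b" for a b :: real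
  proof (cases "b \<le> a")
    case True
    have "(a + b) powr (p - 1) \<le> (2 * a) powr (p - 1)"
      using True ab p by (intro powr_mono2) auto
    also have "\<dots> = 2 powr (p - 1) * a powr (p - 1)"
      using ab by (simp add: powr_mult)
    also have "\<dots> \<le> 2 * a powr (p - 1)"
      using powr_mono[of "p - 1" 1 "2::real"] p by (intro mult_right_mono) auto
    finally show ?thesis
      using ab by simp
  next
    case False
    have "(a + b) powr (p - 1) \<le> (1 + 2 * b) powr (p - 1)"
      using False ab p by (intro powr_mono2) auto
    also have "\<dots> \<le> (1 + 2 * b) powr 1"
      using ab p by (intro powr_mono) auto
    finally show ?thesis
      using ab by (simp add: add_increasing)
  qed
  have pt: "(\<Sum>r<n. w r \<omega>) powr p \<le> (\<Sum>r<n. 2 * w r \<omega> powr p + w r \<omega> * (1 + 2 * V r \<omega>))" for \<omega>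
  proof (cases "(\<Sum>r<n. w r \<omega>) = 0")
    case True
    then show ?thesis
      using nonneg V_nonneg by (auto intro!: sum_nonneg)
  next
    case False
    then have pos: "0 < (\<Sum>r<n. w r \<omega>)"
      using nonneg by (simp add: less_le sum_nonneg)
    have "(\<Sum>r<n. w r \<omega>) powr p = (\<Sum>r<n. w r \<omega>) * (\<Sum>r<n. w r \<omega>) powr (p - 1)"
      using pos by (simp add: powr_mult_base)
    also have "\<dots> = (\<Sum>r<n. w r \<omega> * (w r \<omega> + V r \<omega>) powr (p - 1))"
      unfolding sum_distrib_right V_def
      by (intro sum.cong refl) (simp add: sum.remove[of "{..<n}"])
    also have "\<dots> \<le> (\<Sum>r<n. w r \<omega> * (2 * w r \<omega> powr (p - 1) + (1 + 2 * V r \<omega>)))"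
      by (intro sum_mono mult_left_mono young nonneg V_nonneg)
    also have "\<dots> = (\<Sum>r<n. 2 * w r \<omega> powr p + w r \<omega> * (1 + 2 * V r \<omega>))"
    proof (intro sum.cong refl)
      fix r
      have "w r \<omega> * w r \<omega> powr (p - 1) = w r \<omega> powr p"
        using nonneg[of r \<omega>] p by (cases "w r \<omega> = 0") (auto simp: powr_mult_base)
      then show "w r \<omega> * (2 * w r \<omega> powr (p - 1) + (1 + 2 * V r \<omega>))
          = 2 * w r \<omega> powr p + w r \<omega> * (1 + 2 * V r \<omega>)"
        by (simp add: algebra_simps)
    qed
    finally show ?thesis .
  qed
  have "(\<integral>\<^sup>+\<omega>. ennreal ((\<Sum>r<n. w r \<omega>) powr p) \<partial>M) \<le>
      (\<integral>\<^sup>+\<omega>. (\<Sum>r<n. 2 * ennreal (w r \<omega> powr p)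
        + ennreal (w r \<omega>) * (1 + 2 * ennreal (V r \<omega>))) \<partial>M)"
  proof (intro nn_integral_mono)
    fix \<omega>
    have "ennreal ((\<Sum>r<n. w r \<omega>) powr p)
        \<le> ennreal (\<Sum>r<n. 2 * w r \<omega> powr p + w r \<omega> * (1 + 2 * V r \<omega>))"
      by (intro ennreal_leI pt)
    also have "\<dots> = (\<Sum>r<n. ennreal (2 * w r \<omega> powr p + w r \<omega> * (1 + 2 * V r \<omega>)))"
      using nonneg V_nonneg by (intro sum_ennreal[symmetric]) auto
    also have "\<dots> = (\<Sum>r<n. 2 * ennreal (w r \<omega> powr p) + ennreal (w r \<omega>) * (1 + 2 * ennreal (V r \<omega>)))"
      using nonneg V_nonneg by (intro sum.cong refl) (simp add: ennreal_mult)
    finally show "ennreal ((\<Sum>r<n. w r \<omega>) powr p)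
        \<le> (\<Sum>r<n. 2 * ennreal (w r \<omega> powr p) + ennreal (w r \<omega>) * (1 + 2 * ennreal (V r \<omega>)))" .
  qed
  also have "\<dots> = (\<Sum>r<n. 2 * (\<integral>\<^sup>+\<omega>. ennreal (w r \<omega> powr p) \<partial>M)
        + (\<integral>\<^sup>+\<omega>. ennreal (w r \<omega>) * (1 + 2 * ennreal (V r \<omega>)) \<partial>M))"
    by (simp add: nn_integral_sum nn_integral_add nn_integral_cmult)
  also have "\<dots> \<le> (\<Sum>r<n. 2 * (\<integral>\<^sup>+\<omega>. ennreal (w r \<omega> powr p) \<partial>M)
        + (\<integral>\<^sup>+\<omega>. ennreal (w r \<omega>) \<partial>M) * (1 + 2 * (\<Sum>r<n. \<integral>\<^sup>+\<omega>. ennreal (w r \<omega>) \<partial>M)))"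
  proof (intro sum_mono add_left_mono)
    fix r assume "r \<in> {..<n}"
    have "indep_var borel (w r) borel (V r)"
      unfolding V_def by (intro indep_vars_sum indep_vars_subset[OF indep]) auto
    then have "(\<integral>\<^sup>+\<omega>. ennreal (w r \<omega>) * (1 + 2 * ennreal (V r \<omega>)) \<partial>M)
        = (\<integral>\<^sup>+\<omega>. ennreal (w r \<omega>) \<partial>M) * (\<integral>\<^sup>+\<omega>. 1 + 2 * ennreal (V r \<omega>) \<partial>M)"
      by (rule indep_var_nn_integral_mult) auto
    also have "(\<integral>\<^sup>+\<omega>. 1 + 2 * ennreal (V r \<omega>) \<partial>M) = 1 + 2 * (\<integral>\<^sup>+\<omega>. ennreal (V r \<omega>) \<partial>M)"
      by (simp add: nn_integral_add nn_integral_cmult emeasure_space_1)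
    also have "(\<integral>\<^sup>+\<omega>. ennreal (V r \<omega>) \<partial>M) = (\<Sum>s\<in>{..<n} - {r}. \<integral>\<^sup>+\<omega>. ennreal (w s \<omega>) \<partial>M)"
      using nonneg by (simp add: V_def nn_integral_sum flip: sum_ennreal)
    also have "(\<integral>\<^sup>+\<omega>. ennreal (w r \<omega>) \<partial>M) * (1 + 2 * (\<Sum>s\<in>{..<n} - {r}. \<integral>\<^sup>+\<omega>. ennreal (w s \<omega>) \<partial>M))
        \<le> (\<integral>\<^sup>+\<omega>. ennreal (w r \<omega>) \<partial>M) * (1 + 2 * (\<Sum>r<n. \<integral>\<^sup>+\<omega>. ennreal (w r \<omega>) \<partial>M))"
      by (intro mult_left_mono add_left_mono sum_mono2) auto
    finally show "(\<integral>\<^sup>+\<omega>. ennreal (w r \<omega>) * (1 + 2 * ennreal (V r \<omega>)) \<partial>M) \<le> \<dots>" .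
  qed
  also have "\<dots> = 2 * (\<Sum>r<n. \<integral>\<^sup>+\<omega>. ennreal (w r \<omega> powr p) \<partial>M)
      + (\<Sum>r<n. \<integral>\<^sup>+\<omega>. ennreal (w r \<omega>) \<partial>M) * (1 + 2 * (\<Sum>r<n. \<integral>\<^sup>+\<omega>. ennreal (w r \<omega>) \<partial>M))"
    by (simp add: sum.distrib flip: sum_distrib_left sum_distrib_right)
  finally show ?thesis .
qed

section \<open>Dyadic truncation levels\<close>

text \<open>
  On the block \<open>2\<^sup>k \<le> n < 2\<^sup>k\<^sup>+\<^sup>1\<close> the function \<open>LL n\<close> is replaced by \<open>dy_log k\<close>, the truncation level
  \<open>(n / LL n)\<^sup>1\<^sup>/\<^sup>2\<close> by \<open>dy_trunc k\<close> and the normalisation \<open>(n LL n)\<^sup>1\<^sup>/\<^sup>2\<close> by \<open>dy_scale k\<close>.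
\<close>

definition dy_log :: "nat \<Rightarrow> real" where
  "dy_log k = 1 + ln (real k + 1)"

definition dy_trunc :: "nat \<Rightarrow> real" where
  "dy_trunc k = sqrt (2 ^ k / dy_log k)"

definition dy_scale :: "nat \<Rightarrow> real" where
  "dy_scale k = sqrt (2 ^ k * dy_log k)"

lemma dy_log_ge_1: "1 \<le> dy_log k"
  by (simp add: dy_log_def)

lemma dy_log_pos: "0 < dy_log k"
  using dy_log_ge_1[of k] by linarith

lemma dy_log_mono: "j \<le> k \<Longrightarrow> dy_log j \<le> dy_log k"
  by (simp add: dy_log_def)

lemma dy_trunc_pos: "0 < dy_trunc k"
  by (simp add: dy_trunc_def dy_log_pos)

lemma dy_scale_pos: "0 < dy_scale k"
  by (simp add: dy_scale_def dy_log_pos)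

lemma dy_scale_mono: "j \<le> k \<Longrightarrow> dy_scale j \<le> dy_scale k"
  unfolding dy_scale_def using dy_log_pos[of j]
  by (intro real_sqrt_le_mono mult_mono dy_log_mono power_increasing) auto

lemma LL_ge_1: "1 \<le> LL x"
  by (simp add: LL_def L_def)

lemma L_mono: "0 < x \<Longrightarrow> x \<le> y \<Longrightarrow> L x \<le> L y"
  unfolding L_def by (intro max.mono) auto

lemma LL_mono: "0 < x \<Longrightarrow> x \<le> y \<Longrightarrow> LL x \<le> LL y"
  unfolding LL_def by (intro L_mono) (auto simp: L_def)

lemma two_power_le_real: "2 ^ k \<le> n \<Longrightarrow> 2 ^ k \<le> real n"
  by (metis of_nat_le_iff of_nat_numeral of_nat_power)

text \<open>Since \<open>L n\<close> is at least \<open>k * ln 2\<close>, \<open>dy_log k\<close>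
  exceeds \<open>LL n\<close> by at most 3: the leading 1, \<open>ln 2 \<le> 1\<close> from
  \<open>k + 1 \<le> 2 * k\<close>, and \<open>- ln (ln 2) \<le> 1\<close>. As
  \<open>LL n \<ge> 1\<close>, the factor 4 absorbs this.\<close>

lemma dy_log_le_LL:
  assumes "2 ^ k \<le> n"
  shows "dy_log k \<le> 4 * LL (real n)"
proof (cases "k = 0")
  case True
  then show ?thesis
    using LL_ge_1[of "real n"] by (simp add: dy_log_def)
next
  case False
  have "real k * ln 2 = ln (2 ^ k)"
    by (simp add: ln_realpow)
  also have "\<dots> \<le> ln (real n)"
    using two_power_le_real[OF assms] by (intro ln_mono) auto
  also have "\<dots> \<le> L (real n)"
    by (simp add: L_def)
  finally have "real k * ln 2 \<le> L (real n)" .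
  moreover have "0 < real k * ln 2"
    using False by simp
  ultimately have "ln (real k * ln 2) \<le> ln (L (real n))"
    by (subst ln_le_cancel_iff) auto
  then have "ln (real k * ln 2) \<le> LL (real n)"
    by (simp add: LL_def L_def[of "L _"] le_max_iff_disj)
  then have *: "ln (real k) + ln (ln 2) \<le> LL (real n)"
    using False by (simp add: ln_mult)
  have "exp (- (1::real)) \<le> 1 / 2"
    using exp_ge_add_one_self[of 1] by (simp add: exp_minus field_simps)
  then have "exp (- (1::real)) \<le> ln 2"
    using ln2_ge_two_thirds by linarith
  then have "- 1 \<le> ln (ln (2::real))"
    by (subst ln_ge_iff) auto
  moreover have "ln (real k + 1) \<le> ln (2 * real k)"
    using False by (subst ln_le_cancel_iff) auto
  moreover have "ln (2 * real k) = ln 2 + ln (real k)"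
    using False by (simp add: ln_mult)
  moreover have "ln (2::real) \<le> 1"
    using ln_2_less_1 by simp
  ultimately show ?thesis
    using * LL_ge_1[of "real n"] unfolding dy_log_def by linarith
qed

lemma dy_scale_le:
  assumes "2 ^ k \<le> n"
  shows "dy_scale k \<le> 2 * sqrt (real n * LL (real n))"
proof -
  have "2 ^ k * dy_log k \<le> real n * (4 * LL (real n))"
    using assms two_power_le_real[OF assms] dy_log_pos[of k] LL_ge_1[of "real n"]
    by (intro mult_mono dy_log_le_LL) auto
  then have "dy_scale k \<le> sqrt (4 * (real n * LL (real n)))"
    unfolding dy_scale_def by (intro real_sqrt_le_mono) simp
  then show ?thesis
    by (simp add: real_sqrt_mult)
qed

text \<open>The levels grow geometrically although \<open>dy_log\<close> grows too. One step adds at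
  most \<open>ln 2 \<le> 7 / 10\<close> to \<open>dy_log k \<ge> 1\<close>, a factor of at most
  \<open>17 / 10\<close>, whereas \<open>2 ^ k\<close> doubles; the quotient of the two factors is
  \<open>20 / 17 > 1\<close>.\<close>

lemma dy_trunc_Suc: "(20 / 17) powr (1 / 2) * dy_trunc k \<le> dy_trunc (Suc k)"
proof -
  have "dy_log (Suc k) \<le> (17 / 10) * dy_log k"
  proof -
    have "ln (real k + 2) \<le> ln (2 * (real k + 1))"
      by (subst ln_le_cancel_iff) auto
    also have "\<dots> = ln 2 + ln (real k + 1)"
      by (subst ln_mult) auto
    also have "ln 2 \<le> (7 / 10 :: real)"
      using ln2_le_25_over_36 by simp
    finally have "dy_log (Suc k) \<le> dy_log k + 7 / 10"
      by (simp add: dy_log_def add_ac)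
    then show ?thesis
      using dy_log_ge_1[of k] by linarith
  qed
  then have "(20 / 17) * (2 ^ k / dy_log k) \<le> 2 ^ Suc k / dy_log (Suc k)"
    using dy_log_pos[of k] dy_log_pos[of "Suc k"] by (simp add: field_simps)
  then have "sqrt ((20 / 17) * (2 ^ k / dy_log k)) \<le> dy_trunc (Suc k)"
    unfolding dy_trunc_def by (rule real_sqrt_le_mono)
  then show ?thesis
    by (simp add: dy_trunc_def real_sqrt_mult powr_half_sqrt real_sqrt_divide)
qed

lemma dy_trunc_mono: "j \<le> k \<Longrightarrow> dy_trunc j \<le> dy_trunc k"
proof (rule lift_Suc_mono_le[of dy_trunc])
  fix k
  have "1 * dy_trunc k \<le> (20 / 17) powr (1 / 2) * dy_trunc k"
    using dy_trunc_pos[of k] by (intro mult_right_mono ge_one_powr_ge_zero) auto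
  then show "dy_trunc k \<le> dy_trunc (Suc k)"
    using dy_trunc_Suc[of k] by simp
qed

text \<open>For terms growing at least by the ratio \<open>\<rho> = (20 / 17) powr (q / 2)\<close>,
  the last term counts 1 and all earlier ones together at most \<open>1 / (\<rho> - 1)\<close> of
  it.\<close>

definition geo_const :: "real \<Rightarrow> real" where
  "geo_const q = 1 + 1 / ((20 / 17) powr (q / 2) - 1)"

lemma geo_const_denom_pos: "0 < q \<Longrightarrow> 0 < (20 / 17 :: real) powr (q / 2) - 1"
  by simp

lemma geo_const_ge_1: "0 < q \<Longrightarrow> 1 \<le> geo_const q"
  using divide_nonneg_pos[OF zero_le_one geo_const_denom_pos[of q]]
  unfolding geo_const_def by linarith

lemma sum_dy_trunc_le:
  assumes q: "0 < q" and z: "0 \<le> z"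
  shows "(\<Sum>k\<in>{k. k < K \<and> dy_trunc k < z}. dy_trunc k powr q) \<le> geo_const q * z powr q"
proof -
  define \<rho> where "\<rho> = (20 / 17 :: real) powr (q / 2)"
  have \<rho>: "1 < \<rho>"
    using geo_const_denom_pos[OF q] by (simp add: \<rho>_def)
  have step: "\<rho> * dy_trunc k powr q \<le> dy_trunc (Suc k) powr q" for k
  proof -
    have "\<rho> * dy_trunc k powr q = ((20 / 17) powr (1 / 2) * dy_trunc k) powr q"
      by (simp add: \<rho>_def powr_mult powr_powr dy_trunc_pos less_imp_le)
    also have "\<dots> \<le> dy_trunc (Suc k) powr q"
      using q by (intro powr_mono2 dy_trunc_Suc) (auto simp: dy_trunc_pos less_imp_le)
    finally show ?thesis .
  qed
  \<comment> \<open>The bound is stated against the next term \<open>dy_trunc n\<close>, so that the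
    induction closes through \<open>1 / (\<rho> - 1) + 1 = \<rho> / (\<rho> - 1)\<close>.\<close>
  have geo: "(\<Sum>k<n. dy_trunc k powr q) \<le> 1 / (\<rho> - 1) * dy_trunc n powr q" for n
  proof (induction n)
    case 0
    then show ?case using \<rho> by simp
  next
    case (Suc n)
    have "(\<Sum>k<Suc n. dy_trunc k powr q) \<le> (1 / (\<rho> - 1) + 1) * dy_trunc n powr q"
      using Suc by (simp add: algebra_simps)
    also have "1 / (\<rho> - 1) + 1 = 1 / (\<rho> - 1) * \<rho>"
      using \<rho> by (simp add: field_simps)
    also have "1 / (\<rho> - 1) * \<rho> * dy_trunc n powr q = 1 / (\<rho> - 1) * (\<rho> * dy_trunc n powr q)"
      by simp
    also have "\<dots> \<le> 1 / (\<rho> - 1) * dy_trunc (Suc n) powr q"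
      using \<rho> step[of n] by (intro mult_left_mono) auto
    finally show ?case .
  qed
  define S where "S = {k. k < K \<and> dy_trunc k < z}"
  show ?thesis
  proof (cases "S = {}")
    case True
    then show ?thesis
      using geo_const_ge_1[OF q] by (simp add: S_def[symmetric])
  next
    case False
    have fin: "finite S"
      by (simp add: S_def)
    define m where "m = Max S"
    have m: "m \<in> S" "S \<subseteq> {..<Suc m}"
      using Max_in[OF fin False] Max_ge[OF fin] by (auto simp: m_def le_imp_less_Suc)
    have "(\<Sum>k\<in>S. dy_trunc k powr q) \<le> (\<Sum>k<Suc m. dy_trunc k powr q)"
      using m by (intro sum_mono2) auto
    also have "\<dots> \<le> geo_const q * dy_trunc m powr q"
      using geo[of m] by (simp add: geo_const_def \<rho>_def algebra_simps)
    also have "\<dots> \<le> geo_const q * z powr q"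
      using m q geo_const_ge_1[OF q]
      by (intro mult_left_mono powr_mono2) (auto simp: S_def dy_trunc_pos less_imp_le)
    finally show ?thesis
      by (simp add: S_def)
  qed
qed

text \<open>Indices start at 0 while blocks are those of \<open>Suc r\<close>: exactly
  \<open>2 ^ k\<close> values of \<open>r\<close>, from \<open>2 ^ k - 1\<close> to
  \<open>2 ^ Suc k - 2\<close>, have \<open>floor_log (Suc r) = k\<close>.\<close>

lemma sum_dyadic_blocks:
  fixes \<Phi> :: "nat \<Rightarrow> real"
  shows "(\<Sum>r<2 ^ K - 1. \<Phi> (floor_log (Suc r))) = (\<Sum>k<K. 2 ^ k * \<Phi> k)"
proof (induction K)
  case (Suc K)
  have "{..<2 ^ Suc K - 1} = {..<2 ^ K - 1} \<union> {2 ^ K - 1..<2 ^ Suc K - 1 :: nat}"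
    by (intro ivl_disj_un_one[symmetric]) auto
  moreover have "{..<2 ^ K - 1} \<inter> {2 ^ K - 1..<2 ^ Suc K - 1 :: nat} = {}"
    by auto
  ultimately have "(\<Sum>r<2 ^ Suc K - 1. \<Phi> (floor_log (Suc r)))
      = (\<Sum>r<2 ^ K - 1. \<Phi> (floor_log (Suc r))) + (\<Sum>r\<in>{2 ^ K - 1..<2 ^ Suc K - 1}. \<Phi> (floor_log (Suc r)))"
    by (simp only: sum.union_disjoint finite_lessThan finite_atLeastLessThan)
  also have "(\<Sum>r\<in>{2 ^ K - 1..<2 ^ Suc K - 1}. \<Phi> (floor_log (Suc r)))
      = (\<Sum>r\<in>{2 ^ K - 1..<2 ^ Suc K - 1 :: nat}. \<Phi> K)"
    by (intro sum.cong refl arg_cong[where f = \<Phi>] floor_log_eqI) auto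
  also have "\<dots> = 2 ^ K * \<Phi> K"
  proof -
    have "(2 ^ Suc K - 1) - (2 ^ K - 1) = (2 ^ K :: nat)"
      by simp
    then show ?thesis
      by (simp only: sum_constant card_atLeastLessThan) simp
  qed
  finally show ?case
    using Suc by simp
qed simp

section \<open>The excess over the truncation level\<close>

definition dy_excess :: "nat \<Rightarrow> real \<Rightarrow> real" where
  "dy_excess r z = (if dy_trunc (floor_log (Suc r)) < \<bar>z\<bar> then \<bar>z\<bar> else 0)"

lemma dy_excess_nonneg: "0 \<le> dy_excess r z"
  by (simp add: dy_excess_def)

lemma measurable_dy_excess [measurable]: "dy_excess r \<in> borel_measurable borel"
  unfolding dy_excess_def by measurable

text \<open>Block \<open>k\<close> consists of \<open>2 ^ k\<close> equal terms, which together are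
  at most \<open>\<bar>z\<bar> powr q * dy_trunc k powr (2 - q)\<close>, and it counts only if
  \<open>dy_trunc k < \<bar>z\<bar>\<close>. The geometric growth of the levels sums the second
  factors to a multiple of \<open>\<bar>z\<bar> powr (2 - q)\<close>. Pointwise in \<open>z\<close>,
  so that one expectation settles the whole series.\<close>

lemma sum_dy_excess_le:
  assumes q: "1 \<le> q" "q < 2"
  shows "(\<Sum>r<n. (dy_excess r z / dy_scale (floor_log (Suc r))) powr q) \<le> geo_const (2 - q) * z\<^sup>2"
proof -
  define \<Phi> where "\<Phi> k = (if dy_trunc k < \<bar>z\<bar> then (\<bar>z\<bar> / dy_scale k) powr q else 0)" for k
  have "n \<le> 2 ^ n - 1"
    using less_exp[of n] by linarith
  then have "(\<Sum>r<n. (dy_excess r z / dy_scale (floor_log (Suc r))) powr q)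
      \<le> (\<Sum>r<2 ^ n - 1. (dy_excess r z / dy_scale (floor_log (Suc r))) powr q)"
    by (intro sum_mono2) auto
  also have "\<dots> = (\<Sum>r<2 ^ n - 1. \<Phi> (floor_log (Suc r)))"
    by (intro sum.cong refl) (simp add: dy_excess_def \<Phi>_def)
  also have "\<dots> = (\<Sum>k<n. 2 ^ k * \<Phi> k)"
    by (rule sum_dyadic_blocks)
  also have "\<dots> \<le> (\<Sum>k<n. if dy_trunc k < \<bar>z\<bar> then \<bar>z\<bar> powr q * dy_trunc k powr (2 - q) else 0)"
  proof (intro sum_mono)
    fix k
    define l where "l = dy_log k"
    have l: "1 \<le> l" by (simp add: l_def dy_log_ge_1)
    have "2 ^ k * (1 / dy_scale k) powr q = 2 ^ k * (1 / (2 ^ k * l)) powr (q / 2)"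
      using l by (simp add: dy_scale_def l_def powr_half_sqrt[symmetric] powr_powr powr_divide powr_mult)
    also have "\<dots> = (2 ^ k) powr (1 - q / 2) * l powr (- (q / 2))"
    proof -
      have "(1 / (2 ^ k * l)) powr (q / 2) = (2 ^ k) powr (- (q / 2)) * l powr (- (q / 2))"
        using l by (simp add: powr_divide powr_mult powr_minus field_simps)
      moreover have "2 ^ k * (2 ^ k) powr (- (q / 2)) = (2 ^ k :: real) powr (1 - q / 2)"
        by (subst powr_mult_base) auto
      ultimately show ?thesis
        by (simp add: mult.assoc[symmetric])
    qed
    \<comment> \<open>Both \<open>q \<ge> 1\<close> and \<open>l \<ge> 1\<close> enter here: the
      exponent of \<open>l\<close> rises from \<open>- q / 2\<close> to
      \<open>- (1 - q / 2)\<close>, which turns the expression into a power of the level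
      \<open>2 ^ k / l\<close>.\<close>
    also have "\<dots> \<le> (2 ^ k) powr (1 - q / 2) * l powr (- (1 - q / 2))"
      using l q by (intro mult_left_mono powr_mono) auto
    also have "\<dots> = (2 ^ k / l) powr (1 - q / 2)"
      using l by (simp add: powr_divide powr_minus field_simps)
    also have "\<dots> = dy_trunc k powr (2 - q)"
      using l by (simp add: dy_trunc_def l_def powr_half_sqrt[symmetric] powr_powr diff_divide_distrib)
    finally have *: "2 ^ k * (1 / dy_scale k) powr q \<le> dy_trunc k powr (2 - q)" .
    have "2 ^ k * (\<bar>z\<bar> / dy_scale k) powr q = \<bar>z\<bar> powr q * (2 ^ k * (1 / dy_scale k) powr q)"
      using dy_scale_pos[of k] by (simp add: powr_divide)
    also have "\<dots> \<le> \<bar>z\<bar> powr q * dy_trunc k powr (2 - q)"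
      by (intro mult_left_mono *) auto
    finally show "2 ^ k * \<Phi> k
        \<le> (if dy_trunc k < \<bar>z\<bar> then \<bar>z\<bar> powr q * dy_trunc k powr (2 - q) else 0)"
      by (simp add: \<Phi>_def)
  qed
  also have "\<dots> = \<bar>z\<bar> powr q * (\<Sum>k\<in>{k. k < n \<and> dy_trunc k < \<bar>z\<bar>}. dy_trunc k powr (2 - q))"
  proof -
    have "{k. k < n \<and> dy_trunc k < \<bar>z\<bar>} = {k\<in>{..<n}. dy_trunc k < \<bar>z\<bar>}"
      by auto
    then show ?thesis
      by (simp only: sum.inter_filter finite_lessThan sum_distrib_left) (intro sum.cong refl, simp)
  qed
  also have "\<dots> \<le> \<bar>z\<bar> powr q * (geo_const (2 - q) * \<bar>z\<bar> powr (2 - q))"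
    using q by (intro mult_left_mono sum_dy_trunc_le) auto
  also have "\<dots> = geo_const (2 - q) * (\<bar>z\<bar> powr q * \<bar>z\<bar> powr (2 - q))"
    by simp
  also have "\<bar>z\<bar> powr q * \<bar>z\<bar> powr (2 - q) = z\<^sup>2"
    by (cases "z = 0") (auto simp: powr_numeral simp flip: powr_add)
  finally show ?thesis .
qed

text \<open>The exponent is split as \<open>(j + 1) / 2 * dy_log k\<close> plus
  \<open>2 * dy_log k\<close>. The first part decays in \<open>j\<close> because
  \<open>dy_log k \<ge> 1\<close>; the second yields \<open>1 / (k + 1)^2\<close>, because
  \<open>dy_log k\<close> contains \<open>ln (k + 1)\<close>. The exponential is traded for a fourth
  power, which beats \<open>(j + 7)^2\<close>, and \<open>8192 = 2 * 8^4\<close>.\<close>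

lemma exp_dy_log_le:
  "2 * (real j + 7)\<^sup>2 * exp (- ((real j + 5) * dy_log k / 2))
     \<le> 8192 * (1 / (real j + 1)\<^sup>2) * (1 / (real k + 1)\<^sup>2)"
proof -
  have "(1 + ((real j + 1) / 2) / real 4) ^ 4 \<le> exp ((real j + 1) / 2)"
    by (rule exp_ge_one_plus_x_over_n_power_n) auto
  moreover have "1 + ((real j + 1) / 2) / real 4 = (real j + 9) / 8"
    by simp
  ultimately have e: "((real j + 9) / 8) ^ 4 \<le> exp ((real j + 1) / 2)"
    by (simp only:)
  have "exp (- ((real j + 5) * dy_log k / 2)) = exp (- ((real j + 1) * dy_log k / 2)) * exp (- (2 * dy_log k))"
    by (simp add: mult_exp_exp field_simps)
  also have "\<dots> \<le> 1 / ((real j + 9) / 8) ^ 4 * (1 / (real k + 1)\<^sup>2)"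
  proof (intro mult_mono)
    have "exp (- ((real j + 1) * dy_log k / 2)) \<le> exp (- ((real j + 1) / 2))"
      using mult_left_mono[OF dy_log_ge_1[of k], of "real j + 1"]
      by (subst exp_le_cancel_iff) linarith
    also have "\<dots> \<le> 1 / ((real j + 9) / 8) ^ 4"
      unfolding exp_minus inverse_eq_divide using e by (intro divide_left_mono) auto
    finally show "exp (- ((real j + 1) * dy_log k / 2)) \<le> 1 / ((real j + 9) / 8) ^ 4" .
    have "exp (- (2 * dy_log k)) \<le> exp (- (2 * ln (real k + 1)))"
      by (simp add: dy_log_def)
    also have "\<dots> = 1 / (real k + 1)\<^sup>2"
      by (simp add: exp_minus exp_double field_simps)
    finally show "exp (- (2 * dy_log k)) \<le> 1 / (real k + 1)\<^sup>2" .
  qed auto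
  finally have "2 * (real j + 7)\<^sup>2 * exp (- ((real j + 5) * dy_log k / 2))
      \<le> 2 * (real j + 7)\<^sup>2 * (1 / ((real j + 9) / 8) ^ 4 * (1 / (real k + 1)\<^sup>2))"
    by (intro mult_left_mono) auto
  also have "\<dots> = 2 * (real j + 7)\<^sup>2 * (1 / ((real j + 9) / 8) ^ 4) * (1 / (real k + 1)\<^sup>2)"
    by simp
  also have "\<dots> \<le> 8192 * (1 / (real j + 1)\<^sup>2) * (1 / (real k + 1)\<^sup>2)"
  proof (intro mult_right_mono)
    have "2 * (real j + 7)\<^sup>2 * (1 / ((real j + 9) / 8) ^ 4) = 8192 * ((real j + 7)\<^sup>2 / (real j + 9) ^ 4)"
      by (simp add: power_divide)
    also have "(real j + 7)\<^sup>2 / (real j + 9) ^ 4 \<le> (real j + 9)\<^sup>2 / (real j + 9) ^ 4"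
      by (intro divide_right_mono power_mono) auto
    also have "\<dots> = 1 / (real j + 9)\<^sup>2"
      by (simp add: power4_eq_xxxx power2_eq_square)
    also have "\<dots> \<le> 1 / (real j + 1)\<^sup>2"
      by (intro divide_left_mono power_mono) auto
    finally show "2 * (real j + 7)\<^sup>2 * (1 / ((real j + 9) / 8) ^ 4) \<le> 8192 * (1 / (real j + 1)\<^sup>2)"
      by simp
  qed auto
  finally show ?thesis .
qed

lemma suminf_inverse_squares_le: "(\<Sum>k. ennreal (1 / (real k + 1)\<^sup>2)) \<le> 3"
proof -
  have "(\<Sum>k. ennreal (1 / (real k + 1)\<^sup>2)) = ennreal (pi\<^sup>2 / 6)"
    using inverse_squares_sums by (intro suminf_ennreal_eq) (auto simp: add_ac)
  also have "\<dots> \<le> ennreal 3"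
  proof (intro ennreal_leI)
    have "pi\<^sup>2 \<le> 4\<^sup>2"
      using pi_less_4 pi_gt_zero by (intro power_mono) auto
    then show "pi\<^sup>2 / 6 \<le> 3"
      by simp
  qed
  finally show ?thesis
    by simp
qed

section \<open>Bounded law of the iterated logarithm for i.i.d. sequences\<close>

text \<open>The summands are the bounds for the truncated part (600, twice its L2 bound 300), for
  the sum of the excesses, and for the sum of their means. The outer 2 comes from
  \<open>dy_scale_le\<close>.\<close>

definition lil_const :: "real \<Rightarrow> real" where
  "lil_const p = 2 * (600 + (2 * geo_const (2 - p) + geo_const 1 * (1 + 2 * geo_const 1)) + geo_const 1)"

lemma ennreal_le_suminf: "(f :: nat \<Rightarrow> ennreal) i \<le> suminf f"
  using sum_le_suminf[of f "{i}"] by simp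

lemma (in prob_space) Lp_norm_const: "0 < p \<Longrightarrow> Lp_norm M p (\<lambda>_. c) = c"
  by (simp add: Lp_norm_def emeasure_space_1 ennpowr_ennpowr)

locale iid_normalized = prob_space +
  fixes Z :: "nat \<Rightarrow> 'a \<Rightarrow> real"
  assumes indep: "indep_vars (\<lambda>_. borel) Z UNIV"
    and ident: "\<And>r. distr M borel (Z r) = distr M borel (Z 0)"
    and square_int0: "integrable M (\<lambda>\<omega>. (Z 0 \<omega>)\<^sup>2)"
    and var_le_1: "expectation (\<lambda>\<omega>. (Z 0 \<omega>)\<^sup>2) \<le> 1"
    and mean0: "expectation (Z 0) = 0"
begin

lemma rv [measurable]: "Z r \<in> borel_measurable M"
  using indep by (auto simp: indep_vars_def)

lemma nn_integral_ident:
  assumes [measurable]: "\<phi> \<in> borel_measurable borel"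
  shows "(\<integral>\<^sup>+\<omega>. \<phi> (Z r \<omega>) \<partial>M) = (\<integral>\<^sup>+\<omega>. \<phi> (Z 0 \<omega>) \<partial>M)"
proof -
  have "(\<integral>\<^sup>+\<omega>. \<phi> (Z r \<omega>) \<partial>M) = (\<integral>\<^sup>+z. \<phi> z \<partial>distr M borel (Z r))"
    by (simp add: nn_integral_distr)
  also have "\<dots> = (\<integral>\<^sup>+\<omega>. \<phi> (Z 0 \<omega>) \<partial>M)"
    by (subst ident) (simp add: nn_integral_distr)
  finally show ?thesis .
qed

lemma integral_ident:
  fixes \<phi> :: "real \<Rightarrow> real"
  assumes [measurable]: "\<phi> \<in> borel_measurable borel"
  shows "expectation (\<lambda>\<omega>. \<phi> (Z r \<omega>)) = expectation (\<lambda>\<omega>. \<phi> (Z 0 \<omega>))"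
proof -
  have "expectation (\<lambda>\<omega>. \<phi> (Z r \<omega>)) = (\<integral>z. \<phi> z \<partial>distr M borel (Z r))"
    by (simp add: integral_distr)
  also have "\<dots> = expectation (\<lambda>\<omega>. \<phi> (Z 0 \<omega>))"
    by (subst ident) (simp add: integral_distr)
  finally show ?thesis .
qed

lemma integrable_ident:
  fixes \<phi> :: "real \<Rightarrow> real"
  assumes [measurable]: "\<phi> \<in> borel_measurable borel"
  shows "integrable M (\<lambda>\<omega>. \<phi> (Z r \<omega>)) \<longleftrightarrow> integrable M (\<lambda>\<omega>. \<phi> (Z 0 \<omega>))"
proof -
  have "integrable M (\<lambda>\<omega>. \<phi> (Z r \<omega>)) \<longleftrightarrow> integrable (distr M borel (Z r)) \<phi>"
    by (simp add: integrable_distr_eq)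
  also have "\<dots> \<longleftrightarrow> integrable M (\<lambda>\<omega>. \<phi> (Z 0 \<omega>))"
    by (subst ident) (simp add: integrable_distr_eq)
  finally show ?thesis .
qed

lemma square_integrable: "integrable M (\<lambda>\<omega>. (Z r \<omega>)\<^sup>2)"
  using integrable_ident[of "\<lambda>z. z\<^sup>2" r] square_int0 by simp

lemma integrable: "integrable M (Z r)"
  by (rule square_integrable_imp_integrable[OF _ square_integrable]) simp

lemma second_moment: "expectation (\<lambda>\<omega>. (Z r \<omega>)\<^sup>2) \<le> 1"
  using integral_ident[of "\<lambda>z. z\<^sup>2" r] var_le_1 by simp

lemma mean: "expectation (Z r) = 0"
  using integral_ident[of "\<lambda>z. z" r] mean0 by simp

text \<open>Each term is divided by the scale of its own block, not by that of \<open>n\<close>. As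
  the scales increase, this only enlarges the terms with \<open>r < n\<close>, and the sum over all
  \<open>r\<close> is a bound free of \<open>n\<close>.\<close>

definition excess :: "nat \<Rightarrow> 'a \<Rightarrow> real" where
  "excess r \<omega> = dy_excess r (Z r \<omega>) / dy_scale (floor_log (Suc r))"

lemma excess_nonneg: "0 \<le> excess r \<omega>"
  by (simp add: excess_def dy_excess_nonneg dy_scale_pos less_imp_le)

lemma measurable_excess [measurable]: "excess r \<in> borel_measurable M"
  unfolding excess_def by measurable

text \<open>Identical distribution replaces every \<open>Z r\<close> by \<open>Z 0\<close>, so the
  sum over \<open>r\<close> moves inside a single expectation, where \<open>sum_dy_excess_le\<close>
  bounds it by a multiple of \<open>(Z 0)\<^sup>2\<close>.\<close>

lemma sum_excess_moment:
  assumes "1 \<le> q" "q < 2"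
  shows "(\<Sum>r<n. \<integral>\<^sup>+\<omega>. ennreal (excess r \<omega> powr q) \<partial>M) \<le> ennreal (geo_const (2 - q))"
proof -
  have "(\<Sum>r<n. \<integral>\<^sup>+\<omega>. ennreal (excess r \<omega> powr q) \<partial>M)
      = (\<Sum>r<n. \<integral>\<^sup>+\<omega>. ennreal ((dy_excess r (Z 0 \<omega>) / dy_scale (floor_log (Suc r))) powr q) \<partial>M)"
    unfolding excess_def
    by (intro sum.cong refl nn_integral_ident[where
        \<phi> = "\<lambda>z. ennreal ((dy_excess _ z / dy_scale (floor_log (Suc _))) powr q)"]) measurable
  also have "\<dots> = (\<integral>\<^sup>+\<omega>. ennreal (\<Sum>r<n. (dy_excess r (Z 0 \<omega>) / dy_scale (floor_log (Suc r))) powr q) \<partial>M)"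
    by (simp add: nn_integral_sum flip: sum_ennreal)
  also have "\<dots> \<le> (\<integral>\<^sup>+\<omega>. ennreal (geo_const (2 - q) * (Z 0 \<omega>)\<^sup>2) \<partial>M)"
    using assms by (intro nn_integral_mono ennreal_leI sum_dy_excess_le)
  also have "\<dots> = ennreal (geo_const (2 - q) * expectation (\<lambda>\<omega>. (Z 0 \<omega>)\<^sup>2))"
    using square_int0 geo_const_ge_1[of "2 - q"] assms by (subst nn_integral_eq_integral) auto
  also have "\<dots> \<le> ennreal (geo_const (2 - q) * 1)"
    using var_le_1 geo_const_ge_1[of "2 - q"] assms by (intro ennreal_leI mult_left_mono) auto
  finally show ?thesis
    by simp
qed

lemma sum_excess_mean: "(\<Sum>r<n. \<integral>\<^sup>+\<omega>. ennreal (excess r \<omega>) \<partial>M) \<le> ennreal (geo_const 1)"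
  using sum_excess_moment[of 1 n] by (simp add: excess_nonneg)

lemma Lp_norm_suminf_excess:
  assumes p: "1 \<le> p" "p < 2"
  shows "Lp_norm M p (\<lambda>\<omega>. \<Sum>r. ennreal (excess r \<omega>))
    \<le> ennreal (2 * geo_const (2 - p) + geo_const 1 * (1 + 2 * geo_const 1))" (is "_ \<le> ennreal ?C")
proof -
  have g: "1 \<le> geo_const 1" "1 \<le> geo_const (2 - p)"
    using p by (auto intro: geo_const_ge_1)
  have C: "1 \<le> ?C"
    using g mult_mono[of 1 "geo_const 1" 1 "1 + 2 * geo_const 1"] by simp
  have indep_excess: "indep_vars (\<lambda>_. borel) excess UNIV"
    unfolding excess_def
    by (rule indep_vars_compose2[OF indep, of "\<lambda>r z. dy_excess r z / dy_scale (floor_log (Suc r))"]) auto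
  have "Lp_norm M p (\<lambda>\<omega>. \<Sum>r<n. ennreal (excess r \<omega>)) \<le> ennreal ?C" for n
  proof -
    have "(\<integral>\<^sup>+\<omega>. ennpowr (\<Sum>r<n. ennreal (excess r \<omega>)) p \<partial>M)
        = (\<integral>\<^sup>+\<omega>. ennreal ((\<Sum>r<n. excess r \<omega>) powr p) \<partial>M)"
      by (simp add: excess_nonneg sum_nonneg ennpowr_ennreal)
    also have "\<dots> \<le> 2 * (\<Sum>r<n. \<integral>\<^sup>+\<omega>. ennreal (excess r \<omega> powr p) \<partial>M)
      + (\<Sum>r<n. \<integral>\<^sup>+\<omega>. ennreal (excess r \<omega>) \<partial>M) * (1 + 2 * (\<Sum>r<n. \<integral>\<^sup>+\<omega>. ennreal (excess r \<omega>) \<partial>M))"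
      by (rule powr_sum_nonneg_indep[OF p indep_excess excess_nonneg])
    also have "\<dots> \<le> 2 * ennreal (geo_const (2 - p))
      + ennreal (geo_const 1) * (1 + 2 * ennreal (geo_const 1))"
      using p by (intro add_mono mult_mono sum_excess_moment sum_excess_mean) auto
    also have "\<dots> = ennreal ?C"
      using g by (simp add: ennreal_mult)
    \<comment> \<open>As \<open>?C \<ge> 1\<close> and \<open>p \<ge> 1\<close>, the moment bound
      serves as norm bound without taking a root.\<close>
    also have "\<dots> \<le> ennreal (?C powr p)"
      using powr_mono[of 1 p ?C] C p by (intro ennreal_leI) auto
    finally show ?thesis
      using C p by (subst Lp_norm_le_iff) auto
  qed
  then have "(SUP n. Lp_norm M p (\<lambda>\<omega>. \<Sum>r<n. ennreal (excess r \<omega>))) \<le> ennreal ?C"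
    by (rule SUP_least)
  then show ?thesis
    unfolding suminf_eq_SUP using p
    by (subst Lp_norm_SUP) (auto simp: incseq_def intro!: sum_mono2)
qed

section \<open>The truncated and recentred variables\<close>

definition trunc :: "nat \<Rightarrow> real \<Rightarrow> real" where
  "trunc r z = (if \<bar>z\<bar> \<le> dy_trunc (floor_log (Suc r)) then z else 0)"

lemma measurable_trunc [measurable]: "trunc r \<in> borel_measurable borel"
  unfolding trunc_def by measurable

definition centred :: "nat \<Rightarrow> 'a \<Rightarrow> real" where
  "centred r \<omega> = trunc r (Z r \<omega>) - expectation (\<lambda>\<omega>. trunc r (Z r \<omega>))"

lemma measurable_centred [measurable]: "centred r \<in> borel_measurable M"
  unfolding centred_def by measurable

lemma abs_trunc_le: "\<bar>trunc r z\<bar> \<le> dy_trunc (floor_log (Suc r))"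
  by (simp add: trunc_def dy_trunc_pos less_imp_le)

lemma integrable_trunc: "integrable M (\<lambda>\<omega>. trunc r (Z r \<omega>))"
  using abs_trunc_le by (intro integrable_const_bound[of _ "dy_trunc (floor_log (Suc r))"]) auto

lemma integrable_dy_excess: "integrable M (\<lambda>\<omega>. dy_excess r (Z r \<omega>))"
  by (rule Bochner_Integration.integrable_bound[OF integrable]) (auto simp: dy_excess_def)

lemma centred_bounded: "\<bar>centred r \<omega>\<bar> \<le> 2 * dy_trunc (floor_log (Suc r))"
proof -
  have "\<bar>expectation (\<lambda>\<omega>. trunc r (Z r \<omega>))\<bar> \<le> expectation (\<lambda>\<omega>. \<bar>trunc r (Z r \<omega>)\<bar>)"
    by (rule integral_abs_bound)
  also have "\<dots> \<le> expectation (\<lambda>\<omega>. dy_trunc (floor_log (Suc r)))"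
    using integrable_trunc abs_trunc_le by (intro integral_mono) auto
  finally have "\<bar>expectation (\<lambda>\<omega>. trunc r (Z r \<omega>))\<bar> \<le> dy_trunc (floor_log (Suc r))"
    by (simp add: prob_space)
  then show ?thesis
    using abs_trunc_le[of r "Z r \<omega>"] unfolding centred_def by linarith
qed

lemma centred_mean: "expectation (centred r) = 0"
  unfolding centred_def using integrable_trunc by (simp add: prob_space)

lemma centred_second_moment: "expectation (\<lambda>\<omega>. (centred r \<omega>)\<^sup>2) \<le> 1"
proof -
  have int: "integrable M (\<lambda>\<omega>. (trunc r (Z r \<omega>))\<^sup>2)"
    by (rule Bochner_Integration.integrable_bound[OF square_integrable]) (auto simp: trunc_def)
  have "expectation (\<lambda>\<omega>. (centred r \<omega>)\<^sup>2)
      = expectation (\<lambda>\<omega>. (trunc r (Z r \<omega>))\<^sup>2) - (expectation (\<lambda>\<omega>. trunc r (Z r \<omega>)))\<^sup>2"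
    unfolding centred_def by (rule variance_eq[OF integrable_trunc int])
  also have "\<dots> \<le> expectation (\<lambda>\<omega>. (trunc r (Z r \<omega>))\<^sup>2)"
    by simp
  also have "\<dots> \<le> expectation (\<lambda>\<omega>. (Z r \<omega>)\<^sup>2)"
    by (intro integral_mono int square_integrable) (simp add: trunc_def)
  finally show ?thesis
    using second_moment[of r] by simp
qed

text \<open>Because \<open>Z r\<close> has mean 0, the mean of its truncation is minus the mean of
  the part cut off. Recentring therefore costs no more than the mean of the excess.\<close>

lemma abs_diff_centred_le:
  "\<bar>Z r \<omega> - centred r \<omega>\<bar> \<le> dy_excess r (Z r \<omega>) + expectation (\<lambda>\<omega>. dy_excess r (Z r \<omega>))"
proof -
  have *: "\<bar>Z r \<omega> - trunc r (Z r \<omega>)\<bar> = dy_excess r (Z r \<omega>)" for \<omega>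
    by (simp add: trunc_def dy_excess_def)
  have "expectation (\<lambda>\<omega>. trunc r (Z r \<omega>)) = - expectation (\<lambda>\<omega>. Z r \<omega> - trunc r (Z r \<omega>))"
    using integrable_trunc integrable mean by simp
  also have "\<bar>\<dots>\<bar> \<le> expectation (\<lambda>\<omega>. \<bar>Z r \<omega> - trunc r (Z r \<omega>)\<bar>)"
    by (simp add: integral_abs_bound)
  finally have "\<bar>expectation (\<lambda>\<omega>. trunc r (Z r \<omega>))\<bar> \<le> expectation (\<lambda>\<omega>. dy_excess r (Z r \<omega>))"
    by (simp add: *)
  then show ?thesis
    using *[of \<omega>] unfolding centred_def by linarith
qed

lemma centred_tail:
  "emeasure M {\<omega>\<in>space M. \<exists>N\<le>2 ^ Suc k - 1. (real j + 6) * dy_scale k \<le> \<bar>\<Sum>r<N. centred r \<omega>\<bar>}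
    \<le> ennreal (2 * exp (- ((real j + 5) * dy_log k / 2)))"
proof -
  \<comment> \<open>The largest parameter allowed by the bound \<open>2 * dy_trunc k\<close>. It
    makes \<open>2 ^ Suc k * t\<^sup>2\<close> and \<open>t * dy_scale k\<close> both equal to
    \<open>dy_log k / 2\<close>; this balance is what fixes the truncation level. The exponent
    becomes \<open>(1 - (j + 6)) * dy_log k / 2\<close>.\<close>
  define t where "t = 1 / (2 * dy_trunc k)"
  have small: "floor_log (Suc r) \<le> k" if "r < 2 ^ Suc k - 1" for r
  proof -
    have "2 ^ floor_log (Suc r) \<le> Suc r"
      by (rule floor_log_exp2_le) simp
    also have "\<dots> < 2 ^ Suc k"
      using that by simp
    finally show ?thesis
      using power_less_imp_less_exp[of "2::nat" "floor_log (Suc r)" "Suc k"] by simp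
  qed
  have "indep_vars (\<lambda>_. borel) centred UNIV"
    unfolding centred_def
    by (rule indep_vars_compose2[OF indep,
          of "\<lambda>r z. trunc r z - expectation (\<lambda>\<omega>. trunc r (Z r \<omega>))"]) auto
  moreover have "\<bar>centred r \<omega>\<bar> \<le> 2 * dy_trunc k" if "r < 2 ^ Suc k - 1" for r \<omega>
    using centred_bounded[of r \<omega>] dy_trunc_mono[OF small[OF that]] by linarith
  ultimately have "emeasure M {\<omega>\<in>space M. \<exists>N\<le>2 ^ Suc k - 1. (real j + 6) * dy_scale k \<le> \<bar>\<Sum>r<N. centred r \<omega>\<bar>}
      \<le> ennreal (2 * exp (real (2 ^ Suc k - 1) * t\<^sup>2 - t * ((real j + 6) * dy_scale k)))"
    using centred_mean centred_second_moment dy_trunc_pos[of k]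
    by (intro maximal_bernstein[where B = "2 * dy_trunc k"]) (auto simp: t_def)
  also have "\<dots> \<le> ennreal (2 * exp (- ((real j + 5) * dy_log k / 2)))"
  proof (intro ennreal_leI mult_left_mono)
    have l: "0 < dy_log k"
      by (rule dy_log_pos)
    have "t\<^sup>2 = dy_log k / (4 * 2 ^ k)"
      using l by (simp add: t_def dy_trunc_def power_divide power_mult_distrib)
    then have "real (2 ^ Suc k) * t\<^sup>2 = dy_log k / 2"
      by simp
    moreover have "real (2 ^ Suc k - 1) * t\<^sup>2 \<le> real (2 ^ Suc k) * t\<^sup>2"
      by (intro mult_right_mono) (auto simp del: of_nat_power)
    moreover have "t * dy_scale k = dy_log k / 2"
    proof -
      have "dy_scale k = dy_trunc k * dy_log k"
      proof -
        have "dy_trunc k * dy_log k = sqrt (2 ^ k / dy_log k * (dy_log k)\<^sup>2)"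
          unfolding dy_trunc_def real_sqrt_mult using l by (simp only: real_sqrt_abs abs_of_pos)
        also have "2 ^ k / dy_log k * (dy_log k)\<^sup>2 = 2 ^ k * dy_log k"
          using l by (simp add: power2_eq_square)
        finally show ?thesis
          by (simp add: dy_scale_def)
      qed
      then show ?thesis
        using dy_trunc_pos[of k] by (simp add: t_def)
    qed
    then have "t * ((real j + 6) * dy_scale k) = (real j + 6) * (dy_log k / 2)"
      by (metis mult.left_commute)
    ultimately have "real (2 ^ Suc k - 1) * t\<^sup>2 - t * ((real j + 6) * dy_scale k)
        \<le> dy_log k / 2 - (real j + 6) * (dy_log k / 2)"
      by linarith
    also have "\<dots> = - ((real j + 5) * dy_log k / 2)"
      by (simp add: field_simps)
    finally have "real (2 ^ Suc k - 1) * t\<^sup>2 - t * ((real j + 6) * dy_scale k)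
        \<le> - ((real j + 5) * dy_log k / 2)" .
    then show "exp (real (2 ^ Suc k - 1) * t\<^sup>2 - t * ((real j + 6) * dy_scale k))
        \<le> exp (- ((real j + 5) * dy_log k / 2))"
      by (simp only: exp_le_cancel_iff)
  qed simp
  finally show ?thesis .
qed

text \<open>Values are sorted by the block \<open>k\<close> of \<open>n\<close> and the integer part
  \<open>j + 6\<close> of the normalised sum: on \<open>E j k\<close> the square is at most
  \<open>(j + 7)\<^sup>2\<close>, and values below 6 contribute at most 36. The offset 6 leaves
  \<open>2 * dy_log k\<close> in the exponent, enough to sum over \<open>k\<close>. In total
  \<open>36 + 8192 * 9 \<le> 300\<^sup>2\<close>.\<close>

lemma L2_norm_sup_centred:
  "Lp_norm M 2 (\<lambda>\<omega>. SUP n\<in>{1..}. ennreal (\<bar>\<Sum>r<n. centred r \<omega>\<bar> / dy_scale (floor_log n))) \<le> 300"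
proof -
  define E where "E j k = {\<omega>\<in>space M. \<exists>N\<le>2 ^ Suc k - 1. (real j + 6) * dy_scale k \<le> \<bar>\<Sum>r<N. centred r \<omega>\<bar>}"
    for j k
  have [measurable]: "E j k \<in> sets M" for j k
    unfolding E_def by measurable
  define F where "F j k = (\<lambda>\<omega>. ennreal ((real j + 7)\<^sup>2) * indicator (E j k) \<omega>)" for j k
  have [measurable]: "F j k \<in> borel_measurable M" for j k
    unfolding F_def by measurable
  have pt: "ennpowr (SUP n\<in>{1..}. ennreal (\<bar>\<Sum>r<n. centred r \<omega>\<bar> / dy_scale (floor_log n))) 2
      \<le> 36 + (\<Sum>j. \<Sum>k. F j k \<omega>)" if \<omega>: "\<omega> \<in> space M" for \<omega>
    unfolding ennpowr_SUP[OF zero_less_numeral]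
  proof (rule SUP_least)
    fix n :: nat assume n: "n \<in> {1..}"
    define k where "k = floor_log n"
    define a where "a = \<bar>\<Sum>r<n. centred r \<omega>\<bar> / dy_scale k"
    have a: "0 \<le> a"
      by (simp add: a_def dy_scale_pos less_imp_le)
    have "ennreal (a\<^sup>2) \<le> 36 + (\<Sum>j. \<Sum>k. F j k \<omega>)"
    proof (cases "a < 6")
      case True
      have "a\<^sup>2 \<le> 6\<^sup>2"
        using a True by (intro power_mono) auto
      then have "ennreal (a\<^sup>2) \<le> ennreal 36"
        by (intro ennreal_leI) simp
      also have "\<dots> \<le> 36 + (\<Sum>j. \<Sum>k. F j k \<omega>)"
        by simp
      finally show ?thesis .
    next
      case False
      define j where "j = nat (\<lfloor>a\<rfloor> - 6)"
      have "6 \<le> \<lfloor>a\<rfloor>"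
        using False by (simp add: le_floor_iff)
      then have j: "real j + 6 \<le> a" "a \<le> real j + 7"
        by (auto simp: j_def of_nat_nat intro: less_imp_le) linarith+
      have "n < 2 ^ Suc k"
        unfolding k_def using floor_log_exp2_gt[of n] by simp
      then have "n \<le> 2 ^ Suc k - 1"
        by simp
      moreover have "(real j + 6) * dy_scale k \<le> \<bar>\<Sum>r<n. centred r \<omega>\<bar>"
        using j(1) dy_scale_pos[of k] by (simp add: a_def field_simps)
      ultimately have "\<omega> \<in> E j k"
        using \<omega> by (auto simp: E_def)
      then have "ennreal (a\<^sup>2) \<le> F j k \<omega>"
        using a j(2) by (auto simp: F_def intro!: ennreal_leI power_mono)
      also have "\<dots> \<le> (\<Sum>k. F j k \<omega>)"
        by (rule ennreal_le_suminf)
      also have "\<dots> \<le> (\<Sum>j. \<Sum>k. F j k \<omega>)"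
        by (rule ennreal_le_suminf)
      finally show ?thesis
        by (rule order_trans) simp
    qed
    then show "ennpowr (ennreal (\<bar>\<Sum>r<n. centred r \<omega>\<bar> / dy_scale (floor_log n))) 2
        \<le> 36 + (\<Sum>j. \<Sum>k. F j k \<omega>)"
      using a by (simp add: ennpowr_ennreal a_def k_def powr_numeral)
  qed
  have "(\<integral>\<^sup>+\<omega>. ennpowr (SUP n\<in>{1..}. ennreal (\<bar>\<Sum>r<n. centred r \<omega>\<bar> / dy_scale (floor_log n))) 2 \<partial>M)
      \<le> (\<integral>\<^sup>+\<omega>. 36 + (\<Sum>j. \<Sum>k. F j k \<omega>) \<partial>M)"
    by (intro nn_integral_mono pt)
  also have "\<dots> = 36 + (\<Sum>j. \<Sum>k. \<integral>\<^sup>+\<omega>. F j k \<omega> \<partial>M)"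
    by (simp add: nn_integral_add nn_integral_suminf emeasure_space_1)
  also have "\<dots> \<le> 36 + (\<Sum>j. \<Sum>k. ennreal 8192 * ennreal (1 / (real j + 1)\<^sup>2) * ennreal (1 / (real k + 1)\<^sup>2))"
  proof (intro add_left_mono suminf_le summableI)
    fix j k
    have "(\<integral>\<^sup>+\<omega>. F j k \<omega> \<partial>M) = ennreal ((real j + 7)\<^sup>2) * emeasure M (E j k)"
      by (simp add: F_def nn_integral_cmult_indicator)
    also have "\<dots> \<le> ennreal ((real j + 7)\<^sup>2) * ennreal (2 * exp (- ((real j + 5) * dy_log k / 2)))"
      unfolding E_def by (intro mult_left_mono centred_tail) simp
    also have "\<dots> = ennreal (2 * (real j + 7)\<^sup>2 * exp (- ((real j + 5) * dy_log k / 2)))"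
      by (simp add: ennreal_mult[symmetric] mult_ac)
    also have "\<dots> \<le> ennreal (8192 * (1 / (real j + 1)\<^sup>2) * (1 / (real k + 1)\<^sup>2))"
      by (intro ennreal_leI exp_dy_log_le)
    also have "\<dots> = ennreal 8192 * ennreal (1 / (real j + 1)\<^sup>2) * ennreal (1 / (real k + 1)\<^sup>2)"
      by (simp only: ennreal_mult zero_le_mult_iff zero_le_divide_iff zero_le_power2 zero_le_one zero_le_numeral simp_thms)
    finally show "(\<integral>\<^sup>+\<omega>. F j k \<omega> \<partial>M) \<le> \<dots>" .
  qed
  also have "\<dots> = 36 + ennreal 8192 * ((\<Sum>j. ennreal (1 / (real j + 1)\<^sup>2)) * (\<Sum>k. ennreal (1 / (real k + 1)\<^sup>2)))"
    by (simp only: ennreal_suminf_cmult ennreal_suminf_multc mult.assoc)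
  also have "\<dots> \<le> 36 + ennreal 8192 * (3 * 3)"
    by (intro add_left_mono mult_left_mono mult_mono suminf_inverse_squares_le) auto
  also have "\<dots> \<le> ennreal (300 powr 2)"
  proof -
    have "36 + ennreal 8192 * (3 * 3) = ennreal (36 + 8192 * (3 * 3))"
      by (subst ennreal_plus) (auto simp: ennreal_mult)
    then show ?thesis
      by (simp add: ennreal_leI)
  qed
  finally have "Lp_norm M 2 (\<lambda>\<omega>. SUP n\<in>{1..}. ennreal (\<bar>\<Sum>r<n. centred r \<omega>\<bar> / dy_scale (floor_log n)))
      \<le> ennreal 300"
    by (subst Lp_norm_le_iff) auto
  then show ?thesis
    by simp
qed

text \<open>Pointwise, the partial sum is at most the recentred one plus the excesses plus their
  means. Divided by the scale, the three parts are dominated by \<open>A\<close>, \<open>W\<close>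
  and the number \<open>c\<close>, none of which depends on \<open>n\<close>.\<close>

theorem Lp_norm_sup_partial_sums:
  assumes p: "1 \<le> p" "p < 2"
  shows "Lp_norm M p (\<lambda>\<omega>. SUP n\<in>{1..}. ennreal (\<bar>\<Sum>r<n. Z r \<omega>\<bar> / sqrt (real n * LL (real n))))
    \<le> ennreal (lil_const p)"
proof -
  define A where "A \<omega> = (SUP n\<in>{1..}. ennreal (\<bar>\<Sum>r<n. centred r \<omega>\<bar> / dy_scale (floor_log n)))" for \<omega>
  define W where "W \<omega> = (\<Sum>r. ennreal (excess r \<omega>))" for \<omega>
  define c where "c = (\<Sum>r. \<integral>\<^sup>+\<omega>. ennreal (excess r \<omega>) \<partial>M)"
  have [measurable]: "A \<in> borel_measurable M" "W \<in> borel_measurable M"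
    unfolding A_def W_def by measurable
  have mean_excess: "(\<integral>\<^sup>+\<omega>. ennreal (excess r \<omega>) \<partial>M)
      = ennreal (expectation (\<lambda>\<omega>. dy_excess r (Z r \<omega>)) / dy_scale (floor_log (Suc r)))" for r
    using integrable_dy_excess excess_nonneg unfolding excess_def
    by (subst nn_integral_eq_integral) auto
  have pt: "(SUP n\<in>{1..}. ennreal (\<bar>\<Sum>r<n. Z r \<omega>\<bar> / sqrt (real n * LL (real n)))) \<le> 2 * (A \<omega> + (W \<omega> + c))" for \<omega>
  proof (rule SUP_least)
    fix n :: nat assume n: "n \<in> {1..}"
    define k where "k = floor_log n"
    have scale: "0 < dy_scale k"
      by (rule dy_scale_pos)
    have "dy_scale k \<le> 2 * sqrt (real n * LL (real n))"
      unfolding k_def using n by (intro dy_scale_le floor_log_exp2_le) auto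
    then have "\<bar>\<Sum>r<n. Z r \<omega>\<bar> / sqrt (real n * LL (real n)) \<le> 2 * (\<bar>\<Sum>r<n. Z r \<omega>\<bar> / dy_scale k)"
    proof -
      have "\<bar>\<Sum>r<n. Z r \<omega>\<bar> / sqrt (real n * LL (real n)) = 2 * \<bar>\<Sum>r<n. Z r \<omega>\<bar> / (2 * sqrt (real n * LL (real n)))"
        by simp
      also have "\<dots> \<le> 2 * \<bar>\<Sum>r<n. Z r \<omega>\<bar> / dy_scale k"
      proof (intro divide_left_mono)
        show "dy_scale k \<le> 2 * sqrt (real n * LL (real n))"
          by fact
        then show "0 < 2 * sqrt (real n * LL (real n)) * dy_scale k"
          using scale by (intro mult_pos_pos) linarith+
      qed simp
      finally show ?thesis by simp
    qed
    also have "\<bar>\<Sum>r<n. Z r \<omega>\<bar> / dy_scale k \<le> \<bar>\<Sum>r<n. centred r \<omega>\<bar> / dy_scale k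
        + ((\<Sum>r<n. excess r \<omega>) + (\<Sum>r<n. expectation (\<lambda>\<omega>. dy_excess r (Z r \<omega>)) / dy_scale (floor_log (Suc r))))"
    proof -
      have "(\<Sum>r<n. Z r \<omega>) = (\<Sum>r<n. centred r \<omega>) + (\<Sum>r<n. Z r \<omega> - centred r \<omega>)"
        by (simp add: sum_subtractf)
      then have "\<bar>\<Sum>r<n. Z r \<omega>\<bar> \<le> \<bar>\<Sum>r<n. centred r \<omega>\<bar> + \<bar>\<Sum>r<n. Z r \<omega> - centred r \<omega>\<bar>"
        by linarith
      also have "\<bar>\<Sum>r<n. Z r \<omega> - centred r \<omega>\<bar> \<le> (\<Sum>r<n. \<bar>Z r \<omega> - centred r \<omega>\<bar>)"
        by (rule sum_abs)
      finally have "\<bar>\<Sum>r<n. Z r \<omega>\<bar> / dy_scale k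
          \<le> \<bar>\<Sum>r<n. centred r \<omega>\<bar> / dy_scale k + (\<Sum>r<n. \<bar>Z r \<omega> - centred r \<omega>\<bar> / dy_scale k)"
        using scale by (simp add: divide_right_mono flip: add_divide_distrib sum_divide_distrib)
      also have "(\<Sum>r<n. \<bar>Z r \<omega> - centred r \<omega>\<bar> / dy_scale k)
          \<le> (\<Sum>r<n. excess r \<omega> + expectation (\<lambda>\<omega>. dy_excess r (Z r \<omega>)) / dy_scale (floor_log (Suc r)))"
      proof (rule sum_mono)
        fix r assume "r \<in> {..<n}"
        then have "dy_scale (floor_log (Suc r)) \<le> dy_scale k"
          unfolding k_def by (intro dy_scale_mono floor_log_le_iff) auto
        moreover have "0 \<le> dy_excess r (Z r \<omega>) + expectation (\<lambda>\<omega>. dy_excess r (Z r \<omega>))"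
          using abs_diff_centred_le[of r \<omega>] by linarith
        ultimately have "\<bar>Z r \<omega> - centred r \<omega>\<bar> / dy_scale k
            \<le> (dy_excess r (Z r \<omega>) + expectation (\<lambda>\<omega>. dy_excess r (Z r \<omega>))) / dy_scale (floor_log (Suc r))"
          using dy_scale_pos by (intro frac_le abs_diff_centred_le) auto
        then show "\<bar>Z r \<omega> - centred r \<omega>\<bar> / dy_scale k
            \<le> excess r \<omega> + expectation (\<lambda>\<omega>. dy_excess r (Z r \<omega>)) / dy_scale (floor_log (Suc r))"
          by (simp add: excess_def add_divide_distrib)
      qed
      finally show ?thesis
        by (simp add: sum.distrib)
    qed
    finally have "ennreal (\<bar>\<Sum>r<n. Z r \<omega>\<bar> / sqrt (real n * LL (real n)))
        \<le> ennreal (2 * (\<bar>\<Sum>r<n. centred r \<omega>\<bar> / dy_scale k + ((\<Sum>r<n. excess r \<omega>)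
          + (\<Sum>r<n. expectation (\<lambda>\<omega>. dy_excess r (Z r \<omega>)) / dy_scale (floor_log (Suc r))))))"
      by (intro ennreal_leI) auto
    also have "\<dots> = 2 * (ennreal (\<bar>\<Sum>r<n. centred r \<omega>\<bar> / dy_scale k) + ((\<Sum>r<n. ennreal (excess r \<omega>))
          + (\<Sum>r<n. \<integral>\<^sup>+\<omega>. ennreal (excess r \<omega>) \<partial>M)))"
    proof -
      have e: "0 \<le> expectation (\<lambda>\<omega>. dy_excess r (Z r \<omega>)) / dy_scale (floor_log (Suc r))" for r
        using dy_scale_pos by (intro divide_nonneg_pos Bochner_Integration.integral_nonneg dy_excess_nonneg)
      show ?thesis
        unfolding mean_excess using e excess_nonneg scale
        by (subst ennreal_mult) (simp_all add: sum_nonneg)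
    qed
    also have "\<dots> \<le> 2 * (A \<omega> + (W \<omega> + c))"
      unfolding A_def W_def c_def k_def using n
      by (intro mult_left_mono add_mono SUP_upper sum_le_suminf summableI) auto
    finally show "ennreal (\<bar>\<Sum>r<n. Z r \<omega>\<bar> / sqrt (real n * LL (real n))) \<le> 2 * (A \<omega> + (W \<omega> + c))" .
  qed
  have A: "Lp_norm M p A \<le> 600"
  proof -
    have "Lp_norm M p A \<le> 2 * Lp_norm M 2 A"
      using p by (intro Lp_norm_le_L2_norm) auto
    also have "\<dots> \<le> 2 * 300"
      unfolding A_def by (intro mult_left_mono L2_norm_sup_centred) simp
    finally show ?thesis
      by simp
  qed
  have c: "c \<le> ennreal (geo_const 1)"
    unfolding c_def suminf_eq_SUP by (intro SUP_least sum_excess_mean)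
  have "Lp_norm M p (\<lambda>\<omega>. SUP n\<in>{1..}. ennreal (\<bar>\<Sum>r<n. Z r \<omega>\<bar> / sqrt (real n * LL (real n))))
      \<le> Lp_norm M p (\<lambda>\<omega>. 2 * (A \<omega> + (W \<omega> + c)))"
    using p by (intro Lp_norm_mono pt) auto
  also have "\<dots> = 2 * Lp_norm M p (\<lambda>\<omega>. A \<omega> + (W \<omega> + c))"
    using p by (intro Lp_norm_cmult) auto
  also have "\<dots> \<le> 2 * (Lp_norm M p A + (Lp_norm M p W + Lp_norm M p (\<lambda>_. c)))"
    using p by (intro mult_left_mono order_trans[OF Lp_norm_add_le add_left_mono[OF Lp_norm_add_le]]) auto
  also have "\<dots> \<le> 2 * (600 + (ennreal (2 * geo_const (2 - p) + geo_const 1 * (1 + 2 * geo_const 1)) + ennreal (geo_const 1)))"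
    using p A c Lp_norm_suminf_excess[OF p]
    by (intro mult_left_mono add_mono) (auto simp: W_def[abs_def] Lp_norm_const)
  also have "\<dots> = ennreal (lil_const p)"
  proof -
    have "0 \<le> geo_const 1" "0 \<le> geo_const (2 - p)"
      using geo_const_ge_1[of 1] geo_const_ge_1[of "2 - p"] p by auto
    then show ?thesis
      by (simp add: lil_const_def ennreal_mult add.assoc)
  qed
  finally show ?thesis .
qed

end

section \<open>Sums of m-dependent sequences\<close>

lemma (in prob_space) iid_Lp_norm_sup_partial_sums:
  fixes Z :: "nat \<Rightarrow> 'a \<Rightarrow> real"
  assumes p: "1 \<le> p" "p < 2" and \<sigma>: "0 < \<sigma>"
    and indep: "indep_vars (\<lambda>_. borel) Z UNIV"
    and ident: "\<And>r. distr M borel (Z r) = distr M borel (Z 0)"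
    and square_int: "integrable M (\<lambda>\<omega>. (Z 0 \<omega>)\<^sup>2)"
    and var: "expectation (\<lambda>\<omega>. (Z 0 \<omega>)\<^sup>2) \<le> \<sigma>\<^sup>2"
    and mean: "expectation (Z 0) = 0"
  shows "Lp_norm M p (\<lambda>\<omega>. SUP n\<in>{1..}. ennreal (\<bar>\<Sum>r<n. Z r \<omega>\<bar> / sqrt (real n * LL (real n))))
    \<le> ennreal (\<sigma> * lil_const p)"
proof -
  have [measurable]: "Z r \<in> borel_measurable M" for r
    using indep by (auto simp: indep_vars_def)
  interpret I: iid_normalized M "\<lambda>r \<omega>. Z r \<omega> / \<sigma>"
  proof
    show "indep_vars (\<lambda>_. borel) (\<lambda>r \<omega>. Z r \<omega> / \<sigma>) UNIV"
      by (rule indep_vars_compose2[OF indep, of "\<lambda>r z. z / \<sigma>"]) auto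
    show "distr M borel (\<lambda>\<omega>. Z r \<omega> / \<sigma>) = distr M borel (\<lambda>\<omega>. Z 0 \<omega> / \<sigma>)" for r
    proof -
      have "distr M borel (\<lambda>\<omega>. Z s \<omega> / \<sigma>) = distr (distr M borel (Z s)) borel (\<lambda>z. z / \<sigma>)" for s
        by (subst distr_distr) (auto simp: comp_def)
      then show ?thesis
        by (simp add: ident[of r])
    qed
    show "integrable M (\<lambda>\<omega>. (Z 0 \<omega> / \<sigma>)\<^sup>2)"
      using square_int by (simp add: power_divide)
    show "expectation (\<lambda>\<omega>. (Z 0 \<omega> / \<sigma>)\<^sup>2) \<le> 1"
      using var \<sigma> by (simp add: power_divide)
    show "expectation (\<lambda>\<omega>. Z 0 \<omega> / \<sigma>) = 0"
      using mean by simp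
  qed
  define Y where "Y n \<omega> = \<bar>\<Sum>r<n. Z r \<omega> / \<sigma>\<bar> / sqrt (real n * LL (real n))" for n \<omega>
  have [measurable]: "Y n \<in> borel_measurable M" for n
    unfolding Y_def by measurable
  have "Lp_norm M p (\<lambda>\<omega>. SUP n\<in>{1..}. ennreal (\<bar>\<Sum>r<n. Z r \<omega>\<bar> / sqrt (real n * LL (real n))))
      = Lp_norm M p (\<lambda>\<omega>. ennreal \<sigma> * (SUP n\<in>{1..}. ennreal (Y n \<omega>)))"
  proof (rule Lp_norm_cong)
    fix \<omega>
    have "\<bar>\<Sum>r<n. Z r \<omega>\<bar> / sqrt (real n * LL (real n)) = \<sigma> * Y n \<omega>" for n
      using \<sigma> by (simp add: Y_def sum_divide_distrib[symmetric])
    moreover have "0 \<le> Y n \<omega>" for n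
      using LL_ge_1[of "real n"] by (simp add: Y_def)
    ultimately show "(SUP n\<in>{1..}. ennreal (\<bar>\<Sum>r<n. Z r \<omega>\<bar> / sqrt (real n * LL (real n))))
        = ennreal \<sigma> * (SUP n\<in>{1..}. ennreal (Y n \<omega>))"
      using \<sigma> by (simp add: ennreal_mult SUP_mult_left_ennreal)
  qed
  also have "\<dots> = ennreal \<sigma> * Lp_norm M p (\<lambda>\<omega>. SUP n\<in>{1..}. ennreal (Y n \<omega>))"
    using p by (intro Lp_norm_cmult) auto
  also have "\<dots> \<le> ennreal \<sigma> * ennreal (lil_const p)"
    unfolding Y_def using p by (intro mult_left_mono I.Lp_norm_sup_partial_sums) auto
  also have "\<dots> = ennreal (\<sigma> * lil_const p)"
    using \<sigma> by (simp add: ennreal_mult')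
  finally show ?thesis .
qed

section \<open>Elementary sums and the splitting into residue classes\<close>

lemma inverse_sqrt_le_diff: "1 / sqrt (real (Suc n)) \<le> 2 * (sqrt (real (Suc n)) - sqrt (real n))"
proof -
  define a b where "a = sqrt (real (Suc n))" and "b = sqrt (real n)"
  have ab: "0 < a" "0 \<le> b" "b \<le> a" "a * a = b * b + 1"
    by (auto simp: a_def b_def)
  have "2 * a * b \<le> a * a + b * b"
    using sum_squares_ge_zero[of "a - b" 0] by (simp add: algebra_simps)
  then have "1 \<le> 2 * (a - b) * a"
    using ab by (simp add: algebra_simps)
  then show ?thesis
    using ab(1) unfolding a_def[symmetric] b_def[symmetric] by (simp add: pos_divide_le_eq)
qed

lemma sum_inverse_sqrt_le: "(\<Sum>b=1..n. 1 / sqrt (real b)) \<le> 2 * sqrt (real n)"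
proof (induction n)
  case (Suc n)
  then show ?case
    using inverse_sqrt_le_diff[of n] by simp
qed simp

lemma sum_min_powr_le:
  assumes m: "1 \<le> m"
  shows "(\<Sum>j=1..n. real (min j m) / real j powr (3 / 2)) \<le> 4 * sqrt (real m)"
proof -
  have powr32: "real j powr (3 / 2) = real j * sqrt (real j)" if "0 < j" for j
    using that powr_add[of "real j" 1 "1 / 2"] by (simp add: powr_half_sqrt)
  \<comment> \<open>This is the integral of \<open>min x m / x powr (3 / 2)\<close> over [0, n]. Its
    two branches agree at \<open>n = m\<close>, and each summand is at most the increment of
    \<open>\<phi>\<close>.\<close>
  define \<phi> where "\<phi> n = (if n \<le> m then 2 * sqrt (real n) else 4 * sqrt (real m) - 2 * real m / sqrt (real n))" for n
  have "(\<Sum>j=1..n. real (min j m) / real j powr (3 / 2)) \<le> \<phi> n"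
  proof (induction n)
    case (Suc n)
    define a b where "a = sqrt (real (Suc n))" and "b = sqrt (real n)"
    have ab: "0 < a" "0 \<le> b" "a * a = real (Suc n)" "b \<le> a"
      by (auto simp: a_def b_def)
    have diff: "1 / a \<le> 2 * (a - b)"
      using inverse_sqrt_le_diff[of n] by (simp add: a_def b_def)
    have "real (min (Suc n) m) / real (Suc n) powr (3 / 2) \<le> \<phi> (Suc n) - \<phi> n"
    proof (cases "Suc n \<le> m")
      case True
      have "real (min (Suc n) m) / real (Suc n) powr (3 / 2) = 1 / a"
        using True by (subst powr32) (auto simp: a_def)
      then show ?thesis
        using diff True by (simp add: \<phi>_def a_def b_def)
    next
      case False
      then have n: "m \<le> n" "0 < b"
        using m by (auto simp: b_def)
      have "\<phi> n = 4 * sqrt (real m) - 2 * real m / b"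
      proof (cases "n = m")
        case True
        have "2 * sqrt (real m) = 4 * sqrt (real m) - 2 * (real m / sqrt (real m))"
          by (simp add: real_div_sqrt)
        then show ?thesis
          using True by (simp add: \<phi>_def b_def)
      qed (use n in \<open>simp add: \<phi>_def b_def\<close>)
      then have "\<phi> (Suc n) - \<phi> n = 2 * real m * (1 / b - 1 / a)"
        using False by (simp add: \<phi>_def a_def algebra_simps)
      also have "\<dots> = real m * (2 * (a - b)) / (a * b)"
        using ab n by (simp add: field_simps)
      also have "\<dots> \<ge> real m * (1 / a) / (a * a)"
        using ab n diff by (intro frac_le mult_left_mono mult_nonneg_nonneg) auto
      also have "real m * (1 / a) / (a * a) = real (min (Suc n) m) / real (Suc n) powr (3 / 2)"
        using False ab by (subst powr32) (auto simp: a_def min_def)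
      finally show ?thesis .
    qed
    then show ?case
      using Suc by simp
  qed (simp add: \<phi>_def)
  also have "\<phi> n \<le> 4 * sqrt (real m)"
  proof (cases "n \<le> m")
    case True
    then have "sqrt (real n) \<le> sqrt (real m)"
      by simp
    then have "2 * sqrt (real n) \<le> 4 * sqrt (real m)"
      using real_sqrt_ge_zero[of "real m"] by linarith
    then show ?thesis
      using True by (simp only: \<phi>_def if_True)
  qed (simp add: \<phi>_def)
  finally show ?thesis .
qed

text \<open>The first member of each class is set apart, so that a class has
  \<open>N = (n - b) div m\<close> further members with \<open>m * N \<le> n\<close>. Counting the
  first one as well would give \<open>N + 1\<close>, and \<open>m * (N + 1)\<close> may exceed
  \<open>n\<close>, which would spoil the comparison of normalisations.\<close>

lemma sum_residue_classes:
  fixes z :: "nat \<Rightarrow> real"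
  assumes m: "1 \<le> m"
  shows "(\<Sum>j=1..n. z j) = (\<Sum>b=1..m. if b \<le> n then z b else 0)
    + (\<Sum>b=1..m. \<Sum>r<(n - b) div m. z (b + m * Suc r))"
proof -
  define N where "N b = (if b \<le> n then Suc ((n - b) div m) else 0)" for b
  \<comment> \<open>Classes are numbered from 1, hence \<open>j - 1\<close> is divided by
    \<open>m\<close>: its remainder plus 1 is the class, its quotient the position in the
    class.\<close>
  have "(\<Sum>j=1..n. z j) = (\<Sum>(b, r)\<in>(SIGMA b:{1..m}. {..<N b}). z (b + m * r))"
  proof (rule sum.reindex_bij_witness[where j = "\<lambda>j. (Suc ((j - 1) mod m), (j - 1) div m)"
        and i = "\<lambda>(b, r). b + m * r"])
    fix j assume j: "j \<in> {1..n}"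
    show "(case (Suc ((j - 1) mod m), (j - 1) div m) of (b, r) \<Rightarrow> b + m * r) = j"
      using j by simp
    have "(j - 1) mod m + m * ((j - 1) div m) = j - 1"
      by (rule mod_mult_div_eq)
    then have "Suc ((j - 1) mod m) \<le> n" "m * ((j - 1) div m) \<le> n - Suc ((j - 1) mod m)"
      using j by (auto simp only: atLeastAtMost_iff)
    then have "(j - 1) div m < N (Suc ((j - 1) mod m))"
      using m by (simp add: N_def less_Suc_eq_le less_eq_div_iff_mult_less_eq mult.commute)
    then show "(Suc ((j - 1) mod m), (j - 1) div m) \<in> (SIGMA b:{1..m}. {..<N b})"
      using m by (simp add: Suc_le_eq)
    show "(case (Suc ((j - 1) mod m), (j - 1) div m) of (b, r) \<Rightarrow> z (b + m * r)) = z j"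
      using j by simp
  next
    fix x assume x: "x \<in> (SIGMA b:{1..m}. {..<N b})"
    obtain b r where [simp]: "x = (b, r)" by (cases x)
    have b: "1 \<le> b" "b \<le> m" "b \<le> n" "r \<le> (n - b) div m"
      using x by (auto simp: N_def split: if_splits)
    have "m * r \<le> n - b"
      using b m by (simp add: less_eq_div_iff_mult_less_eq mult.commute)
    then show "(case x of (b, r) \<Rightarrow> b + m * r) \<in> {1..n}"
      using b by auto
    obtain c where c: "b = Suc c"
      using b by (cases b) auto
    have "c < m"
      using b c by simp
    then show "(Suc (((case x of (b, r) \<Rightarrow> b + m * r) - 1) mod m), ((case x of (b, r) \<Rightarrow> b + m * r) - 1) div m) = x"
      by (simp add: c)
  qed
  also have "\<dots> = (\<Sum>b=1..m. \<Sum>r<N b. z (b + m * r))"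
    by (subst sum.Sigma) auto
  also have "\<dots> = (\<Sum>b=1..m. (if b \<le> n then z b else 0) + (\<Sum>r<(n - b) div m. z (b + m * Suc r)))"
    by (intro sum.cong refl) (simp add: N_def sum.lessThan_Suc_shift del: sum.lessThan_Suc)
  finally show ?thesis
    by (simp add: sum.distrib)
qed

text \<open>Each class sum is i.i.d., and \<open>m * N \<le> n\<close> gains a factor
  \<open>1 / sqrt m\<close> against the normalisation of length \<open>n\<close>; over
  \<open>m\<close> classes this leaves \<open>sqrt m\<close>. A first member \<open>Z b\<close>
  appears only for \<open>n \<ge> b\<close>, so it is divided by at least \<open>sqrt b\<close>. The
  sum of \<open>1 / sqrt b\<close> is at most \<open>2 * sqrt m\<close>, and passing through the
  2-norm costs another 2, which gives the 4.\<close>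

lemma (in prob_space) m_dependent_Lp_norm_sup_partial_sums:
  fixes Z :: "nat \<Rightarrow> 'a \<Rightarrow> real"
  assumes p: "1 \<le> p" "p < 2" and \<sigma>: "0 < \<sigma>" and m: "1 \<le> m"
    and indep: "\<And>b. indep_vars (\<lambda>_. borel) (\<lambda>r. Z (b + m * Suc r)) UNIV"
    and ident: "\<And>i j. distr M borel (Z i) = distr M borel (Z j)"
    and [measurable]: "\<And>j. Z j \<in> borel_measurable M"
    and square_int: "\<And>j. integrable M (\<lambda>\<omega>. (Z j \<omega>)\<^sup>2)"
    and var: "\<And>j. expectation (\<lambda>\<omega>. (Z j \<omega>)\<^sup>2) \<le> \<sigma>\<^sup>2"
    and mean: "\<And>j. expectation (Z j) = 0"
  shows "Lp_norm M p (\<lambda>\<omega>. SUP n\<in>{1..}. ennreal (\<bar>\<Sum>j=1..n. Z j \<omega>\<bar> / sqrt (real n * LL (real n))))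
    \<le> ennreal ((lil_const p + 4) * sqrt (real m) * \<sigma>)"
proof -
  define S where "S b \<omega> = (SUP N\<in>{1..}. ennreal (\<bar>\<Sum>r<N. Z (b + m * Suc r) \<omega>\<bar> / sqrt (real N * LL (real N))))" for b \<omega>
  have [measurable]: "S b \<in> borel_measurable M" for b
    unfolding S_def by measurable
  define B where "B \<omega> = (\<Sum>b=1..m. ennreal (1 / sqrt (real b)) * ennreal \<bar>Z b \<omega>\<bar>)
      + ennreal (1 / sqrt (real m)) * (\<Sum>b=1..m. S b \<omega>)" for \<omega>
  have pt: "(SUP n\<in>{1..}. ennreal (\<bar>\<Sum>j=1..n. Z j \<omega>\<bar> / sqrt (real n * LL (real n)))) \<le> B \<omega>" for \<omega>
  proof (rule SUP_least)
    fix n :: nat assume "n \<in> {1..}"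
    then have n: "1 \<le> n" by simp
    define s where "s = sqrt (real n * LL (real n))"
    have s_pos: "0 < s"
      using n LL_ge_1[of "real n"] by (simp add: s_def)
    have "\<bar>\<Sum>j=1..n. Z j \<omega>\<bar> \<le> (\<Sum>b=1..m. if b \<le> n then \<bar>Z b \<omega>\<bar> else 0)
        + (\<Sum>b=1..m. \<bar>\<Sum>r<(n - b) div m. Z (b + m * Suc r) \<omega>\<bar>)"
      by (subst sum_residue_classes[OF m])
        (rule order_trans[OF abs_triangle_ineq add_mono[OF order_trans[OF sum_abs sum_mono] sum_abs]], auto)
    then have "\<bar>\<Sum>j=1..n. Z j \<omega>\<bar> / s \<le> (\<Sum>b=1..m. (if b \<le> n then \<bar>Z b \<omega>\<bar> else 0) / s)
        + (\<Sum>b=1..m. \<bar>\<Sum>r<(n - b) div m. Z (b + m * Suc r) \<omega>\<bar> / s)"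
      using s_pos by (simp add: divide_right_mono flip: add_divide_distrib sum_divide_distrib)
    then have "ennreal (\<bar>\<Sum>j=1..n. Z j \<omega>\<bar> / s) \<le> ennreal ((\<Sum>b=1..m. (if b \<le> n then \<bar>Z b \<omega>\<bar> else 0) / s)
        + (\<Sum>b=1..m. \<bar>\<Sum>r<(n - b) div m. Z (b + m * Suc r) \<omega>\<bar> / s))"
      by (rule ennreal_leI)
    also have "\<dots> = (\<Sum>b=1..m. ennreal ((if b \<le> n then \<bar>Z b \<omega>\<bar> else 0) / s))
        + (\<Sum>b=1..m. ennreal (\<bar>\<Sum>r<(n - b) div m. Z (b + m * Suc r) \<omega>\<bar> / s))"
      using s_pos by (simp add: sum_nonneg)
    also have "\<dots> \<le> B \<omega>"
      unfolding B_def sum_distrib_left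
    proof (intro add_mono sum_mono)
      fix b assume b: "b \<in> {1..m}"
      show "ennreal ((if b \<le> n then \<bar>Z b \<omega>\<bar> else 0) / s) \<le> ennreal (1 / sqrt (real b)) * ennreal \<bar>Z b \<omega>\<bar>"
      proof (cases "b \<le> n")
        case True
        have "real b * 1 \<le> real n * LL (real n)"
          using True LL_ge_1[of "real n"] by (intro mult_mono) auto
        then have "sqrt (real b) \<le> s"
          unfolding s_def by (intro real_sqrt_le_mono) simp
        then have "\<bar>Z b \<omega>\<bar> / s \<le> \<bar>Z b \<omega>\<bar> / sqrt (real b)"
          using b s_pos by (intro divide_left_mono mult_pos_pos) auto
        then show ?thesis
          using True by (simp add: ennreal_mult[symmetric] ennreal_leI)
      qed simp
      define N where "N = (n - b) div m"
      show "ennreal (\<bar>\<Sum>r<(n - b) div m. Z (b + m * Suc r) \<omega>\<bar> / s) \<le> ennreal (1 / sqrt (real m)) * S b \<omega>"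
      proof (cases "N = 0")
        case False
        have "m * N \<le> n - b"
          by (simp add: N_def)
        then have mN: "m * N \<le> n"
          by linarith
        have "N \<le> n"
          using mN m by (metis le_trans mult_le_mono1 nat_mult_1)
        then have LLN: "LL (real N) \<le> LL (real n)"
          using False by (intro LL_mono) auto
        have "real m * (real N * LL (real N)) = real (m * N) * LL (real N)"
          by simp
        also have "\<dots> \<le> real n * LL (real n)"
          using mN LLN LL_ge_1[of "real N"] by (intro mult_mono) (auto simp del: of_nat_mult)
        finally have le: "sqrt (real m) * sqrt (real N * LL (real N)) \<le> s"
          unfolding s_def real_sqrt_mult[symmetric] by (rule real_sqrt_le_mono)
        have pos: "0 < sqrt (real m) * sqrt (real N * LL (real N))"
          using m False LL_ge_1[of "real N"] by simp
        have "\<bar>\<Sum>r<N. Z (b + m * Suc r) \<omega>\<bar> / s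
            \<le> \<bar>\<Sum>r<N. Z (b + m * Suc r) \<omega>\<bar> / (sqrt (real m) * sqrt (real N * LL (real N)))"
          by (rule divide_left_mono[OF le abs_ge_zero mult_pos_pos[OF s_pos pos]])
        also have "\<dots> = 1 / sqrt (real m) * (\<bar>\<Sum>r<N. Z (b + m * Suc r) \<omega>\<bar> / sqrt (real N * LL (real N)))"
          by simp
        finally have "ennreal (\<bar>\<Sum>r<N. Z (b + m * Suc r) \<omega>\<bar> / s)
            \<le> ennreal (1 / sqrt (real m) * (\<bar>\<Sum>r<N. Z (b + m * Suc r) \<omega>\<bar> / sqrt (real N * LL (real N))))"
          by (rule ennreal_leI)
        also have "\<dots> = ennreal (1 / sqrt (real m)) * ennreal (\<bar>\<Sum>r<N. Z (b + m * Suc r) \<omega>\<bar> / sqrt (real N * LL (real N)))"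
          by (rule ennreal_mult') simp
        also have "\<dots> \<le> ennreal (1 / sqrt (real m)) * S b \<omega>"
          unfolding S_def using False by (intro mult_left_mono SUP_upper) auto
        finally show ?thesis
          by (simp add: N_def)
      qed (simp add: N_def)
    qed
    finally show "ennreal (\<bar>\<Sum>j=1..n. Z j \<omega>\<bar> / sqrt (real n * LL (real n))) \<le> B \<omega>"
      by (simp add: s_def)
  qed
  have lil_nonneg: "0 \<le> lil_const p"
  proof -
    have "0 \<le> geo_const 1" "0 \<le> geo_const (2 - p)"
      using geo_const_ge_1[of 1] geo_const_ge_1[of "2 - p"] p by auto
    then show ?thesis
      by (simp add: lil_const_def)
  qed
  have S_le: "Lp_norm M p (S b) \<le> ennreal (\<sigma> * lil_const p)" for b
    unfolding S_def[abs_def]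
    by (rule iid_Lp_norm_sup_partial_sums[OF p \<sigma> indep ident square_int var mean])
  have Z_le: "Lp_norm M p (\<lambda>\<omega>. ennreal \<bar>Z b \<omega>\<bar>) \<le> ennreal (2 * \<sigma>)" for b
  proof -
    have "Lp_norm M p (\<lambda>\<omega>. ennreal \<bar>Z b \<omega>\<bar>) \<le> 2 * Lp_norm M 2 (\<lambda>\<omega>. ennreal \<bar>Z b \<omega>\<bar>)"
      using p by (intro Lp_norm_le_L2_norm) auto
    also have "\<dots> \<le> 2 * ennreal \<sigma>"
      using \<sigma> square_int var by (intro mult_left_mono) (auto simp: L2_norm_le_iff_integral)
    finally show ?thesis
      using \<sigma> by (simp add: ennreal_mult)
  qed
  have "Lp_norm M p (\<lambda>\<omega>. SUP n\<in>{1..}. ennreal (\<bar>\<Sum>j=1..n. Z j \<omega>\<bar> / sqrt (real n * LL (real n)))) \<le> Lp_norm M p B"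
    using p by (intro Lp_norm_mono pt) auto
  also have "\<dots> \<le> Lp_norm M p (\<lambda>\<omega>. \<Sum>b=1..m. ennreal (1 / sqrt (real b)) * ennreal \<bar>Z b \<omega>\<bar>)
      + Lp_norm M p (\<lambda>\<omega>. ennreal (1 / sqrt (real m)) * (\<Sum>b=1..m. S b \<omega>))"
    unfolding B_def[abs_def] using p by (intro Lp_norm_add_le) auto
  also have "\<dots> \<le> (\<Sum>b=1..m. Lp_norm M p (\<lambda>\<omega>. ennreal (1 / sqrt (real b)) * ennreal \<bar>Z b \<omega>\<bar>))
      + ennreal (1 / sqrt (real m)) * (\<Sum>b=1..m. Lp_norm M p (S b))"
    using p by (intro add_mono Lp_norm_sum_le) (auto simp: Lp_norm_cmult intro!: mult_left_mono Lp_norm_sum_le)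
  also have "\<dots> \<le> (\<Sum>b=1..m. ennreal (1 / sqrt (real b) * (2 * \<sigma>)))
      + ennreal (1 / sqrt (real m)) * (\<Sum>b=1..m. ennreal (\<sigma> * lil_const p))"
  proof (intro add_mono sum_mono mult_left_mono S_le)
    fix b
    have "Lp_norm M p (\<lambda>\<omega>. ennreal (1 / sqrt (real b)) * ennreal \<bar>Z b \<omega>\<bar>)
        = ennreal (1 / sqrt (real b)) * Lp_norm M p (\<lambda>\<omega>. ennreal \<bar>Z b \<omega>\<bar>)"
      using p by (intro Lp_norm_cmult) auto
    also have "\<dots> \<le> ennreal (1 / sqrt (real b)) * ennreal (2 * \<sigma>)"
      by (intro mult_left_mono Z_le) simp
    also have "\<dots> = ennreal (1 / sqrt (real b) * (2 * \<sigma>))"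
      by (rule ennreal_mult'[symmetric]) simp
    finally show "Lp_norm M p (\<lambda>\<omega>. ennreal (1 / sqrt (real b)) * ennreal \<bar>Z b \<omega>\<bar>)
        \<le> ennreal (1 / sqrt (real b) * (2 * \<sigma>))" .
  qed simp
  also have "\<dots> = ennreal ((\<Sum>b=1..m. 1 / sqrt (real b)) * (2 * \<sigma>) + 1 / sqrt (real m) * (real m * (\<sigma> * lil_const p)))"
  proof -
    have "(\<Sum>b=1..m. ennreal (1 / sqrt (real b) * (2 * \<sigma>))) = ennreal ((\<Sum>b=1..m. 1 / sqrt (real b)) * (2 * \<sigma>))"
      using \<sigma> unfolding sum_distrib_right by (intro sum_ennreal) auto
    moreover have "ennreal (1 / sqrt (real m)) * (\<Sum>b=1..m. ennreal (\<sigma> * lil_const p))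
        = ennreal (1 / sqrt (real m) * (real m * (\<sigma> * lil_const p)))"
      using \<sigma> lil_nonneg by (simp add: sum_ennreal ennreal_mult[symmetric] ennreal_of_nat_eq_real_of_nat)
    ultimately show ?thesis
      using \<sigma> lil_nonneg by (subst ennreal_plus) (auto intro!: sum_nonneg mult_nonneg_nonneg)
  qed
  also have "\<dots> \<le> ennreal ((lil_const p + 4) * sqrt (real m) * \<sigma>)"
  proof (rule ennreal_leI)
    have "(\<Sum>b=1..m. 1 / sqrt (real b)) * (2 * \<sigma>) \<le> 2 * sqrt (real m) * (2 * \<sigma>)"
      using \<sigma> by (intro mult_right_mono sum_inverse_sqrt_le) auto
    moreover have "1 / sqrt (real m) * (real m * (\<sigma> * lil_const p)) = sqrt (real m) * (\<sigma> * lil_const p)"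
    proof -
      have "1 / sqrt (real m) * (real m * (\<sigma> * lil_const p)) = real m / sqrt (real m) * (\<sigma> * lil_const p)"
        by simp
      then show ?thesis
        by (simp only: real_div_sqrt of_nat_0_le_iff)
    qed
    ultimately show "(\<Sum>b=1..m. 1 / sqrt (real b)) * (2 * \<sigma>) + 1 / sqrt (real m) * (real m * (\<sigma> * lil_const p))
        \<le> (lil_const p + 4) * sqrt (real m) * \<sigma>"
      by (simp add: algebra_simps)
  qed
  finally show ?thesis .
qed

section \<open>Orthogonal triangular arrays\<close>

lemma integrable_mult_of_squares:
  fixes f g :: "'a \<Rightarrow> real"
  assumes [measurable]: "f \<in> borel_measurable M" "g \<in> borel_measurable M"
    and "integrable M (\<lambda>x. (f x)\<^sup>2)" "integrable M (\<lambda>x. (g x)\<^sup>2)"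
  shows "integrable M (\<lambda>x. f x * g x)"
proof (rule Bochner_Integration.integrable_bound)
  show "integrable M (\<lambda>x. (f x)\<^sup>2 + (g x)\<^sup>2)"
    using assms by simp
  have "\<bar>a * b\<bar> \<le> a\<^sup>2 + b\<^sup>2" for a b :: real
  proof -
    have "2 * (\<bar>a\<bar> * \<bar>b\<bar>) \<le> a\<^sup>2 + b\<^sup>2"
      using sum_squares_bound[of "\<bar>a\<bar>" "\<bar>b\<bar>"] by simp
    moreover have "0 \<le> \<bar>a\<bar> * \<bar>b\<bar>"
      by simp
    ultimately show ?thesis
      unfolding abs_mult by linarith
  qed
  then show "AE x in M. norm (f x * g x) \<le> norm ((f x)\<^sup>2 + (g x)\<^sup>2)"
    by simp
qed measurable

lemma sum_squared_expand: "(\<Sum>a\<in>A. z a)\<^sup>2 = (\<Sum>a\<in>A. \<Sum>b\<in>A. z a * z b)" for z :: "_ \<Rightarrow> real"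
  by (simp add: power2_eq_square sum_product)

lemma integrable_sum_squared:
  fixes Z :: "'i \<Rightarrow> 'a \<Rightarrow> real"
  assumes "\<And>a. a \<in> A \<Longrightarrow> Z a \<in> borel_measurable M"
    and "\<And>a. a \<in> A \<Longrightarrow> integrable M (\<lambda>x. (Z a x)\<^sup>2)"
  shows "integrable M (\<lambda>x. (\<Sum>a\<in>A. Z a x)\<^sup>2)"
  unfolding sum_squared_expand using assms
  by (intro Bochner_Integration.integrable_sum integrable_mult_of_squares) auto

text \<open>In the expanded square an index \<open>a\<close> has fewer than \<open>2 * m\<close>
  partners at distance below \<open>m\<close>. Each such covariance is at most \<open>K\<close> by
  the inequality of arithmetic and geometric means, all others vanish.\<close>

lemma integral_sum_squared_le:
  fixes Z :: "nat \<Rightarrow> 'a \<Rightarrow> real"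
  assumes fin: "finite A" and m: "1 \<le> m" and K: "0 \<le> K"
    and meas: "\<And>a. a \<in> A \<Longrightarrow> Z a \<in> borel_measurable M"
    and int: "\<And>a. a \<in> A \<Longrightarrow> integrable M (\<lambda>x. (Z a x)\<^sup>2)"
    and bound: "\<And>a. a \<in> A \<Longrightarrow> (\<integral>x. (Z a x)\<^sup>2 \<partial>M) \<le> K"
    and orth: "\<And>a b. a \<in> A \<Longrightarrow> b \<in> A \<Longrightarrow> a + m \<le> b \<Longrightarrow> (\<integral>x. Z a x * Z b x \<partial>M) = 0"
  shows "(\<integral>x. (\<Sum>a\<in>A. Z a x)\<^sup>2 \<partial>M) \<le> 2 * real m * real (card A) * K"
proof -
  have int2: "integrable M (\<lambda>x. Z a x * Z b x)" if "a \<in> A" "b \<in> A" for a b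
    using that by (intro integrable_mult_of_squares meas int)
  have cov: "(\<integral>x. Z a x * Z b x \<partial>M) \<le> (if a < b + m \<and> b < a + m then K else 0)"
    if ab: "a \<in> A" "b \<in> A" for a b
  proof (cases "a < b + m \<and> b < a + m")
    case True
    have "(\<integral>x. Z a x * Z b x \<partial>M) \<le> (\<integral>x. ((Z a x)\<^sup>2 + (Z b x)\<^sup>2) / 2 \<partial>M)"
    proof (intro integral_mono)
      show "Z a x * Z b x \<le> ((Z a x)\<^sup>2 + (Z b x)\<^sup>2) / 2" for x
        using sum_squares_bound[of "Z a x" "Z b x"] by simp
    qed (use ab int int2 in auto)
    also have "\<dots> = ((\<integral>x. (Z a x)\<^sup>2 \<partial>M) + (\<integral>x. (Z b x)\<^sup>2 \<partial>M)) / 2"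
      using ab int by simp
    also have "\<dots> \<le> K"
      using bound[OF ab(1)] bound[OF ab(2)] by simp
    finally show ?thesis
      using True by simp
  next
    case False
    then consider "b + m \<le> a" | "a + m \<le> b"
      by linarith
    then show ?thesis
    proof cases
      case 1
      then show ?thesis
        using orth[OF ab(2,1)] by (simp add: mult.commute)
    next
      case 2
      then show ?thesis
        using orth[OF ab] by simp
    qed
  qed
  have "(\<integral>x. (\<Sum>a\<in>A. Z a x)\<^sup>2 \<partial>M) = (\<Sum>a\<in>A. \<Sum>b\<in>A. \<integral>x. Z a x * Z b x \<partial>M)"
    unfolding sum_squared_expand using int2
    by (subst Bochner_Integration.integral_sum) (auto intro!: sum.cong Bochner_Integration.integral_sum)
  also have "\<dots> \<le> (\<Sum>a\<in>A. \<Sum>b\<in>A. if a < b + m \<and> b < a + m then K else 0)"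
    by (intro sum_mono cov)
  also have "\<dots> \<le> (\<Sum>a\<in>A. 2 * real m * K)"
  proof (rule sum_mono)
    fix a assume "a \<in> A"
    have "(\<Sum>b\<in>A. if a < b + m \<and> b < a + m then K else 0) = (\<Sum>b\<in>{b\<in>A. a < b + m \<and> b < a + m}. K)"
      using fin by (rule sum.inter_filter[symmetric])
    also have "\<dots> = real (card {b\<in>A. a < b + m \<and> b < a + m}) * K"
      by simp
    also have "\<dots> \<le> real (2 * m) * K"
    proof (intro mult_right_mono K of_nat_mono)
      have "card {b\<in>A. a < b + m \<and> b < a + m} \<le> card {a + 1 - m..<a + m}"
        by (intro card_mono) auto
      then show "card {b\<in>A. a < b + m \<and> b < a + m} \<le> 2 * m"
        using m by simp
    qed
    finally show "(\<Sum>b\<in>A. if a < b + m \<and> b < a + m then K else 0) \<le> 2 * real m * K"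
      by simp
  qed
  also have "\<dots> = 2 * real m * real (card A) * K"
    by simp
  finally show ?thesis .
qed

text \<open>Cauchy-Schwarz without orthogonality. The absolute values inside the sum make the bound
  uniform over all partial sums, as needed between two points of the subsequence.\<close>

lemma integral_sum_abs_squared_le:
  fixes Z :: "nat \<Rightarrow> 'a \<Rightarrow> real"
  assumes meas: "\<And>a. a \<in> A \<Longrightarrow> Z a \<in> borel_measurable M"
    and int: "\<And>a. a \<in> A \<Longrightarrow> integrable M (\<lambda>x. (Z a x)\<^sup>2)"
    and bound: "\<And>a. a \<in> A \<Longrightarrow> (\<integral>x. (Z a x)\<^sup>2 \<partial>M) \<le> K"
  shows "(\<integral>x. (\<Sum>a\<in>A. \<bar>Z a x\<bar>)\<^sup>2 \<partial>M) \<le> (real (card A))\<^sup>2 * K"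
proof -
  have "(\<integral>x. (\<Sum>a\<in>A. \<bar>Z a x\<bar>)\<^sup>2 \<partial>M) \<le> (\<integral>x. (\<Sum>a\<in>A. (Z a x)\<^sup>2) * real (card A) \<partial>M)"
  proof (intro integral_mono)
    show "(\<Sum>a\<in>A. \<bar>Z a x\<bar>)\<^sup>2 \<le> (\<Sum>a\<in>A. (Z a x)\<^sup>2) * real (card A)" for x
      using sum_squared_le_sum_of_squares[of "\<lambda>a. \<bar>Z a x\<bar>" A] by simp
  qed (use meas int in \<open>auto intro!: integrable_sum_squared\<close>)
  also have "\<dots> = (\<Sum>a\<in>A. \<integral>x. (Z a x)\<^sup>2 \<partial>M) * real (card A)"
    using int by (subst Bochner_Integration.integral_mult_left) (auto intro!: Bochner_Integration.integral_sum)
  also have "\<dots> \<le> (\<Sum>a\<in>A. K) * real (card A)"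
    by (intro mult_right_mono sum_mono bound) auto
  finally show ?thesis
    by (simp add: power2_eq_square mult_ac)
qed

lemma ex_square_block:
  fixes m n :: nat
  assumes "1 \<le> m" "m \<le> n"
  obtains q where "1 \<le> q" "m * q\<^sup>2 \<le> n" "n < m * (q + 1)\<^sup>2"
proof -
  define P where "P q = (m * q\<^sup>2 \<le> n)" for q
  have bound: "q \<le> n" if "P q" for q
  proof -
    have "q \<le> q\<^sup>2"
      by (simp add: power2_eq_square)
    also have "\<dots> \<le> m * q\<^sup>2"
      using assms by simp
    finally show ?thesis
      using that by (simp add: P_def)
  qed
  have P1: "P 1"
    using assms by (simp add: P_def)
  define q where "q = Greatest P"
  have q: "P q"
    unfolding q_def using P1 bound by (rule GreatestI_nat)
  moreover have "1 \<le> q"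
    unfolding q_def using P1 bound by (rule Greatest_le_nat)
  moreover have "\<not> P (q + 1)"
    using Greatest_le_nat[of P "q + 1" n] bound by (auto simp: q_def)
  ultimately show ?thesis
    using that by (auto simp: P_def)
qed

text \<open>The second-order content of a degenerate remainder. Orthogonality concerns only far
  pairs, either from columns at least \<open>m\<close> apart or from one column with rows at least
  \<open>m\<close> apart. Near pairs share just the second moment bound.\<close>

locale orthogonal_array = prob_space +
  fixes R :: "nat \<Rightarrow> nat \<Rightarrow> 'a \<Rightarrow> real" and m :: nat and \<kappa> :: real
  assumes m: "1 \<le> m" and \<kappa>: "0 < \<kappa>"
    and measurable_R [measurable]: "\<And>i j. R i j \<in> borel_measurable M"
    and square_int: "\<And>i j. 1 \<le> i \<Longrightarrow> i < j \<Longrightarrow> integrable M (\<lambda>\<omega>. (R i j \<omega>)\<^sup>2)"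
    and second_moment: "\<And>i j. 1 \<le> i \<Longrightarrow> i < j \<Longrightarrow> expectation (\<lambda>\<omega>. (R i j \<omega>)\<^sup>2) \<le> \<kappa>\<^sup>2"
    and orth_cols: "\<And>i j i' j'. 1 \<le> i \<Longrightarrow> i + m \<le> j \<Longrightarrow> 1 \<le> i' \<Longrightarrow> i' + m \<le> j' \<Longrightarrow> j + m \<le> j' \<Longrightarrow>
      expectation (\<lambda>\<omega>. R i j \<omega> * R i' j' \<omega>) = 0"
    and orth_rows: "\<And>i i' j. 1 \<le> i \<Longrightarrow> i + m \<le> i' \<Longrightarrow> i' + m \<le> j \<Longrightarrow>
      expectation (\<lambda>\<omega>. R i j \<omega> * R i' j \<omega>) = 0"
begin

section \<open>Column sums over far and near pairs\<close>

definition far_col :: "nat \<Rightarrow> 'a \<Rightarrow> real" where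
  "far_col j \<omega> = (\<Sum>i\<in>{i. 1 \<le> i \<and> i + m \<le> j}. R i j \<omega>)"

text \<open>Near pairs have no cancellation to preserve, so absolute values are taken at
  once.\<close>

definition near_col :: "nat \<Rightarrow> 'a \<Rightarrow> real" where
  "near_col j \<omega> = (\<Sum>i\<in>{i. 1 \<le> i \<and> i < j \<and> j < i + m}. \<bar>R i j \<omega>\<bar>)"

lemma finite_far: "finite {i. 1 \<le> i \<and> i + m \<le> j}"
  by (rule finite_subset[of _ "{..j}"]) auto

lemma measurable_far_col [measurable]: "far_col j \<in> borel_measurable M"
  unfolding far_col_def by measurable

lemma measurable_near_col [measurable]: "near_col j \<in> borel_measurable M"
  unfolding near_col_def by measurable

lemma card_far: "card {i. 1 \<le> i \<and> i + m \<le> j} \<le> j"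
proof -
  have "card {i. 1 \<le> i \<and> i + m \<le> j} \<le> card {1..j}"
    by (intro card_mono) auto
  then show ?thesis
    by simp
qed

lemma integrable_far_col: "integrable M (\<lambda>\<omega>. (far_col j \<omega>)\<^sup>2)"
  unfolding far_col_def using m by (intro integrable_sum_squared square_int) auto

lemma far_col_second_moment: "expectation (\<lambda>\<omega>. (far_col j \<omega>)\<^sup>2) \<le> 2 * real m * real j * \<kappa>\<^sup>2"
proof -
  have "expectation (\<lambda>\<omega>. (far_col j \<omega>)\<^sup>2) \<le> 2 * real m * real (card {i. 1 \<le> i \<and> i + m \<le> j}) * \<kappa>\<^sup>2"
    unfolding far_col_def using m
    by (intro integral_sum_squared_le finite_far square_int second_moment) (auto intro: orth_rows)
  also have "\<dots> \<le> 2 * real m * real j * \<kappa>\<^sup>2"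
    using card_far by (intro mult_right_mono mult_left_mono) auto
  finally show ?thesis .
qed

lemma far_col_orth:
  assumes "j + m \<le> j'"
  shows "expectation (\<lambda>\<omega>. far_col j \<omega> * far_col j' \<omega>) = 0"
proof -
  have "expectation (\<lambda>\<omega>. far_col j \<omega> * far_col j' \<omega>)
      = (\<Sum>i\<in>{i. 1 \<le> i \<and> i + m \<le> j}. \<Sum>i'\<in>{i. 1 \<le> i \<and> i + m \<le> j'}. expectation (\<lambda>\<omega>. R i j \<omega> * R i' j' \<omega>))"
    unfolding far_col_def sum_product using m
    by (subst Bochner_Integration.integral_sum)
      (auto intro!: sum.cong Bochner_Integration.integral_sum Bochner_Integration.integrable_sum
        integrable_mult_of_squares square_int)
  also have "\<dots> = 0"
    using assms by (intro sum.neutral ballI) (auto intro!: orth_cols)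
  finally show ?thesis .
qed

text \<open>
  Between \<open>m q\<^sup>2\<close> and \<open>m (q + 1)\<^sup>2\<close> the triangle inequality loses nothing: with about \<open>m q\<close> columns of
  norm about \<open>m q\<close>, \<open>block_tail q\<close> is of the same order \<open>(m q)\<^sup>2\<close> as \<open>block_head q\<close>.
\<close>

definition block_head :: "nat \<Rightarrow> 'a \<Rightarrow> real" where
  "block_head q \<omega> = \<bar>\<Sum>j=1..m * q\<^sup>2. far_col j \<omega>\<bar>"

definition block_tail :: "nat \<Rightarrow> 'a \<Rightarrow> real" where
  "block_tail q \<omega> = (\<Sum>j\<in>{m * q\<^sup>2<..m * (q + 1)\<^sup>2}. \<bar>far_col j \<omega>\<bar>)"

lemma measurable_block [measurable]:
  "block_head q \<in> borel_measurable M" "block_tail q \<in> borel_measurable M"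
  unfolding block_head_def block_tail_def by measurable

text \<open>The bound for finitely many non-orthogonal partners is used a second time, now with
  whole columns as summands, whose second moments it had bounded before. Each use contributes a
  factor \<open>2 * m\<close>.\<close>

lemma block_head_second_moment:
  "integrable M (\<lambda>\<omega>. (block_head q \<omega>)\<^sup>2)"
  "expectation (\<lambda>\<omega>. (block_head q \<omega>)\<^sup>2) \<le> 4 * real m ^ 4 * real q ^ 4 * \<kappa>\<^sup>2"
proof -
  show "integrable M (\<lambda>\<omega>. (block_head q \<omega>)\<^sup>2)"
    unfolding block_head_def power2_abs by (intro integrable_sum_squared integrable_far_col) auto
  have "expectation (\<lambda>\<omega>. (block_head q \<omega>)\<^sup>2)
      \<le> 2 * real m * real (card {1..m * q\<^sup>2}) * (2 * real m * real (m * q\<^sup>2) * \<kappa>\<^sup>2)"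
    unfolding block_head_def power2_abs
  proof (intro integral_sum_squared_le m integrable_far_col far_col_orth)
    fix j assume "j \<in> {1..m * q\<^sup>2}"
    then have "2 * real m * real j * \<kappa>\<^sup>2 \<le> 2 * real m * real (m * q\<^sup>2) * \<kappa>\<^sup>2"
      by (intro mult_right_mono mult_left_mono) (auto simp del: of_nat_mult)
    then show "expectation (\<lambda>\<omega>. (far_col j \<omega>)\<^sup>2) \<le> 2 * real m * real (m * q\<^sup>2) * \<kappa>\<^sup>2"
      using far_col_second_moment[of j] by linarith
  qed auto
  also have "\<dots> = 4 * real m ^ 4 * real q ^ 4 * \<kappa>\<^sup>2"
    by (simp add: power2_eq_square power4_eq_xxxx)
  finally show "expectation (\<lambda>\<omega>. (block_head q \<omega>)\<^sup>2) \<le> 4 * real m ^ 4 * real q ^ 4 * \<kappa>\<^sup>2" .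
qed

lemma block_tail_second_moment:
  assumes q: "1 \<le> q"
  shows "integrable M (\<lambda>\<omega>. (block_tail q \<omega>)\<^sup>2)"
  "expectation (\<lambda>\<omega>. (block_tail q \<omega>)\<^sup>2) \<le> 72 * real m ^ 4 * real q ^ 4 * \<kappa>\<^sup>2"
proof -
  show "integrable M (\<lambda>\<omega>. (block_tail q \<omega>)\<^sup>2)"
    unfolding block_tail_def using integrable_far_col by (intro integrable_sum_squared) auto
  have "expectation (\<lambda>\<omega>. (block_tail q \<omega>)\<^sup>2)
      \<le> (real (card {m * q\<^sup>2<..m * (q + 1)\<^sup>2}))\<^sup>2 * (2 * real m * real (m * (q + 1)\<^sup>2) * \<kappa>\<^sup>2)"
    unfolding block_tail_def
  proof (intro integral_sum_abs_squared_le integrable_far_col)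
    fix j assume "j \<in> {m * q\<^sup>2<..m * (q + 1)\<^sup>2}"
    then have "2 * real m * real j * \<kappa>\<^sup>2 \<le> 2 * real m * real (m * (q + 1)\<^sup>2) * \<kappa>\<^sup>2"
      by (intro mult_right_mono mult_left_mono) (auto simp del: of_nat_mult)
    then show "expectation (\<lambda>\<omega>. (far_col j \<omega>)\<^sup>2) \<le> 2 * real m * real (m * (q + 1)\<^sup>2) * \<kappa>\<^sup>2"
      using far_col_second_moment[of j] by linarith
  qed auto
  also have "card {m * q\<^sup>2<..m * (q + 1)\<^sup>2} = m * (2 * q + 1)"
    by (simp add: power2_eq_square algebra_simps)
  also have "(real (m * (2 * q + 1)))\<^sup>2 * (2 * real m * real (m * (q + 1)\<^sup>2) * \<kappa>\<^sup>2)
      = 2 * real m ^ 4 * \<kappa>\<^sup>2 * ((2 * real q + 1) * (real q + 1))\<^sup>2"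
  proof -
    have "(x * (2 * y + 1))\<^sup>2 * (2 * x * (x * (y + 1)\<^sup>2) * \<kappa>\<^sup>2)
        = 2 * x ^ 4 * \<kappa>\<^sup>2 * ((2 * y + 1) * (y + 1))\<^sup>2" for x y :: real
      by algebra
    moreover have "real (m * (2 * q + 1)) = real m * (2 * real q + 1)"
      by (simp add: algebra_simps)
    moreover have "real (m * (q + 1)\<^sup>2) = real m * (real q + 1)\<^sup>2"
      by (simp add: add.commute)
    ultimately show ?thesis
      by (simp only:)
  qed
  \<comment> \<open>For \<open>q \<ge> 1\<close>, \<open>2 * q + 1 \<le> 3 * q\<close> and
    \<open>q + 1 \<le> 2 * q\<close>; hence \<open>72 = 2 * (3 * 2)\<^sup>2\<close>.\<close>
  also have "\<dots> \<le> 2 * real m ^ 4 * \<kappa>\<^sup>2 * ((3 * real q) * (2 * real q))\<^sup>2"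
    using q by (intro mult_left_mono power_mono mult_mono) auto
  also have "\<dots> = 72 * real m ^ 4 * real q ^ 4 * \<kappa>\<^sup>2"
    by (simp add: power_mult_distrib power2_eq_square power4_eq_xxxx)
  finally show "expectation (\<lambda>\<omega>. (block_tail q \<omega>)\<^sup>2) \<le> 72 * real m ^ 4 * real q ^ 4 * \<kappa>\<^sup>2" .
qed

text \<open>For \<open>n < m\<close> there are no far pairs. Otherwise \<open>n\<close> lies in some
  block \<open>q\<close>, and the squared ratio is at most the square of head plus tail over
  \<open>(m * q\<^sup>2) ^ 3\<close>. Its mean is at most
  \<open>152 * m * \<kappa>\<^sup>2 / q\<^sup>2\<close> with \<open>152 = 2 * 4 + 2 * 72\<close>, so
  the supremum may be replaced by the sum over all blocks. The inverse squares sum to at most 3, and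
  \<open>456 \<le> 22\<^sup>2\<close>.\<close>

lemma far_part:
  "Lp_norm M 2 (\<lambda>\<omega>. SUP n\<in>{1..}. ennreal (\<bar>\<Sum>j=1..n. far_col j \<omega>\<bar> / real n powr (3 / 2)))
    \<le> ennreal (22 * sqrt (real m) * \<kappa>)"
proof -
  define F where "F k \<omega> = (block_head (Suc k) \<omega> + block_tail (Suc k) \<omega>)\<^sup>2 / (real m * (real k + 1)\<^sup>2) ^ 3"
    for k \<omega>
  have [measurable]: "F k \<in> borel_measurable M" for k
    unfolding F_def by measurable
  have pt: "ennpowr (SUP n\<in>{1..}. ennreal (\<bar>\<Sum>j=1..n. far_col j \<omega>\<bar> / real n powr (3 / 2))) 2
      \<le> (\<Sum>k. ennreal (F k \<omega>))" for \<omega>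
    unfolding ennpowr_SUP[OF zero_less_numeral]
  proof (rule SUP_least)
    fix n :: nat assume n: "n \<in> {1..}"
    have sq: "(\<bar>x\<bar> / real n powr (3 / 2))\<^sup>2 = x\<^sup>2 / real n ^ 3" for x
    proof -
      have "(real n powr (3 / 2))\<^sup>2 = real n powr 3"
        by (simp add: power2_eq_square flip: powr_add)
      then show ?thesis
        using n by (simp add: power_divide powr_numeral)
    qed
    have "ennreal ((\<bar>\<Sum>j=1..n. far_col j \<omega>\<bar> / real n powr (3 / 2))\<^sup>2) \<le> (\<Sum>k. ennreal (F k \<omega>))"
    proof (cases "n < m")
      case True
      have "far_col j \<omega> = 0" if "j \<le> n" for j
      proof -
        have "{i. 1 \<le> i \<and> i + m \<le> j} = {}"
          using that True by auto
        then show ?thesis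
          unfolding far_col_def by (simp only: sum.empty)
      qed
      then show ?thesis
        by simp
    next
      case False
      then obtain q where q: "1 \<le> q" "m * q\<^sup>2 \<le> n" "n < m * (q + 1)\<^sup>2"
        using ex_square_block[of m n] m by auto
      have "(\<Sum>j=1..n. far_col j \<omega>) = (\<Sum>j=1..m * q\<^sup>2. far_col j \<omega>) + (\<Sum>j\<in>{m * q\<^sup>2<..n}. far_col j \<omega>)"
      proof -
        have "{1..n} = {1..m * q\<^sup>2} \<union> {m * q\<^sup>2<..n}"
          using q by auto
        then show ?thesis
          by (simp only:) (intro sum.union_disjoint, auto)
      qed
      moreover have "\<bar>\<Sum>j\<in>{m * q\<^sup>2<..n}. far_col j \<omega>\<bar> \<le> block_tail q \<omega>"
        unfolding block_tail_def using q by (intro order_trans[OF sum_abs] sum_mono2) auto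
      ultimately have "\<bar>\<Sum>j=1..n. far_col j \<omega>\<bar> \<le> block_head q \<omega> + block_tail q \<omega>"
        unfolding block_head_def by linarith
      then have "(\<Sum>j=1..n. far_col j \<omega>)\<^sup>2 \<le> (block_head q \<omega> + block_tail q \<omega>)\<^sup>2"
        by (metis abs_ge_zero power2_abs power_mono)
      moreover have "(real m * (real q)\<^sup>2) ^ 3 \<le> real n ^ 3"
      proof (rule power_mono)
        have "real (m * q\<^sup>2) \<le> real n"
          using q by (simp only: of_nat_le_iff)
        then show "real m * (real q)\<^sup>2 \<le> real n"
          by simp
      qed auto
      moreover have "0 < (real m * (real q)\<^sup>2) ^ 3"
        using q m by auto
      ultimately have "(\<Sum>j=1..n. far_col j \<omega>)\<^sup>2 / real n ^ 3
          \<le> (block_head q \<omega> + block_tail q \<omega>)\<^sup>2 / (real m * (real q)\<^sup>2) ^ 3"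
        by (intro frac_le) auto
      \<comment> \<open>Blocks are numbered from 1, the terms of the series from 0.\<close>
      also have "\<dots> = F (q - 1) \<omega>"
        using q by (simp add: F_def of_nat_diff)
      finally have "ennreal ((\<bar>\<Sum>j=1..n. far_col j \<omega>\<bar> / real n powr (3 / 2))\<^sup>2) \<le> ennreal (F (q - 1) \<omega>)"
        unfolding sq by (rule ennreal_leI)
      also have "\<dots> \<le> (\<Sum>k. ennreal (F k \<omega>))"
        by (rule ennreal_le_suminf[of "\<lambda>k. ennreal (F k \<omega>)"])
      finally show ?thesis .
    qed
    then show "ennpowr (ennreal (\<bar>\<Sum>j=1..n. far_col j \<omega>\<bar> / real n powr (3 / 2))) 2 \<le> (\<Sum>k. ennreal (F k \<omega>))"
      by (simp add: ennpowr_ennreal powr_numeral)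
  qed
  have F_le: "(\<integral>\<^sup>+\<omega>. ennreal (F k \<omega>) \<partial>M) \<le> ennreal (152 * real m * \<kappa>\<^sup>2) * ennreal (1 / (real k + 1)\<^sup>2)" for k
  proof -
    have int: "integrable M (\<lambda>\<omega>. 2 * (block_head (Suc k) \<omega>)\<^sup>2 + 2 * (block_tail (Suc k) \<omega>)\<^sup>2)"
      using block_head_second_moment block_tail_second_moment by auto
    have "(\<integral>\<^sup>+\<omega>. ennreal (F k \<omega>) \<partial>M)
        \<le> (\<integral>\<^sup>+\<omega>. ennreal ((2 * (block_head (Suc k) \<omega>)\<^sup>2 + 2 * (block_tail (Suc k) \<omega>)\<^sup>2) / (real m * (real k + 1)\<^sup>2) ^ 3) \<partial>M)"
    proof (intro nn_integral_mono ennreal_leI)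
      fix \<omega>
      have "(a + b)\<^sup>2 \<le> 2 * a\<^sup>2 + 2 * b\<^sup>2" for a b :: real
        using sum_squares_bound[of a b] by (simp add: power2_sum)
      then show "F k \<omega> \<le> (2 * (block_head (Suc k) \<omega>)\<^sup>2 + 2 * (block_tail (Suc k) \<omega>)\<^sup>2) / (real m * (real k + 1)\<^sup>2) ^ 3"
        unfolding F_def by (intro divide_right_mono) auto
    qed
    also have "\<dots> = ennreal (expectation (\<lambda>\<omega>. 2 * (block_head (Suc k) \<omega>)\<^sup>2 + 2 * (block_tail (Suc k) \<omega>)\<^sup>2) / (real m * (real k + 1)\<^sup>2) ^ 3)"
      using int by (subst nn_integral_eq_integral) auto
    also have "\<dots> \<le> ennreal ((2 * (4 * real m ^ 4 * real (Suc k) ^ 4 * \<kappa>\<^sup>2) + 2 * (72 * real m ^ 4 * real (Suc k) ^ 4 * \<kappa>\<^sup>2)) / (real m * (real k + 1)\<^sup>2) ^ 3)"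
    proof (intro ennreal_leI divide_right_mono)
      have "expectation (\<lambda>\<omega>. 2 * (block_head (Suc k) \<omega>)\<^sup>2 + 2 * (block_tail (Suc k) \<omega>)\<^sup>2)
          = 2 * expectation (\<lambda>\<omega>. (block_head (Suc k) \<omega>)\<^sup>2) + 2 * expectation (\<lambda>\<omega>. (block_tail (Suc k) \<omega>)\<^sup>2)"
        using block_head_second_moment block_tail_second_moment[of "Suc k"] by simp
      also have "\<dots> \<le> 2 * (4 * real m ^ 4 * real (Suc k) ^ 4 * \<kappa>\<^sup>2) + 2 * (72 * real m ^ 4 * real (Suc k) ^ 4 * \<kappa>\<^sup>2)"
        by (intro add_mono mult_left_mono block_head_second_moment block_tail_second_moment) auto
      finally show "expectation (\<lambda>\<omega>. 2 * (block_head (Suc k) \<omega>)\<^sup>2 + 2 * (block_tail (Suc k) \<omega>)\<^sup>2)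
          \<le> \<dots>" .
    qed simp
    also have "(2 * (4 * real m ^ 4 * real (Suc k) ^ 4 * \<kappa>\<^sup>2) + 2 * (72 * real m ^ 4 * real (Suc k) ^ 4 * \<kappa>\<^sup>2)) / (real m * (real k + 1)\<^sup>2) ^ 3
        = 152 * real m * \<kappa>\<^sup>2 * (1 / (real k + 1)\<^sup>2)"
    proof -
      have "(2 * (4 * x ^ 4 * y ^ 4 * \<kappa>\<^sup>2) + 2 * (72 * x ^ 4 * y ^ 4 * \<kappa>\<^sup>2)) / (x * y\<^sup>2) ^ 3 = 152 * x * \<kappa>\<^sup>2 * (1 / y\<^sup>2)"
        if "0 < x" "0 < y" for x y :: real
        using that by (simp add: field_simps power2_eq_square power3_eq_cube power4_eq_xxxx)
      from this[of "real m" "real k + 1"] show ?thesis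
        using m by (simp add: add.commute)
    qed
    also have "ennreal \<dots> = ennreal (152 * real m * \<kappa>\<^sup>2) * ennreal (1 / (real k + 1)\<^sup>2)"
      by (rule ennreal_mult) auto
    finally show ?thesis .
  qed
  have "(\<integral>\<^sup>+\<omega>. ennpowr (SUP n\<in>{1..}. ennreal (\<bar>\<Sum>j=1..n. far_col j \<omega>\<bar> / real n powr (3 / 2))) 2 \<partial>M)
      \<le> (\<integral>\<^sup>+\<omega>. (\<Sum>k. ennreal (F k \<omega>)) \<partial>M)"
    by (intro nn_integral_mono pt)
  also have "\<dots> = (\<Sum>k. \<integral>\<^sup>+\<omega>. ennreal (F k \<omega>) \<partial>M)"
    by (intro nn_integral_suminf) measurable
  also have "\<dots> \<le> (\<Sum>k. ennreal (152 * real m * \<kappa>\<^sup>2) * ennreal (1 / (real k + 1)\<^sup>2))"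
    by (intro suminf_le F_le summableI)
  also have "\<dots> \<le> ennreal (152 * real m * \<kappa>\<^sup>2) * 3"
    unfolding ennreal_suminf_cmult by (intro mult_left_mono suminf_inverse_squares_le) simp
  also have "\<dots> = ennreal (456 * real m * \<kappa>\<^sup>2)"
    by (simp add: ennreal_mult'[symmetric] ennreal_numeral[symmetric] del: ennreal_numeral)
  also have "\<dots> \<le> ennreal ((22 * sqrt (real m) * \<kappa>) powr 2)"
    using \<kappa> by (intro ennreal_leI) (simp add: powr_numeral power_mult_distrib)
  finally show ?thesis
    using \<kappa> by (subst Lp_norm_le_iff) auto
qed

text \<open>Dividing column \<open>j\<close> by its own \<open>j powr (3 / 2)\<close>, which is at
  most the weight of any \<open>n \<ge> j\<close>, replaces the supremum over \<open>n\<close> by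
  one series. The triangle inequality then needs only that column \<open>j\<close> has at most
  \<open>min j m\<close> near pairs.\<close>

lemma near_part:
  "Lp_norm M 2 (\<lambda>\<omega>. \<Sum>j. ennreal (near_col (Suc j) \<omega> / real (Suc j) powr (3 / 2)))
    \<le> ennreal (4 * sqrt (real m) * \<kappa>)"
proof -
  have R_le: "Lp_norm M 2 (\<lambda>\<omega>. ennreal \<bar>R i j \<omega>\<bar>) \<le> ennreal \<kappa>" if "1 \<le> i" "i < j" for i j
    using \<kappa> square_int[OF that] second_moment[OF that] by (subst L2_norm_le_iff_integral) auto
  have col: "Lp_norm M 2 (\<lambda>\<omega>. ennreal (near_col j \<omega> / real j powr (3 / 2)))
      \<le> ennreal (real (min j m) / real j powr (3 / 2) * \<kappa>)" if j: "1 \<le> j" for j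
  proof -
    define I where "I = {i. 1 \<le> i \<and> i < j \<and> j < i + m}"
    have "I \<subseteq> {1..<j}" "I \<subseteq> {j + 1 - m..<j}"
      by (auto simp: I_def)
    then have "card I \<le> card {1..<j}" "card I \<le> card {j + 1 - m..<j}"
      by (auto intro!: card_mono simp del: card_atLeastLessThan)
    then have card: "card I \<le> min j m"
      by auto
    have "Lp_norm M 2 (\<lambda>\<omega>. ennreal (near_col j \<omega> / real j powr (3 / 2)))
        = Lp_norm M 2 (\<lambda>\<omega>. ennreal (1 / real j powr (3 / 2)) * (\<Sum>i\<in>I. ennreal \<bar>R i j \<omega>\<bar>))"
      by (intro Lp_norm_cong) (simp add: near_col_def I_def ennreal_mult[symmetric] sum_nonneg)
    also have "\<dots> = ennreal (1 / real j powr (3 / 2)) * Lp_norm M 2 (\<lambda>\<omega>. \<Sum>i\<in>I. ennreal \<bar>R i j \<omega>\<bar>)"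
      by (intro Lp_norm_cmult) auto
    also have "\<dots> \<le> ennreal (1 / real j powr (3 / 2)) * (\<Sum>i\<in>I. ennreal \<kappa>)"
      by (intro mult_left_mono order_trans[OF Lp_norm_sum_le] sum_mono R_le) (auto simp: I_def)
    also have "\<dots> = ennreal (1 / real j powr (3 / 2) * (real (card I) * \<kappa>))"
      using \<kappa> by (simp add: ennreal_mult ennreal_of_nat_eq_real_of_nat flip: ennreal_mult)
    also have "\<dots> \<le> ennreal (real (min j m) / real j powr (3 / 2) * \<kappa>)"
    proof (rule ennreal_leI)
      have "1 / real j powr (3 / 2) * (real (card I) * \<kappa>) \<le> 1 / real j powr (3 / 2) * (real (min j m) * \<kappa>)"
        using card \<kappa> by (intro mult_left_mono mult_right_mono of_nat_mono) auto
      then show "1 / real j powr (3 / 2) * (real (card I) * \<kappa>) \<le> real (min j m) / real j powr (3 / 2) * \<kappa>"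
        by simp
    qed
    finally show ?thesis .
  qed
  have "Lp_norm M 2 (\<lambda>\<omega>. \<Sum>j. ennreal (near_col (Suc j) \<omega> / real (Suc j) powr (3 / 2)))
      \<le> (\<Sum>j. Lp_norm M 2 (\<lambda>\<omega>. ennreal (near_col (Suc j) \<omega> / real (Suc j) powr (3 / 2))))"
    by (intro Lp_norm_suminf_le) auto
  also have "\<dots> \<le> (\<Sum>j. ennreal (real (min (Suc j) m) / real (Suc j) powr (3 / 2) * \<kappa>))"
    by (intro suminf_le col summableI) auto
  also have "\<dots> \<le> ennreal (4 * sqrt (real m) * \<kappa>)"
    unfolding suminf_eq_SUP
  proof (rule SUP_least)
    fix n
    have "(\<Sum>j<n. ennreal (real (min (Suc j) m) / real (Suc j) powr (3 / 2) * \<kappa>))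
        = ennreal (\<Sum>j<n. real (min (Suc j) m) / real (Suc j) powr (3 / 2) * \<kappa>)"
      using \<kappa> by (intro sum_ennreal) auto
    also have "(\<Sum>j<n. real (min (Suc j) m) / real (Suc j) powr (3 / 2) * \<kappa>)
        = (\<Sum>j=1..n. real (min j m) / real j powr (3 / 2)) * \<kappa>"
      unfolding sum_distrib_right[symmetric]
      by (intro arg_cong[where f = "\<lambda>x. x * \<kappa>"] sum.reindex_bij_witness[where i = "\<lambda>j. j - 1" and j = Suc]) auto
    also have "ennreal \<dots> \<le> ennreal (4 * sqrt (real m) * \<kappa>)"
      using m \<kappa> by (intro ennreal_leI mult_right_mono sum_min_powr_le) auto
    finally show "(\<Sum>j<n. ennreal (real (min (Suc j) m) / real (Suc j) powr (3 / 2) * \<kappa>)) \<le> \<dots>" .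
  qed
  finally show ?thesis .
qed

theorem L2_norm_sup_triangular_sums:
  "Lp_norm M 2 (\<lambda>\<omega>. SUP n\<in>{1..}. ennreal (\<bar>\<Sum>j=1..n. \<Sum>i\<in>{1..<j}. R i j \<omega>\<bar> / real n powr (3 / 2)))
    \<le> ennreal (26 * sqrt (real m) * \<kappa>)"
proof -
  define A where "A \<omega> = (SUP n\<in>{1..}. ennreal (\<bar>\<Sum>j=1..n. far_col j \<omega>\<bar> / real n powr (3 / 2)))" for \<omega>
  define B where "B \<omega> = (\<Sum>j. ennreal (near_col (Suc j) \<omega> / real (Suc j) powr (3 / 2)))" for \<omega>
  have [measurable]: "A \<in> borel_measurable M" "B \<in> borel_measurable M"
    unfolding A_def B_def by measurable
  have near_nonneg: "0 \<le> near_col j \<omega>" for j \<omega>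
    unfolding near_col_def by (intro sum_nonneg) auto
  have pt: "(SUP n\<in>{1..}. ennreal (\<bar>\<Sum>j=1..n. \<Sum>i\<in>{1..<j}. R i j \<omega>\<bar> / real n powr (3 / 2))) \<le> A \<omega> + B \<omega>" for \<omega>
  proof (rule SUP_least)
    fix n :: nat assume n: "n \<in> {1..}"
    have col: "\<bar>(\<Sum>i\<in>{1..<j}. R i j \<omega>) - far_col j \<omega>\<bar> \<le> near_col j \<omega>" for j
    proof -
      have "{1..<j} = {i. 1 \<le> i \<and> i + m \<le> j} \<union> {i. 1 \<le> i \<and> i < j \<and> j < i + m}"
        using m by auto
      moreover have "finite {i. 1 \<le> i \<and> i < j \<and> j < i + m}"
        by (rule finite_subset[of _ "{..j}"]) auto
      ultimately have "(\<Sum>i\<in>{1..<j}. R i j \<omega>) = far_col j \<omega> + (\<Sum>i\<in>{i. 1 \<le> i \<and> i < j \<and> j < i + m}. R i j \<omega>)"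
        unfolding far_col_def by (simp only:) (intro sum.union_disjoint finite_far, auto)
      then show ?thesis
        unfolding near_col_def by (simp add: sum_abs)
    qed
    have "\<bar>\<Sum>j=1..n. \<Sum>i\<in>{1..<j}. R i j \<omega>\<bar> \<le> \<bar>\<Sum>j=1..n. far_col j \<omega>\<bar> + (\<Sum>j=1..n. near_col j \<omega>)"
    proof -
      have "(\<Sum>j=1..n. \<Sum>i\<in>{1..<j}. R i j \<omega>) = (\<Sum>j=1..n. far_col j \<omega>)
          + (\<Sum>j=1..n. (\<Sum>i\<in>{1..<j}. R i j \<omega>) - far_col j \<omega>)"
        by (simp add: sum_subtractf)
      moreover have "\<bar>\<Sum>j=1..n. (\<Sum>i\<in>{1..<j}. R i j \<omega>) - far_col j \<omega>\<bar> \<le> (\<Sum>j=1..n. near_col j \<omega>)"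
        by (intro order_trans[OF sum_abs] sum_mono col)
      ultimately show ?thesis
        by linarith
    qed
    then have "\<bar>\<Sum>j=1..n. \<Sum>i\<in>{1..<j}. R i j \<omega>\<bar> / real n powr (3 / 2)
        \<le> \<bar>\<Sum>j=1..n. far_col j \<omega>\<bar> / real n powr (3 / 2) + (\<Sum>j=1..n. near_col j \<omega> / real n powr (3 / 2))"
      by (simp add: divide_right_mono flip: add_divide_distrib sum_divide_distrib)
    also have "(\<Sum>j=1..n. near_col j \<omega> / real n powr (3 / 2)) \<le> (\<Sum>j=1..n. near_col j \<omega> / real j powr (3 / 2))"
      by (intro sum_mono divide_left_mono near_nonneg powr_mono2) auto
    also have "\<dots> = (\<Sum>j<n. near_col (Suc j) \<omega> / real (Suc j) powr (3 / 2))"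
      by (rule sum.reindex_bij_witness[where j = "\<lambda>j. j - 1" and i = Suc]) auto
    finally have "ennreal (\<bar>\<Sum>j=1..n. \<Sum>i\<in>{1..<j}. R i j \<omega>\<bar> / real n powr (3 / 2))
        \<le> ennreal (\<bar>\<Sum>j=1..n. far_col j \<omega>\<bar> / real n powr (3 / 2) + (\<Sum>j<n. near_col (Suc j) \<omega> / real (Suc j) powr (3 / 2)))"
      by (intro ennreal_leI) auto
    also have "\<dots> = ennreal (\<bar>\<Sum>j=1..n. far_col j \<omega>\<bar> / real n powr (3 / 2))
        + (\<Sum>j<n. ennreal (near_col (Suc j) \<omega> / real (Suc j) powr (3 / 2)))"
      using near_nonneg by (simp add: sum_nonneg)
    also have "\<dots> \<le> A \<omega> + B \<omega>"
      unfolding A_def B_def using n by (intro add_mono SUP_upper sum_le_suminf summableI) auto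
    finally show "ennreal (\<bar>\<Sum>j=1..n. \<Sum>i\<in>{1..<j}. R i j \<omega>\<bar> / real n powr (3 / 2)) \<le> A \<omega> + B \<omega>" .
  qed
  have "Lp_norm M 2 (\<lambda>\<omega>. SUP n\<in>{1..}. ennreal (\<bar>\<Sum>j=1..n. \<Sum>i\<in>{1..<j}. R i j \<omega>\<bar> / real n powr (3 / 2)))
      \<le> Lp_norm M 2 (\<lambda>\<omega>. A \<omega> + B \<omega>)"
    by (intro Lp_norm_mono pt) auto
  also have "\<dots> \<le> Lp_norm M 2 A + Lp_norm M 2 B"
    by (intro Lp_norm_add_le) auto
  also have "\<dots> \<le> ennreal (22 * sqrt (real m) * \<kappa>) + ennreal (4 * sqrt (real m) * \<kappa>)"
    unfolding A_def[abs_def] B_def[abs_def] by (intro add_mono far_part near_part)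
  also have "\<dots> = ennreal (22 * sqrt (real m) * \<kappa> + 4 * sqrt (real m) * \<kappa>)"
    using \<kappa> by (intro ennreal_plus[symmetric]) auto
  finally show ?thesis
    by (simp add: algebra_simps)
qed

end

section \<open>Kernels of m-dependent fields\<close>

text \<open>The number 160 is \<open>2 * 26 * 3 + 4\<close>: the array bound 26 with remainder norm
  \<open>3 * \<kappa>\<close>, doubled by the passage from the p-norm to the 2-norm, and the 4 from
  the first members of the residue classes.\<close>

definition ustat_const :: "real \<Rightarrow> real" where
  "ustat_const p = lil_const p + 160"

text \<open>Every index occurs in exactly \<open>n - 1\<close> of the pairs.\<close>

lemma sum_pairs_additive:
  fixes z :: "nat \<Rightarrow> real"
  assumes "1 \<le> n"
  shows "(\<Sum>j=1..n. \<Sum>i\<in>{1..<j}. z i + z j) = (real n - 1) * (\<Sum>j=1..n. z j)"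
  using assms
proof (induction n rule: nat_induct_at_least)
  case (Suc n)
  have "(\<Sum>i\<in>{1..<Suc n}. z i + z (Suc n)) = (\<Sum>j=1..n. z j) + real n * z (Suc n)"
    by (simp add: sum.distrib atLeastLessThanSuc_atLeastAtMost)
  then show ?case
    using Suc by (simp add: algebra_simps)
qed simp

lemma (in prob_space) square_expectation_le:
  fixes f :: "'a \<Rightarrow> real"
  assumes [measurable]: "f \<in> borel_measurable M" and f: "integrable M (\<lambda>x. (f x)\<^sup>2)"
  shows "(expectation f)\<^sup>2 \<le> expectation (\<lambda>x. (f x)\<^sup>2)"
proof -
  have "integrable M f"
    by (rule square_integrable_imp_integrable[OF _ f]) measurable
  from variance_eq[OF this f] variance_positive[of f] show ?thesis
    by linarith
qed

lemma (in prob_space) variance_le_second_moment: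
  fixes f :: "'a \<Rightarrow> real"
  assumes [measurable]: "f \<in> borel_measurable M" and f: "integrable M (\<lambda>x. (f x)\<^sup>2)"
  shows "variance f \<le> expectation (\<lambda>x. (f x)\<^sup>2)"
proof -
  have "integrable M f"
    by (rule square_integrable_imp_integrable[OF _ f]) measurable
  from variance_eq[OF this f] show ?thesis
    by simp
qed

text \<open>A product of two kernel values involves four positions. \<open>\<xi>_indep_far\<close>
  isolates one of them from the other three, which may coincide or depend on each other; it is
  phrased as a product law so that Fubini applies directly.\<close>

locale m_dependent_field = prob_space +
  fixes W :: "'b measure" and \<xi> :: "nat \<Rightarrow> 'a \<Rightarrow> 'b" and m :: nat
  assumes m: "1 \<le> m"
    and \<xi>_ident: "\<And>i. distr M W (\<xi> i) = distr M W (\<xi> 0)"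
    and measurable_\<xi> [measurable]: "\<And>i. \<xi> i \<in> measurable M W"
    and \<xi>_indep_far: "\<And>a b c d. int m \<le> \<bar>int a - int d\<bar> \<Longrightarrow> int m \<le> \<bar>int b - int d\<bar> \<Longrightarrow> int m \<le> \<bar>int c - int d\<bar> \<Longrightarrow>
      distr M ((W \<Otimes>\<^sub>M (W \<Otimes>\<^sub>M W)) \<Otimes>\<^sub>M W) (\<lambda>\<omega>. ((\<xi> a \<omega>, \<xi> b \<omega>, \<xi> c \<omega>), \<xi> d \<omega>))
        = distr M (W \<Otimes>\<^sub>M (W \<Otimes>\<^sub>M W)) (\<lambda>\<omega>. (\<xi> a \<omega>, \<xi> b \<omega>, \<xi> c \<omega>)) \<Otimes>\<^sub>M distr M W (\<xi> d)"
    and \<xi>_indep_class: "\<And>b. indep_vars (\<lambda>_. W) (\<lambda>r. \<xi> (b + m * Suc r)) UNIV"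
begin

definition law :: "'b measure" where
  "law = distr M W (\<xi> 0)"

lemma law_eq: "distr M W (\<xi> i) = law"
  unfolding law_def by (rule \<xi>_ident)

sublocale law: prob_space law
  unfolding law_def by (rule prob_space_distr) measurable

lemma sets_law [measurable_cong, simp]: "sets law = sets W"
  by (simp add: law_def)

lemma space_law [simp]: "space law = space W"
  by (simp add: law_def)

lemma law_prob_space: "measure law (space W) = 1"
  using law.prob_space by simp

sublocale law2: pair_prob_space law law ..

text \<open>The triple is taken constantly equal to \<open>\<xi> i\<close>, and the law is projected
  to its first component.\<close>

lemma distr_pair:
  assumes "i + m \<le> j"
  shows "distr M (W \<Otimes>\<^sub>M W) (\<lambda>\<omega>. (\<xi> i \<omega>, \<xi> j \<omega>)) = law \<Otimes>\<^sub>M law"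
proof -
  define P where "P = distr M (W \<Otimes>\<^sub>M (W \<Otimes>\<^sub>M W)) (\<lambda>\<omega>. (\<xi> i \<omega>, \<xi> i \<omega>, \<xi> i \<omega>))"
  have [measurable_cong]: "sets P = sets (W \<Otimes>\<^sub>M (W \<Otimes>\<^sub>M W))"
    by (simp add: P_def)
  have "int m \<le> \<bar>int i - int j\<bar>"
    using assms by simp
  from \<xi>_indep_far[OF this this this]
  have joint: "distr M ((W \<Otimes>\<^sub>M (W \<Otimes>\<^sub>M W)) \<Otimes>\<^sub>M W) (\<lambda>\<omega>. ((\<xi> i \<omega>, \<xi> i \<omega>, \<xi> i \<omega>), \<xi> j \<omega>)) = P \<Otimes>\<^sub>M law"
    by (simp add: P_def law_eq)
  have "distr M (W \<Otimes>\<^sub>M W) (\<lambda>\<omega>. (\<xi> i \<omega>, \<xi> j \<omega>))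
      = distr (distr M ((W \<Otimes>\<^sub>M (W \<Otimes>\<^sub>M W)) \<Otimes>\<^sub>M W) (\<lambda>\<omega>. ((\<xi> i \<omega>, \<xi> i \<omega>, \<xi> i \<omega>), \<xi> j \<omega>)))
          (W \<Otimes>\<^sub>M W) (\<lambda>(x, y). (fst x, y))"
    by (subst distr_distr) (auto simp: comp_def)
  also have "\<dots> = distr P W fst \<Otimes>\<^sub>M distr law W (\<lambda>y. y)"
    unfolding joint
    by (rule pair_measure_distr[symmetric]) (auto intro!: prob_space_imp_sigma_finite law.prob_space_distr)
  also have "distr P W fst = law"
    unfolding P_def by (subst distr_distr) (auto simp: comp_def law_eq)
  also have "distr law W (\<lambda>y. y) = law"
    by (rule distr_id2) simp
  finally show ?thesis .
qed

lemma integral_law: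
  fixes \<phi> :: "'b \<Rightarrow> real"
  assumes [measurable]: "\<phi> \<in> borel_measurable W"
  shows "expectation (\<lambda>\<omega>. \<phi> (\<xi> i \<omega>)) = (\<integral>x. \<phi> x \<partial>law)"
  unfolding law_eq[of i, symmetric] by (simp add: integral_distr)

lemma integrable_law:
  fixes \<phi> :: "'b \<Rightarrow> real"
  assumes [measurable]: "\<phi> \<in> borel_measurable W"
  shows "integrable M (\<lambda>\<omega>. \<phi> (\<xi> i \<omega>)) \<longleftrightarrow> integrable law \<phi>"
  unfolding law_eq[of i, symmetric] by (simp add: integrable_distr_eq)

end

locale m_dependent_kernel = m_dependent_field +
  fixes K :: "'b \<Rightarrow> 'b \<Rightarrow> real" and \<kappa> :: real
  assumes measurable_K_pair: "case_prod K \<in> borel_measurable (W \<Otimes>\<^sub>M W)"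
    and K_sym: "\<And>x y. K x y = K y x"
    and \<kappa>: "0 < \<kappa>"
    and K_square_int: "\<And>i j. i < j \<Longrightarrow> integrable M (\<lambda>\<omega>. (K (\<xi> i \<omega>) (\<xi> j \<omega>))\<^sup>2)"
    and K_second_moment: "\<And>i j. i < j \<Longrightarrow> expectation (\<lambda>\<omega>. (K (\<xi> i \<omega>) (\<xi> j \<omega>))\<^sup>2) \<le> \<kappa>\<^sup>2"
begin

lemma measurable_K [measurable (raw)]:
  assumes [measurable]: "f \<in> measurable N W" "g \<in> measurable N W"
  shows "(\<lambda>x. K (f x) (g x)) \<in> borel_measurable N"
proof -
  have "(\<lambda>x. case_prod K (f x, g x)) \<in> borel_measurable N"
    by (rule measurable_compose[OF _ measurable_K_pair]) measurable
  then show ?thesis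
    by simp
qed

section \<open>Hoeffding's decomposition with respect to \<open>law\<close>\<close>

definition proj :: "'b \<Rightarrow> real" where
  "proj x = (\<integral>y. K x y \<partial>law)"

definition mean_K :: real where
  "mean_K = (\<integral>x. proj x \<partial>law)"

definition lin :: "'b \<Rightarrow> real" where
  "lin x = proj x - mean_K"

definition degen :: "'b \<Rightarrow> 'b \<Rightarrow> real" where
  "degen x y = K x y - lin x - lin y - mean_K"

lemma measurable_proj [measurable]: "proj \<in> borel_measurable W"
proof -
  have "(\<lambda>x. \<integral>y. K x y \<partial>law) \<in> borel_measurable W"
    by measurable
  then show ?thesis
    by (simp add: proj_def[abs_def])
qed

lemma measurable_lin [measurable]: "lin \<in> borel_measurable W"
  unfolding lin_def by measurable

lemma measurable_degen [measurable (raw)]: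
  assumes [measurable]: "f \<in> measurable N W" "g \<in> measurable N W"
  shows "(\<lambda>x. degen (f x) (g x)) \<in> borel_measurable N"
  unfolding degen_def by measurable

lemma degen_sym: "degen x y = degen y x"
  by (simp add: degen_def K_sym[of x y])

lemma K_square_int_law: "integrable (law \<Otimes>\<^sub>M law) (\<lambda>z. (K (fst z) (snd z))\<^sup>2)"
  using K_square_int[of 0 m] m unfolding distr_pair[of 0 m, simplified, symmetric]
  by (subst integrable_distr_eq) auto

lemma K_second_moment_law: "(\<integral>z. (K (fst z) (snd z))\<^sup>2 \<partial>(law \<Otimes>\<^sub>M law)) \<le> \<kappa>\<^sup>2"
  using K_second_moment[of 0 m] m unfolding distr_pair[of 0 m, simplified, symmetric]
  by (subst integral_distr) auto

lemma K_int_law: "integrable (law \<Otimes>\<^sub>M law) (\<lambda>z. K (fst z) (snd z))"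
  by (rule law2.square_integrable_imp_integrable[OF _ K_square_int_law]) measurable

lemma expectation_K_far: "i + m \<le> j \<Longrightarrow> expectation (\<lambda>\<omega>. K (\<xi> i \<omega>) (\<xi> j \<omega>)) = mean_K"
proof -
  assume ij: "i + m \<le> j"
  have "expectation (\<lambda>\<omega>. K (\<xi> i \<omega>) (\<xi> j \<omega>)) = (\<integral>z. K (fst z) (snd z) \<partial>(law \<Otimes>\<^sub>M law))"
    unfolding distr_pair[OF ij, symmetric] by (subst integral_distr) auto
  also have "\<dots> = mean_K"
    unfolding mean_K_def proj_def using law2.integral_fst'[OF K_int_law] by simp
  finally show ?thesis .
qed

text \<open>Jensen's inequality on almost every section \<open>K x\<close>, followed by
  Fubini.\<close>

lemma proj_square: "integrable law (\<lambda>x. (proj x)\<^sup>2)" "(\<integral>x. (proj x)\<^sup>2 \<partial>law) \<le> \<kappa>\<^sup>2"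
proof -
  define q where "q x = (\<integral>y. (K x y)\<^sup>2 \<partial>law)" for x
  have int_q: "integrable law q"
    unfolding q_def using law2.integrable_fst'[OF K_square_int_law] by simp
  have le: "AE x in law. (proj x)\<^sup>2 \<le> q x"
    using law2.AE_integrable_fst'[OF K_square_int_law]
  proof eventually_elim
    case (elim x)
    show ?case
    proof (cases "(\<lambda>y. K x y) \<in> borel_measurable law")
      case True
      then show ?thesis
        unfolding proj_def q_def using elim by (intro law.square_expectation_le) auto
    next
      case False
      then have "\<not> integrable law (\<lambda>y. K x y)"
        by auto
      then have "proj x = 0"
        by (simp add: proj_def not_integrable_integral_eq)
      then show ?thesis
        by (simp add: q_def)
    qed
  qed
  show int: "integrable law (\<lambda>x. (proj x)\<^sup>2)"
    by (rule Bochner_Integration.integrable_bound[OF int_q]) (use le in \<open>auto elim: eventually_mono\<close>)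
  have "(\<integral>x. (proj x)\<^sup>2 \<partial>law) \<le> (\<integral>x. q x \<partial>law)"
    by (rule integral_mono_AE[OF int int_q le])
  also have "\<dots> = (\<integral>z. (K (fst z) (snd z))\<^sup>2 \<partial>(law \<Otimes>\<^sub>M law))"
    unfolding q_def using law2.integral_fst'[OF K_square_int_law] by simp
  finally show "(\<integral>x. (proj x)\<^sup>2 \<partial>law) \<le> \<kappa>\<^sup>2"
    using K_second_moment_law by simp
qed

lemma integrable_proj: "integrable law proj"
  by (rule law.square_integrable_imp_integrable[OF _ proj_square(1)]) measurable

lemma integrable_lin: "integrable law lin"
  unfolding lin_def using integrable_proj by simp

lemma integral_lin: "(\<integral>x. lin x \<partial>law) = 0"
  unfolding lin_def using integrable_proj by (simp add: mean_K_def law_prob_space)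

lemma lin_square: "integrable law (\<lambda>x. (lin x)\<^sup>2)" "(\<integral>x. (lin x)\<^sup>2 \<partial>law) \<le> \<kappa>\<^sup>2"
proof -
  show "integrable law (\<lambda>x. (lin x)\<^sup>2)"
    unfolding lin_def power2_diff using integrable_proj proj_square(1) by simp
  have "(\<integral>x. (lin x)\<^sup>2 \<partial>law) \<le> (\<integral>x. (proj x)\<^sup>2 \<partial>law)"
    using law.variance_le_second_moment[OF _ proj_square(1)] by (simp add: lin_def mean_K_def)
  then show "(\<integral>x. (lin x)\<^sup>2 \<partial>law) \<le> \<kappa>\<^sup>2"
    using proj_square(2) by simp
qed

text \<open>For the null set of \<open>x\<close> where \<open>K x\<close> is not integrable both sides are \<open>0\<close> by convention.\<close>

lemma integral_degen: "(\<integral>y. degen x y \<partial>law) = 0"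
proof (cases "integrable law (\<lambda>y. K x y)")
  case True
  then have "(\<integral>y. degen x y \<partial>law) = proj x - lin x - 0 - mean_K"
    unfolding degen_def using integrable_lin integral_lin
    by (simp add: proj_def law_prob_space)
  then show ?thesis
    by (simp add: lin_def)
next
  case False
  have "\<not> integrable law (\<lambda>y. degen x y)"
  proof
    assume "integrable law (\<lambda>y. degen x y)"
    then have "integrable law (\<lambda>y. degen x y + (lin x + lin y + mean_K))"
      using integrable_lin by (intro Bochner_Integration.integrable_add) auto
    with False show False
      by (simp add: degen_def)
  qed
  then show ?thesis
    by (rule not_integrable_integral_eq)
qed

text \<open>Centring uses the actual expectation of each pair. For near pairs it may differ from
  \<open>mean_K\<close>; for far pairs the two agree, and \<open>rem\<close> is the degenerate
  kernel.\<close>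

definition rem :: "nat \<Rightarrow> nat \<Rightarrow> 'a \<Rightarrow> real" where
  "rem i j \<omega> = K (\<xi> i \<omega>) (\<xi> j \<omega>) - expectation (\<lambda>\<omega>. K (\<xi> i \<omega>) (\<xi> j \<omega>))
    - lin (\<xi> i \<omega>) - lin (\<xi> j \<omega>)"

lemma measurable_rem [measurable]: "rem i j \<in> borel_measurable M"
  unfolding rem_def by measurable

lemma rem_far: "i + m \<le> j \<Longrightarrow> rem i j \<omega> = degen (\<xi> i \<omega>) (\<xi> j \<omega>)"
  by (simp add: rem_def degen_def expectation_K_far)

lemma rem_square:
  assumes "i < j"
  shows "integrable M (\<lambda>\<omega>. (rem i j \<omega>)\<^sup>2)" "expectation (\<lambda>\<omega>. (rem i j \<omega>)\<^sup>2) \<le> (3 * \<kappa>)\<^sup>2"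
proof -
  define c where "c = expectation (\<lambda>\<omega>. K (\<xi> i \<omega>) (\<xi> j \<omega>))"
  define B where "B \<omega> = 3 * (K (\<xi> i \<omega>) (\<xi> j \<omega>) - c)\<^sup>2 + 3 * (lin (\<xi> i \<omega>))\<^sup>2 + 3 * (lin (\<xi> j \<omega>))\<^sup>2" for \<omega>
  have K_int: "integrable M (\<lambda>\<omega>. K (\<xi> i \<omega>) (\<xi> j \<omega>))"
    by (rule square_integrable_imp_integrable[OF _ K_square_int[OF assms]]) measurable
  have K2_int: "integrable M (\<lambda>\<omega>. (K (\<xi> i \<omega>) (\<xi> j \<omega>) - c)\<^sup>2)"
    unfolding power2_diff using K_int K_square_int[OF assms] by simp
  have K2_le: "expectation (\<lambda>\<omega>. (K (\<xi> i \<omega>) (\<xi> j \<omega>) - c)\<^sup>2) \<le> \<kappa>\<^sup>2"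
    using variance_le_second_moment[OF _ K_square_int[OF assms]] K_second_moment[OF assms]
    by (simp add: c_def)
  have lin_int: "integrable M (\<lambda>\<omega>. (lin (\<xi> k \<omega>))\<^sup>2)"
    and lin_le: "expectation (\<lambda>\<omega>. (lin (\<xi> k \<omega>))\<^sup>2) \<le> \<kappa>\<^sup>2" for k
    using lin_square integrable_law[of "\<lambda>x. (lin x)\<^sup>2" k] integral_law[of "\<lambda>x. (lin x)\<^sup>2" k] by auto
  have B_int: "integrable M B"
    unfolding B_def using K2_int lin_int by simp
  have le: "(rem i j \<omega>)\<^sup>2 \<le> B \<omega>" for \<omega>
  proof -
    have "(a - b - d)\<^sup>2 \<le> 3 * a\<^sup>2 + 3 * b\<^sup>2 + 3 * d\<^sup>2" for a b d :: real
    proof -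
      \<comment> \<open>This sum of squares is precisely the right-hand side minus the left-hand
        side.\<close>
      have "0 \<le> (a + b)\<^sup>2 + (a + d)\<^sup>2 + (b - d)\<^sup>2"
        by simp
      then show ?thesis
        by (simp add: power2_eq_square algebra_simps)
    qed
    then show ?thesis
      by (simp add: rem_def B_def c_def)
  qed
  show int: "integrable M (\<lambda>\<omega>. (rem i j \<omega>)\<^sup>2)"
    by (rule Bochner_Integration.integrable_bound[OF B_int]) (use le in \<open>auto intro: order_trans[OF _ abs_ge_self]\<close>)
  have "expectation (\<lambda>\<omega>. (rem i j \<omega>)\<^sup>2) \<le> expectation B"
    by (intro integral_mono int B_int le)
  also have "\<dots> = 3 * expectation (\<lambda>\<omega>. (K (\<xi> i \<omega>) (\<xi> j \<omega>) - c)\<^sup>2)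
      + 3 * expectation (\<lambda>\<omega>. (lin (\<xi> i \<omega>))\<^sup>2) + 3 * expectation (\<lambda>\<omega>. (lin (\<xi> j \<omega>))\<^sup>2)"
    unfolding B_def using K2_int lin_int by simp
  also have "\<dots> \<le> (3 * \<kappa>)\<^sup>2"
    using K2_le lin_le[of i] lin_le[of j] by (simp add: power_mult_distrib)
  finally show "expectation (\<lambda>\<omega>. (rem i j \<omega>)\<^sup>2) \<le> (3 * \<kappa>)\<^sup>2" .
qed

text \<open>The isolated variable \<open>\<xi> d\<close> is independent of the triple and occurs in
  one factor only. Integrating it first gives 0 by degeneracy.\<close>

lemma expectation_degen_mult:
  assumes far: "int m \<le> \<bar>int a - int d\<bar>" "int m \<le> \<bar>int b - int d\<bar>" "int m \<le> \<bar>int c - int d\<bar>"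
    and int: "integrable M (\<lambda>\<omega>. degen (\<xi> a \<omega>) (\<xi> b \<omega>) * degen (\<xi> c \<omega>) (\<xi> d \<omega>))"
  shows "expectation (\<lambda>\<omega>. degen (\<xi> a \<omega>) (\<xi> b \<omega>) * degen (\<xi> c \<omega>) (\<xi> d \<omega>)) = 0"
proof -
  define P where "P = distr M (W \<Otimes>\<^sub>M (W \<Otimes>\<^sub>M W)) (\<lambda>\<omega>. (\<xi> a \<omega>, \<xi> b \<omega>, \<xi> c \<omega>))"
  interpret P: prob_space P
    unfolding P_def by (rule prob_space_distr) measurable
  interpret PL: pair_prob_space P law ..
  have [measurable_cong]: "sets P = sets (W \<Otimes>\<^sub>M (W \<Otimes>\<^sub>M W))"
    by (simp add: P_def)
  define \<Psi> where "\<Psi> z = degen (fst (fst z)) (fst (snd (fst z))) * degen (snd (snd (fst z))) (snd z)" for z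
  have [measurable]: "\<Psi> \<in> borel_measurable ((W \<Otimes>\<^sub>M (W \<Otimes>\<^sub>M W)) \<Otimes>\<^sub>M W)"
    unfolding \<Psi>_def by measurable
  have joint: "P \<Otimes>\<^sub>M law = distr M ((W \<Otimes>\<^sub>M (W \<Otimes>\<^sub>M W)) \<Otimes>\<^sub>M W) (\<lambda>\<omega>. ((\<xi> a \<omega>, \<xi> b \<omega>, \<xi> c \<omega>), \<xi> d \<omega>))"
    using \<xi>_indep_far[OF far] by (simp add: P_def law_eq)
  have int': "integrable (P \<Otimes>\<^sub>M law) \<Psi>"
    unfolding joint using int by (subst integrable_distr_eq) (auto simp: \<Psi>_def)
  have "expectation (\<lambda>\<omega>. degen (\<xi> a \<omega>) (\<xi> b \<omega>) * degen (\<xi> c \<omega>) (\<xi> d \<omega>)) = (\<integral>z. \<Psi> z \<partial>(P \<Otimes>\<^sub>M law))"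
    unfolding joint by (subst integral_distr) (auto simp: \<Psi>_def)
  also have "\<dots> = (\<integral>x. \<integral>y. \<Psi> (x, y) \<partial>law \<partial>P)"
    by (rule PL.integral_fst'[OF int', symmetric])
  also have "\<dots> = 0"
    by (simp add: \<Psi>_def integral_degen)
  finally show ?thesis .
qed

lemma integrable_rem_mult:
  "i < j \<Longrightarrow> i' < j' \<Longrightarrow> integrable M (\<lambda>\<omega>. rem i j \<omega> * rem i' j' \<omega>)"
  by (intro integrable_mult_of_squares rem_square) auto

sublocale rem: orthogonal_array M rem m "3 * \<kappa>"
proof
  show "1 \<le> m" "0 < 3 * \<kappa>"
    using m \<kappa> by auto
  show "rem i j \<in> borel_measurable M" for i j
    by measurable
  show "integrable M (\<lambda>\<omega>. (rem i j \<omega>)\<^sup>2)" "expectation (\<lambda>\<omega>. (rem i j \<omega>)\<^sup>2) \<le> (3 * \<kappa>)\<^sup>2" if "i < j" for i j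
    using rem_square[OF that] by auto
  show "expectation (\<lambda>\<omega>. rem i j \<omega> * rem i' j' \<omega>) = 0"
    if "i + m \<le> j" "i' + m \<le> j'" "j + m \<le> j'" for i j i' j'
  proof -
    \<comment> \<open>The isolated position is \<open>j'\<close>: each of \<open>i\<close>,
      \<open>j\<close> and \<open>i'\<close> is at least \<open>m\<close> below it.\<close>
    have "i < j" "i' < j'"
      using that m by auto
    from integrable_rem_mult[OF this] show ?thesis
      using that by (simp add: rem_far) (intro expectation_degen_mult, auto)
  qed
  show "expectation (\<lambda>\<omega>. rem i j \<omega> * rem i' j \<omega>) = 0"
    if "i + m \<le> i'" "i' + m \<le> j" for i i' j
  proof -
    have "i' < j" "i < j" "i + m \<le> j"
      using that m by auto
    \<comment> \<open>Both factors share \<open>j\<close>, so the isolated position is the smallest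
      one, \<open>i\<close>. Symmetry of \<open>degen\<close> moves it to the last argument.\<close>
    have "integrable M (\<lambda>\<omega>. degen (\<xi> i' \<omega>) (\<xi> j \<omega>) * degen (\<xi> j \<omega>) (\<xi> i \<omega>))"
      using integrable_rem_mult[OF \<open>i' < j\<close> \<open>i < j\<close>] that \<open>i + m \<le> j\<close>
      by (simp add: rem_far degen_sym[of "\<xi> j _" "\<xi> i _"])
    then have "expectation (\<lambda>\<omega>. degen (\<xi> i' \<omega>) (\<xi> j \<omega>) * degen (\<xi> j \<omega>) (\<xi> i \<omega>)) = 0"
      using that by (intro expectation_degen_mult) auto
    then show ?thesis
      using that \<open>i + m \<le> j\<close> by (simp add: rem_far degen_sym[of "\<xi> j _" "\<xi> i _"] mult.commute)
  qed
qed

lemma lin_part: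
  assumes p: "1 \<le> p" "p < 2"
  shows "Lp_norm M p (\<lambda>\<omega>. SUP n\<in>{1..}. ennreal (\<bar>\<Sum>j=1..n. lin (\<xi> j \<omega>)\<bar> / sqrt (real n * LL (real n))))
    \<le> ennreal ((lil_const p + 4) * sqrt (real m) * \<kappa>)"
proof (rule m_dependent_Lp_norm_sup_partial_sums[OF p \<kappa> m])
  show "indep_vars (\<lambda>_. borel) (\<lambda>r \<omega>. lin (\<xi> (b + m * Suc r) \<omega>)) UNIV" for b
    by (rule indep_vars_compose2[OF \<xi>_indep_class, of "\<lambda>_. lin"]) measurable
  show "distr M borel (\<lambda>\<omega>. lin (\<xi> i \<omega>)) = distr M borel (\<lambda>\<omega>. lin (\<xi> j \<omega>))" for i j
  proof -
    have "distr M borel (\<lambda>\<omega>. lin (\<xi> k \<omega>)) = distr law borel lin" for k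
      unfolding law_eq[of k, symmetric] by (subst distr_distr) (auto simp: comp_def)
    then show ?thesis
      by simp
  qed
  show "integrable M (\<lambda>\<omega>. (lin (\<xi> j \<omega>))\<^sup>2)" "expectation (\<lambda>\<omega>. (lin (\<xi> j \<omega>))\<^sup>2) \<le> \<kappa>\<^sup>2" for j
    using lin_square integrable_law[of "\<lambda>x. (lin x)\<^sup>2" j] integral_law[of "\<lambda>x. (lin x)\<^sup>2" j] by auto
  show "expectation (\<lambda>\<omega>. lin (\<xi> j \<omega>)) = 0" for j
    by (simp add: integral_law integral_lin)
qed measurable

text \<open>The factor \<open>n - 1\<close> of the linear part lowers \<open>n powr (3 / 2)\<close>
  to \<open>sqrt n\<close>, so the normalisation becomes that of the law of the iterated logarithm.
  For the remainder, \<open>sqrt (LL n) \<ge> 1\<close> is simply dropped.\<close>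

theorem Lp_norm_sup_ustat:
  assumes p: "1 \<le> p" "p < 2"
  shows "Lp_norm M p (\<lambda>\<omega>. SUP n\<in>{1..}. ennreal (1 / (real n powr (3 / 2) * sqrt (LL (real n)))
      * \<bar>\<Sum>j=1..n. \<Sum>i\<in>{1..<j}. K (\<xi> i \<omega>) (\<xi> j \<omega>) - expectation (\<lambda>\<omega>. K (\<xi> i \<omega>) (\<xi> j \<omega>))\<bar>))
    \<le> ennreal (ustat_const p * sqrt (real m) * \<kappa>)"
proof -
  define A where "A \<omega> = (SUP n\<in>{1..}. ennreal (\<bar>\<Sum>j=1..n. \<Sum>i\<in>{1..<j}. rem i j \<omega>\<bar> / real n powr (3 / 2)))" for \<omega>
  define B where "B \<omega> = (SUP n\<in>{1..}. ennreal (\<bar>\<Sum>j=1..n. lin (\<xi> j \<omega>)\<bar> / sqrt (real n * LL (real n))))" for \<omega>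
  have [measurable]: "A \<in> borel_measurable M" "B \<in> borel_measurable M"
    unfolding A_def B_def by measurable
  have pt: "(SUP n\<in>{1..}. ennreal (1 / (real n powr (3 / 2) * sqrt (LL (real n)))
      * \<bar>\<Sum>j=1..n. \<Sum>i\<in>{1..<j}. K (\<xi> i \<omega>) (\<xi> j \<omega>) - expectation (\<lambda>\<omega>. K (\<xi> i \<omega>) (\<xi> j \<omega>))\<bar>)) \<le> A \<omega> + B \<omega>" for \<omega>
  proof (rule SUP_least)
    fix n :: nat assume "n \<in> {1..}"
    then have n: "1 \<le> n" by simp
    define T where "T = (\<Sum>j=1..n. \<Sum>i\<in>{1..<j}. rem i j \<omega>)"
    define S where "S = (\<Sum>j=1..n. lin (\<xi> j \<omega>))"
    define s where "s = sqrt (LL (real n))"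
    have s: "1 \<le> s"
      using LL_ge_1[of "real n"] by (simp add: s_def)
    have eq: "(\<Sum>j=1..n. \<Sum>i\<in>{1..<j}. K (\<xi> i \<omega>) (\<xi> j \<omega>) - expectation (\<lambda>\<omega>. K (\<xi> i \<omega>) (\<xi> j \<omega>)))
        = T + (real n - 1) * S"
    proof -
      have "T + (real n - 1) * S = (\<Sum>j=1..n. \<Sum>i\<in>{1..<j}. rem i j \<omega> + (lin (\<xi> i \<omega>) + lin (\<xi> j \<omega>)))"
        unfolding T_def S_def sum_pairs_additive[OF n, symmetric] by (simp add: sum.distrib)
      also have "\<dots> = (\<Sum>j=1..n. \<Sum>i\<in>{1..<j}. K (\<xi> i \<omega>) (\<xi> j \<omega>) - expectation (\<lambda>\<omega>. K (\<xi> i \<omega>) (\<xi> j \<omega>)))"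
        by (simp add: rem_def)
      finally show ?thesis ..
    qed
    have n32: "real n powr (3 / 2) = real n * sqrt (real n)"
      using n powr_add[of "real n" 1 "1 / 2"] by (simp add: powr_half_sqrt)
    have "1 / (real n powr (3 / 2) * s) * \<bar>T + (real n - 1) * S\<bar>
        \<le> \<bar>T\<bar> / real n powr (3 / 2) + \<bar>S\<bar> / (sqrt (real n) * s)"
    proof -
      have "\<bar>T + (real n - 1) * S\<bar> \<le> \<bar>T\<bar> * s + real n * \<bar>S\<bar>"
      proof -
        have "\<bar>(real n - 1) * S\<bar> \<le> real n * \<bar>S\<bar>"
          using n by (simp add: abs_mult mult_right_mono)
        moreover have "\<bar>T\<bar> * 1 \<le> \<bar>T\<bar> * s"
          using s by (intro mult_left_mono) auto
        ultimately show ?thesis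
          by linarith
      qed
      then have "1 / (real n powr (3 / 2) * s) * \<bar>T + (real n - 1) * S\<bar>
          \<le> 1 / (real n powr (3 / 2) * s) * (\<bar>T\<bar> * s + real n * \<bar>S\<bar>)"
        using s by (intro mult_left_mono) auto
      also have "\<dots> = \<bar>T\<bar> / real n powr (3 / 2) + \<bar>S\<bar> / (sqrt (real n) * s)"
        unfolding n32 using s n by (simp add: field_simps)
      finally show ?thesis .
    qed
    then have "ennreal (1 / (real n powr (3 / 2) * s) * \<bar>T + (real n - 1) * S\<bar>)
        \<le> ennreal (\<bar>T\<bar> / real n powr (3 / 2)) + ennreal (\<bar>S\<bar> / sqrt (real n * LL (real n)))"
      using s by (subst ennreal_plus[symmetric]) (auto simp: s_def real_sqrt_mult simp del: ennreal_plus intro!: ennreal_leI)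
    also have "\<dots> \<le> A \<omega> + B \<omega>"
      unfolding A_def B_def T_def S_def using n by (intro add_mono SUP_upper) auto
    finally show "ennreal (1 / (real n powr (3 / 2) * sqrt (LL (real n)))
      * \<bar>\<Sum>j=1..n. \<Sum>i\<in>{1..<j}. K (\<xi> i \<omega>) (\<xi> j \<omega>) - expectation (\<lambda>\<omega>. K (\<xi> i \<omega>) (\<xi> j \<omega>))\<bar>) \<le> A \<omega> + B \<omega>"
      unfolding eq s_def .
  qed
  have "Lp_norm M p (\<lambda>\<omega>. SUP n\<in>{1..}. ennreal (1 / (real n powr (3 / 2) * sqrt (LL (real n)))
      * \<bar>\<Sum>j=1..n. \<Sum>i\<in>{1..<j}. K (\<xi> i \<omega>) (\<xi> j \<omega>) - expectation (\<lambda>\<omega>. K (\<xi> i \<omega>) (\<xi> j \<omega>))\<bar>))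
    \<le> Lp_norm M p (\<lambda>\<omega>. A \<omega> + B \<omega>)"
    using p by (intro Lp_norm_mono pt) auto
  also have "\<dots> \<le> Lp_norm M p A + Lp_norm M p B"
    using p by (intro Lp_norm_add_le) auto
  also have "\<dots> \<le> 2 * ennreal (26 * sqrt (real m) * (3 * \<kappa>)) + ennreal ((lil_const p + 4) * sqrt (real m) * \<kappa>)"
  proof (rule add_mono)
    have "Lp_norm M p A \<le> 2 * Lp_norm M 2 A"
      using p by (intro Lp_norm_le_L2_norm) auto
    also have "\<dots> \<le> 2 * ennreal (26 * sqrt (real m) * (3 * \<kappa>))"
      unfolding A_def[abs_def] by (intro mult_left_mono rem.L2_norm_sup_triangular_sums) simp
    finally show "Lp_norm M p A \<le> 2 * ennreal (26 * sqrt (real m) * (3 * \<kappa>))" .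
    show "Lp_norm M p B \<le> ennreal ((lil_const p + 4) * sqrt (real m) * \<kappa>)"
      unfolding B_def[abs_def] by (rule lin_part[OF p])
  qed
  also have "\<dots> = ennreal (2 * (26 * sqrt (real m) * (3 * \<kappa>)) + (lil_const p + 4) * sqrt (real m) * \<kappa>)"
  proof -
    have "0 \<le> lil_const p"
      using geo_const_ge_1[of 1] geo_const_ge_1[of "2 - p"] p by (simp add: lil_const_def)
    then have "0 \<le> (lil_const p + 4) * sqrt (real m) * \<kappa>" "0 \<le> 2 * (26 * sqrt (real m) * (3 * \<kappa>))"
      using \<kappa> by auto
    then show ?thesis
      using ennreal_mult[of 2 "26 * sqrt (real m) * (3 * \<kappa>)"] by (simp only: ennreal_plus) simp
  qed
  also have "2 * (26 * sqrt (real m) * (3 * \<kappa>)) + (lil_const p + 4) * sqrt (real m) * \<kappa> = ustat_const p * sqrt (real m) * \<kappa>"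
    by (simp add: ustat_const_def algebra_simps)
  finally show ?thesis .
qed

end

section \<open>Windows of an i.i.d. field\<close>

lemma ustat_const_pos: "p < 2 \<Longrightarrow> 0 < ustat_const p"
  using geo_const_ge_1[of 1] geo_const_ge_1[of "2 - p"]
  by (simp add: ustat_const_def lil_const_def add_pos_nonneg)

lemma (in prob_space) distr_pair_indep:
  assumes indep: "indep_var S X T Y"
    and [measurable]: "f \<in> measurable S N" "g \<in> measurable T N'"
  shows "distr M (N \<Otimes>\<^sub>M N') (\<lambda>\<omega>. (f (X \<omega>), g (Y \<omega>)))
    = distr M N (\<lambda>\<omega>. f (X \<omega>)) \<Otimes>\<^sub>M distr M N' (\<lambda>\<omega>. g (Y \<omega>))"
proof -
  have [measurable]: "X \<in> measurable M S" "Y \<in> measurable M T"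
    using indep by (auto dest: indep_var_rv1 indep_var_rv2)
  interpret Y: prob_space "distr M T Y"
    by (rule prob_space_distr) measurable
  have "distr M (N \<Otimes>\<^sub>M N') (\<lambda>\<omega>. (f (X \<omega>), g (Y \<omega>)))
      = distr (distr M (S \<Otimes>\<^sub>M T) (\<lambda>\<omega>. (X \<omega>, Y \<omega>))) (N \<Otimes>\<^sub>M N') (\<lambda>(x, y). (f x, g y))"
    by (subst distr_distr) (auto simp: comp_def)
  also have "\<dots> = distr (distr M S X \<Otimes>\<^sub>M distr M T Y) (N \<Otimes>\<^sub>M N') (\<lambda>(x, y). (f x, g y))"
    using indep by (simp add: indep_var_distribution_eq)
  also have "\<dots> = distr (distr M S X) N f \<Otimes>\<^sub>M distr (distr M T Y) N' g"
    by (rule pair_measure_distr[symmetric])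
      (auto intro!: prob_space_imp_sigma_finite Y.prob_space_distr)
  also have "\<dots> = distr M N (\<lambda>\<omega>. f (X \<omega>)) \<Otimes>\<^sub>M distr M N' (\<lambda>\<omega>. g (Y \<omega>))"
    by (subst (1 2) distr_distr) (auto simp: comp_def)
  finally show ?thesis .
qed

section \<open>Functionals of the path and stationarity\<close>

abbreviation seq_space :: "(int \<Rightarrow> real) measure" where
  "seq_space \<equiv> PiM UNIV (\<lambda>_. borel)"

text \<open>The coordinate process on path space. Taking it in place of \<open>eps\<close> turns
  windows and shifted processes into measurable functionals of the path, so stationarity reduces to
  shift invariance of the law of the path.\<close>

abbreviation coord :: "int \<Rightarrow> (int \<Rightarrow> real) \<Rightarrow> real" where
  "coord u x \<equiv> x u"

lemma measurable_reindex_coord [measurable (raw)]: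
  "(\<lambda>x k. coord (\<tau> k) x) \<in> measurable seq_space seq_space"
  by (rule measurable_PiM_single') (auto simp: space_PiM)

lemma measurable_window_coord [measurable]: "window coord j l \<in> measurable seq_space (window_space l)"
  unfolding window_def window_space_def by (rule measurable_restrict) simp

lemma window_path: "window eps (j + s) l \<omega> = window coord j l (\<lambda>u. eps (u + s) \<omega>)"
  by (auto simp: window_def fun_eq_iff add_ac)

lemma shift_process_path: "shift_process eps f (j + s) \<omega> = shift_process coord f j (\<lambda>u. eps (u + s) \<omega>)"
  by (auto simp: shift_process_def algebra_simps intro!: arg_cong[where f = f])

locale iid_field = prob_space +
  fixes eps :: "int \<Rightarrow> 'a \<Rightarrow> real"
  assumes eps_indep: "indep_vars (\<lambda>_. borel) eps UNIV"
    and eps_ident: "\<And>u v. distr M borel (eps u) = distr M borel (eps v)"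
begin

lemma measurable_eps [measurable]: "eps u \<in> borel_measurable M"
  using eps_indep by (auto simp: indep_vars_def)

lemma measurable_path [measurable]: "(\<lambda>\<omega> u. eps (u + s) \<omega>) \<in> measurable M seq_space"
  by (rule measurable_PiM_single') (auto simp: space_PiM)

lemma measurable_path_0 [measurable]: "(\<lambda>\<omega> u. eps u \<omega>) \<in> measurable M seq_space"
  using measurable_path[of 0] by simp

lemma distr_path: "distr M seq_space (\<lambda>\<omega> u. eps (u + s) \<omega>) = PiM UNIV (\<lambda>_. distr M borel (eps 0))"
proof -
  \<comment> \<open>Independence is reindexed along \<open>u + s\<close> by grouping the family into
    singletons.\<close>
  have "indep_vars (\<lambda>u. PiM {u + s} (\<lambda>_. borel)) (\<lambda>u \<omega>. restrict (\<lambda>i. eps i \<omega>) {u + s}) UNIV"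
    by (rule indep_vars_restrict[OF eps_indep]) (auto simp: disjoint_family_on_def)
  then have "indep_vars (\<lambda>_. borel) (\<lambda>u \<omega>. (restrict (\<lambda>i. eps i \<omega>) {u + s}) (u + s)) UNIV"
    by (rule indep_vars_compose2[where Y = "\<lambda>u x. x (u + s)"]) simp
  then have "indep_vars (\<lambda>_. borel) (\<lambda>u. eps (u + s)) UNIV"
    by simp
  then have "distr M seq_space (\<lambda>\<omega>. \<lambda>u\<in>UNIV. eps (u + s) \<omega>) = PiM UNIV (\<lambda>u. distr M borel (eps (u + s)))"
    by (subst (asm) indep_vars_iff_distr_eq_PiM) auto
  also have "(\<lambda>u. distr M borel (eps (u + s))) = (\<lambda>_. distr M borel (eps 0))"
    by (intro ext eps_ident)
  finally show ?thesis
    by simp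
qed

lemma distr_shift:
  assumes [measurable]: "\<Phi> \<in> measurable seq_space N"
  shows "distr M N (\<lambda>\<omega>. \<Phi> (\<lambda>u. eps (u + s) \<omega>)) = distr M N (\<lambda>\<omega>. \<Phi> (\<lambda>u. eps u \<omega>))"
proof -
  have eq: "distr M N (\<lambda>\<omega>. \<Phi> (\<lambda>u. eps (u + t) \<omega>)) = distr (PiM UNIV (\<lambda>_. distr M borel (eps 0))) N \<Phi>" for t
    unfolding distr_path[of t, symmetric] by (subst distr_distr) (auto simp: comp_def)
  show ?thesis
    using eq[of s] eq[of 0] by simp
qed

lemma nn_integral_shift:
  assumes [measurable]: "\<Phi> \<in> borel_measurable seq_space"
  shows "(\<integral>\<^sup>+\<omega>. \<Phi> (\<lambda>u. eps (u + s) \<omega>) \<partial>M) = (\<integral>\<^sup>+\<omega>. \<Phi> (\<lambda>u. eps u \<omega>) \<partial>M)"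
proof -
  have eq: "(\<integral>\<^sup>+\<omega>. \<Phi> (\<lambda>u. eps (u + t) \<omega>) \<partial>M) = (\<integral>\<^sup>+x. \<Phi> x \<partial>PiM UNIV (\<lambda>_. distr M borel (eps 0)))" for t
    unfolding distr_path[of t, symmetric] by (subst nn_integral_distr) auto
  show ?thesis
    using eq[of s] eq[of 0] by simp
qed

lemma measure_shift:
  assumes [measurable]: "A \<in> sets seq_space"
  shows "measure M {\<omega>\<in>space M. (\<lambda>u. eps (u + s) \<omega>) \<in> A} = measure M {\<omega>\<in>space M. (\<lambda>u. eps u \<omega>) \<in> A}"
proof -
  have eq: "measure M {\<omega>\<in>space M. (\<lambda>u. eps (u + t) \<omega>) \<in> A} = measure (PiM UNIV (\<lambda>_. distr M borel (eps 0))) A" for t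
    unfolding distr_path[of t, symmetric]
    by (subst measure_distr) (auto intro!: arg_cong[where f = "measure M"])
  show ?thesis
    using eq[of s] eq[of 0] by simp
qed

lemma Lp_norm_shift:
  assumes [measurable]: "\<Phi> \<in> borel_measurable seq_space"
  shows "Lp_norm M p (\<lambda>\<omega>. \<Phi> (\<lambda>u. eps (u + s) \<omega>)) = Lp_norm M p (\<lambda>\<omega>. \<Phi> (\<lambda>u. eps u \<omega>))"
  unfolding Lp_norm_def by (subst nn_integral_shift[where \<Phi> = "\<lambda>x. ennpowr (\<Phi> x) p"]) auto

lemma window_path_0: "window eps j l \<omega> = window coord 0 l (\<lambda>u. eps (u + j) \<omega>)"
  using window_path[of eps 0 j] by simp

lemma measurable_window [measurable]: "window eps j l \<in> measurable M (window_space l)"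
  unfolding window_path_0[abs_def] by measurable

definition support :: "nat \<Rightarrow> nat \<Rightarrow> int set" where
  "support l i = {int i - int l..int i + int l}"

text \<open>The window around \<open>i\<close> as a function of the coordinates in any index set
  containing its support, so that disjoint index sets give independent windows.\<close>

definition rewindow :: "nat \<Rightarrow> nat \<Rightarrow> (int \<Rightarrow> real) \<Rightarrow> (int \<Rightarrow> real)" where
  "rewindow l i y = (\<lambda>k\<in>{- int l..int l}. y (int i + k))"

lemma measurable_rewindow:
  "support l i \<subseteq> A \<Longrightarrow> rewindow l i \<in> measurable (PiM A (\<lambda>_. borel)) (window_space l)"
  unfolding rewindow_def window_space_def support_def
  by (intro measurable_restrict measurable_component_singleton) auto

lemma rewindow_restrict:
  "support l i \<subseteq> A \<Longrightarrow> rewindow l i (restrict (\<lambda>u. eps u \<omega>) A) = window eps (int i) l \<omega>"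
  by (auto simp: rewindow_def window_def support_def fun_eq_iff restrict_def subset_iff)

text \<open>Windows of radius \<open>l\<close> use disjoint coordinates once their centres are at
  least \<open>2 * l + 1\<close> apart. All windows live on one space because they are indexed by
  offsets.\<close>

sublocale windows: m_dependent_field M "window_space l" "\<lambda>i. window eps (int i) l" "2 * l + 1" for l
proof
  show "1 \<le> 2 * l + 1"
    by simp
  show "window eps (int i) l \<in> measurable M (window_space l)" for i
    by measurable
  show "distr M (window_space l) (window eps (int i) l) = distr M (window_space l) (window eps (int 0) l)" for i
    unfolding window_path_0[abs_def] using distr_shift[OF measurable_window_coord[of 0 l], of "int i"] by simp
  show "indep_vars (\<lambda>_. window_space l) (\<lambda>r. window eps (int (b + (2 * l + 1) * Suc r)) l) UNIV" for b
  proof -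
    define c where "c r = b + (2 * l + 1) * Suc r" for r
    have "disjoint_family_on (\<lambda>r. support l (c r)) UNIV"
      unfolding disjoint_family_on_def
    proof (intro ballI impI)
      have "support l (c r) \<inter> support l (c s) = {}" if "r < s" for r s
      proof -
        have "(2 * l + 1) * Suc (Suc r) \<le> (2 * l + 1) * Suc s"
          using that by (intro mult_le_mono) auto
        then have "c r + 2 * l + 1 \<le> c s"
          by (simp add: c_def)
        then show ?thesis
          by (auto simp: support_def)
      qed
      then show "support l (c r) \<inter> support l (c s) = {}" if "r \<noteq> s" for r s
        using that by (metis Int_commute linorder_neqE_nat)
    qed
    then have "indep_vars (\<lambda>r. PiM (support l (c r)) (\<lambda>_. borel))
        (\<lambda>r \<omega>. restrict (\<lambda>i. eps i \<omega>) (support l (c r))) UNIV"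
      by (intro indep_vars_restrict[OF eps_indep]) auto
    then have "indep_vars (\<lambda>_. window_space l)
        (\<lambda>r \<omega>. rewindow l (c r) (restrict (\<lambda>i. eps i \<omega>) (support l (c r)))) UNIV"
      by (rule indep_vars_compose2[where Y = "\<lambda>r. rewindow l (c r)"]) (simp add: measurable_rewindow)
    then show ?thesis
      by (simp add: rewindow_restrict c_def)
  qed
  show "distr M ((window_space l \<Otimes>\<^sub>M window_space l \<Otimes>\<^sub>M window_space l) \<Otimes>\<^sub>M window_space l)
       (\<lambda>\<omega>. ((window eps (int a) l \<omega>, window eps (int b) l \<omega>, window eps (int c) l \<omega>), window eps (int d) l \<omega>)) =
      distr M (window_space l \<Otimes>\<^sub>M window_space l \<Otimes>\<^sub>M window_space l)
       (\<lambda>\<omega>. (window eps (int a) l \<omega>, window eps (int b) l \<omega>, window eps (int c) l \<omega>)) \<Otimes>\<^sub>M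
      distr M (window_space l) (window eps (int d) l)"
    if far: "int (2 * l + 1) \<le> \<bar>int a - int d\<bar>" "int (2 * l + 1) \<le> \<bar>int b - int d\<bar>" "int (2 * l + 1) \<le> \<bar>int c - int d\<bar>"
    for a b c d
  proof -
    \<comment> \<open>The three supports may overlap; it matters only that their union is disjoint
      from the support of \<open>d\<close>.\<close>
    define A where "A = support l a \<union> support l b \<union> support l c"
    have sub: "support l a \<subseteq> A" "support l b \<subseteq> A" "support l c \<subseteq> A"
      by (auto simp: A_def)
    have "A \<inter> support l d = {}"
      using far by (auto simp: A_def support_def)
    then have indep: "indep_var (PiM A (\<lambda>_. borel)) (\<lambda>\<omega>. restrict (\<lambda>i. eps i \<omega>) A)
        (PiM (support l d) (\<lambda>_. borel)) (\<lambda>\<omega>. restrict (\<lambda>i. eps i \<omega>) (support l d))"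
      by (intro indep_var_restrict[OF eps_indep]) auto
    have "(\<lambda>y. (rewindow l a y, rewindow l b y, rewindow l c y))
        \<in> measurable (PiM A (\<lambda>_. borel)) (window_space l \<Otimes>\<^sub>M window_space l \<Otimes>\<^sub>M window_space l)"
      by (intro measurable_Pair measurable_rewindow sub)
    from distr_pair_indep[OF indep this measurable_rewindow[OF order_refl]] show ?thesis
      by (simp add: rewindow_restrict sub cong: distr_cong)
  qed
qed

end

section \<open>Increments between consecutive window radii\<close>

definition pair_approx ::
    "(int \<Rightarrow> 'a \<Rightarrow> real) \<Rightarrow> (real \<Rightarrow> real \<Rightarrow> real) \<Rightarrow> (nat \<Rightarrow> (int \<Rightarrow> real) \<Rightarrow> real) \<Rightarrow>
      nat \<Rightarrow> int \<Rightarrow> int \<Rightarrow> 'a \<Rightarrow> real" where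
  "pair_approx eps h fl l i j \<omega> = h (fl l (window eps i l \<omega>)) (fl l (window eps j l \<omega>))"

lemma kernel_approx_eq: "kernel_approx eps h fl l j = pair_approx eps h fl l 0 (int j)"
  by (simp add: kernel_approx_def pair_approx_def fun_eq_iff)

definition pair_incr ::
    "(int \<Rightarrow> 'a \<Rightarrow> real) \<Rightarrow> (real \<Rightarrow> real \<Rightarrow> real) \<Rightarrow> (nat \<Rightarrow> (int \<Rightarrow> real) \<Rightarrow> real) \<Rightarrow>
      nat \<Rightarrow> int \<Rightarrow> int \<Rightarrow> 'a \<Rightarrow> real" where
  "pair_incr eps h fl l i j \<omega> =
    (case l of 0 \<Rightarrow> pair_approx eps h fl 0 i j \<omega>
     | Suc k \<Rightarrow> pair_approx eps h fl (Suc k) i j \<omega> - pair_approx eps h fl k i j \<omega>)"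

lemma sum_pair_incr: "(\<Sum>l<Suc n. pair_incr eps h fl l i j \<omega>) = pair_approx eps h fl n i j \<omega>"
  by (induction n) (simp_all add: pair_incr_def)

lemma theta2_eq: "theta2 M eps h fl l = (SUP j. Lp_norm M 2 (\<lambda>\<omega>. ennreal \<bar>pair_incr eps h fl l 0 (int j) \<omega>\<bar>))"
  by (cases l) (simp_all add: pair_incr_def kernel_approx_eq)

lemma pair_approx_path:
  "pair_approx eps h fl l (i + s) (j + s) \<omega> = pair_approx coord h fl l i j (\<lambda>u. eps (u + s) \<omega>)"
  by (simp add: pair_approx_def window_path)

lemma pair_incr_path:
  "pair_incr eps h fl l (i + s) (j + s) \<omega> = pair_incr coord h fl l i j (\<lambda>u. eps (u + s) \<omega>)"
  by (simp add: pair_incr_def pair_approx_path split: nat.split)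

text \<open>A kernel on windows of radius \<open>l\<close> alone: the window of the preceding radius
  is recovered by restriction, so an increment inherits the dependence range of level
  \<open>l\<close>.\<close>

definition level_kernel ::
    "(real \<Rightarrow> real \<Rightarrow> real) \<Rightarrow> (nat \<Rightarrow> (int \<Rightarrow> real) \<Rightarrow> real) \<Rightarrow> nat \<Rightarrow> (int \<Rightarrow> real) \<Rightarrow> (int \<Rightarrow> real) \<Rightarrow> real" where
  "level_kernel h fl l x y =
    (case l of 0 \<Rightarrow> h (fl 0 x) (fl 0 y)
     | Suc k \<Rightarrow> h (fl (Suc k) x) (fl (Suc k) y)
         - h (fl k (restrict x {- int k..int k})) (fl k (restrict y {- int k..int k})))"

lemma level_kernel_window:
  "level_kernel h fl l (window eps i l \<omega>) (window eps j l \<omega>) = pair_incr eps h fl l i j \<omega>"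
proof (cases l)
  case (Suc k)
  have "restrict (window eps i (Suc k) \<omega>) {- int k..int k} = window eps i k \<omega>" for i
    by (auto simp: window_def restrict_def fun_eq_iff)
  then show ?thesis
    by (simp add: Suc level_kernel_def pair_incr_def pair_approx_def)
qed (simp add: level_kernel_def pair_incr_def pair_approx_def)

sublocale bernoulli_ustat \<subseteq> iid_field
  by unfold_locales (rule eps_indep eps_ident)+

context bernoulli_ustat
begin

lemma measurable_h [measurable (raw)]:
  assumes [measurable]: "a \<in> borel_measurable N" "b \<in> borel_measurable N"
  shows "(\<lambda>x. h (a x) (b x)) \<in> borel_measurable N"
proof -
  have "(\<lambda>x. case_prod h (a x, b x)) \<in> borel_measurable N"
    by (rule measurable_compose[OF _ h_measurable]) measurable
  then show ?thesis
    by simp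
qed

lemma measurable_fl [measurable (raw)]:
  "a \<in> measurable N (window_space l) \<Longrightarrow> (\<lambda>x. fl l (a x)) \<in> borel_measurable N"
  by (rule measurable_compose[OF _ fl_measurable])

lemma measurable_pair_approx_coord [measurable]: "pair_approx coord h fl l i j \<in> borel_measurable seq_space"
  unfolding pair_approx_def by measurable

lemma measurable_pair_incr_coord [measurable]: "pair_incr coord h fl l i j \<in> borel_measurable seq_space"
  unfolding pair_incr_def by (cases l) simp_all

lemma measurable_pair_incr [measurable]: "pair_incr eps h fl l i j \<in> borel_measurable M"
  using measurable_compose[OF measurable_path_0 measurable_pair_incr_coord, of l i j]
  by (simp add: pair_incr_path[of eps _ _ _ _ 0, simplified, symmetric] cong: measurable_cong)

lemma measurable_pair_approx [measurable]: "pair_approx eps h fl l i j \<in> borel_measurable M"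
  unfolding pair_approx_def by measurable

lemma measurable_level_kernel:
  "case_prod (level_kernel h fl l) \<in> borel_measurable (window_space l \<Otimes>\<^sub>M window_space l)"
proof (cases l)
  case 0
  then show ?thesis
    by (simp add: level_kernel_def split_beta') measurable
next
  case (Suc k)
  have [measurable]: "(\<lambda>x. restrict x {- int k..int k}) \<in> measurable (window_space (Suc k)) (window_space k)"
    unfolding window_space_def by (rule measurable_restrict_subset) auto
  show ?thesis
    unfolding Suc by (simp add: level_kernel_def split_beta') measurable
qed

lemma level_kernel_sym: "level_kernel h fl l x y = level_kernel h fl l y x"
  by (cases l) (simp_all add: level_kernel_def h_symmetric[of "fl _ x"] h_symmetric[of "fl _ (restrict x _)"])

text \<open>Stationarity moves the pair \<open>(i, j)\<close> to \<open>(0, j - i)\<close>, the form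
  seen by \<open>theta2\<close>.\<close>

lemma pair_incr_L2_le:
  assumes "i < j"
  shows "Lp_norm M 2 (\<lambda>\<omega>. ennreal \<bar>pair_incr eps h fl l (int i) (int j) \<omega>\<bar>) \<le> theta2 M eps h fl l"
proof -
  have path: "pair_incr eps h fl l (int i) (int j) \<omega> = pair_incr coord h fl l 0 (int (j - i)) (\<lambda>u. eps (u + int i) \<omega>)" for \<omega>
    using assms pair_incr_path[of eps h fl l 0 "int i" "int (j - i)" \<omega>] by (simp add: of_nat_diff)
  have "Lp_norm M 2 (\<lambda>\<omega>. ennreal \<bar>pair_incr eps h fl l (int i) (int j) \<omega>\<bar>)
      = Lp_norm M 2 (\<lambda>\<omega>. ennreal \<bar>pair_incr coord h fl l 0 (int (j - i)) (\<lambda>u. eps u \<omega>)\<bar>)"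
    unfolding path by (rule Lp_norm_shift[where \<Phi> = "\<lambda>x. ennreal \<bar>pair_incr coord h fl l 0 (int (j - i)) x\<bar>"]) measurable
  also have "\<dots> = Lp_norm M 2 (\<lambda>\<omega>. ennreal \<bar>pair_incr eps h fl l 0 (int (j - i)) \<omega>\<bar>)"
    using pair_incr_path[of eps h fl l 0 0 "int (j - i)"] by simp
  also have "\<dots> \<le> theta2 M eps h fl l"
    unfolding theta2_eq by (rule SUP_upper) simp
  finally show ?thesis .
qed

definition level_sup :: "nat \<Rightarrow> 'a \<Rightarrow> ennreal" where
  "level_sup l \<omega> = (SUP n\<in>{1..}. ennreal (1 / (real n powr (3 / 2) * sqrt (LL (real n)))
    * \<bar>\<Sum>j=1..n. \<Sum>i\<in>{1..<j}. pair_incr eps h fl l (int i) (int j) \<omega>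
        - expectation (pair_incr eps h fl l (int i) (int j))\<bar>))"

lemma measurable_level_sup [measurable]: "level_sup l \<in> borel_measurable M"
  unfolding level_sup_def by measurable

lemma level_sup_le_real:
  assumes p: "1 \<le> p" "p < 2" and \<kappa>: "0 < \<kappa>" "theta2 M eps h fl l \<le> ennreal \<kappa>"
  shows "Lp_norm M p (level_sup l) \<le> ennreal (ustat_const p * sqrt (real (2 * l + 1)) * \<kappa>)"
proof -
  have L2: "integrable M (\<lambda>\<omega>. (pair_incr eps h fl l (int i) (int j) \<omega>)\<^sup>2) \<and>
      expectation (\<lambda>\<omega>. (pair_incr eps h fl l (int i) (int j) \<omega>)\<^sup>2) \<le> \<kappa>\<^sup>2" if "i < j" for i j
    using order_trans[OF pair_incr_L2_le[OF that] \<kappa>(2)] \<kappa>(1)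
    by (subst (asm) L2_norm_le_iff_integral) auto
  interpret K: m_dependent_kernel M "window_space l" "\<lambda>i. window eps (int i) l" "2 * l + 1"
      "level_kernel h fl l" \<kappa>
    by unfold_locales (use L2 \<kappa>(1) measurable_level_kernel level_kernel_sym in
        \<open>auto simp: level_kernel_window\<close>)
  show ?thesis
    using K.Lp_norm_sup_ustat[OF p] by (simp add: level_kernel_window level_sup_def[abs_def])
qed

lemma level_sup_le:
  assumes p: "1 \<le> p" "p < 2"
  shows "Lp_norm M p (level_sup l) \<le> ennreal (ustat_const p * sqrt (real (2 * l + 1))) * theta2 M eps h fl l"
proof -
  define C where "C = ustat_const p * sqrt (real (2 * l + 1))"
  have C: "0 < C"
    using ustat_const_pos[OF p(2)] by (simp add: C_def)
  show ?thesis
  proof (cases "theta2 M eps h fl l")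
    case (real t)
    have "Lp_norm M p (level_sup l) \<le> ennreal (C * t)"
    proof (rule ennreal_le_epsilon)
      fix e :: real assume e: "0 < e"
      \<comment> \<open>The kernel bound must be positive, while \<open>t\<close> may be 0; the
        enlargement by \<open>e / C\<close> costs \<open>e\<close>.\<close>
      have "Lp_norm M p (level_sup l) \<le> ennreal (C * (t + e / C))"
        unfolding C_def using real e C ustat_const_pos[OF p(2)]
        by (intro level_sup_le_real p) (auto intro!: ennreal_leI add_nonneg_pos)
      also have "\<dots> = ennreal (C * t) + ennreal e"
        using C e real by (subst ennreal_plus[symmetric]) (auto simp: distrib_left)
      finally show "Lp_norm M p (level_sup l) \<le> ennreal (C * t) + ennreal e" .
    qed
    then show ?thesis
      unfolding C_def[symmetric] using real C by (simp add: ennreal_mult)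
  next
    case top
    then show ?thesis
      unfolding C_def[symmetric] using C by (simp add: ennreal_mult_top)
  qed
qed

end

section \<open>Approximation of the U-statistic\<close>

lemma ennreal_abs_le_suminf_abs:
  fixes f :: "nat \<Rightarrow> real"
  assumes "f sums s"
  shows "ennreal \<bar>s\<bar> \<le> (\<Sum>l. ennreal \<bar>f l\<bar>)"
proof (cases "(\<Sum>l. ennreal \<bar>f l\<bar>) = top")
  case False
  then have "summable (\<lambda>l. \<bar>f l\<bar>)"
    by (intro summable_suminf_not_top) auto
  moreover from this have "\<bar>suminf f\<bar> \<le> (\<Sum>l. \<bar>f l\<bar>)"
    by (rule summable_rabs)
  ultimately show ?thesis
    using sums_unique[OF assms] by (simp add: suminf_ennreal2 ennreal_leI)
qed simp

lemma (in finite_measure) measure_dist_gt_tendsto_0: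
  fixes A :: "nat \<Rightarrow> 'a \<Rightarrow> real"
  assumes [measurable]: "\<And>n. A n \<in> borel_measurable M" "B \<in> borel_measurable M"
    and lim: "AE \<omega> in M. (\<lambda>n. A n \<omega>) \<longlonglongrightarrow> B \<omega>" and \<delta>: "0 < \<delta>"
  shows "(\<lambda>n. measure M {\<omega>\<in>space M. \<delta> < \<bar>A n \<omega> - B \<omega>\<bar>}) \<longlonglongrightarrow> 0"
proof -
  define E where "E n = {\<omega>\<in>space M. \<delta> < \<bar>A n \<omega> - B \<omega>\<bar>}" for n
  have [measurable]: "E n \<in> sets M" for n
    unfolding E_def by measurable
  have "(\<lambda>n. \<integral>\<omega>. indicat_real (E n) \<omega> \<partial>M) \<longlonglongrightarrow> (\<integral>\<omega>. 0 \<partial>M)"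
  proof (rule integral_dominated_convergence[where w = "\<lambda>_. 1"])
    show "AE \<omega> in M. (\<lambda>n. indicat_real (E n) \<omega>) \<longlonglongrightarrow> 0"
      using lim
    proof eventually_elim
      case (elim \<omega>)
      have "eventually (\<lambda>n. \<bar>A n \<omega> - B \<omega>\<bar> < \<delta>) sequentially"
        using tendstoD[OF elim \<delta>] by (simp add: dist_real_def)
      then have "eventually (\<lambda>n. indicat_real (E n) \<omega> = 0) sequentially"
        by eventually_elim (auto simp: E_def)
      then show ?case
        by (rule tendsto_eventually)
    qed
  qed (auto simp: indicator_def)
  then show ?thesis
    by (simp add: E_def)
qed

text \<open>If \<open>B\<close> and \<open>C\<close> are more than \<open>2 * \<delta>\<close>
  apart, then every \<open>A n\<close> is more than \<open>\<delta>\<close> away from one of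
  them.\<close>

lemma (in finite_measure) AE_eq_of_limits_in_measure:
  fixes A :: "nat \<Rightarrow> 'a \<Rightarrow> real"
  assumes [measurable]: "\<And>n. A n \<in> borel_measurable M" "B \<in> borel_measurable M" "C \<in> borel_measurable M"
    and B: "\<And>\<delta>. 0 < \<delta> \<Longrightarrow> (\<lambda>n. measure M {\<omega>\<in>space M. \<delta> < \<bar>A n \<omega> - B \<omega>\<bar>}) \<longlonglongrightarrow> 0"
    and C: "\<And>\<delta>. 0 < \<delta> \<Longrightarrow> (\<lambda>n. measure M {\<omega>\<in>space M. \<delta> < \<bar>A n \<omega> - C \<omega>\<bar>}) \<longlonglongrightarrow> 0"
  shows "AE \<omega> in M. B \<omega> = C \<omega>"
proof -
  have null: "measure M {\<omega>\<in>space M. 2 * \<delta> < \<bar>B \<omega> - C \<omega>\<bar>} = 0" if \<delta>: "0 < \<delta>" for \<delta>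
  proof -
    have "measure M {\<omega>\<in>space M. 2 * \<delta> < \<bar>B \<omega> - C \<omega>\<bar>}
        \<le> measure M {\<omega>\<in>space M. \<delta> < \<bar>A n \<omega> - B \<omega>\<bar>} + measure M {\<omega>\<in>space M. \<delta> < \<bar>A n \<omega> - C \<omega>\<bar>}" for n
    proof -
      have "measure M {\<omega>\<in>space M. 2 * \<delta> < \<bar>B \<omega> - C \<omega>\<bar>}
          \<le> measure M ({\<omega>\<in>space M. \<delta> < \<bar>A n \<omega> - B \<omega>\<bar>} \<union> {\<omega>\<in>space M. \<delta> < \<bar>A n \<omega> - C \<omega>\<bar>})"
        by (intro finite_measure_mono) auto
      also have "\<dots> \<le> measure M {\<omega>\<in>space M. \<delta> < \<bar>A n \<omega> - B \<omega>\<bar>} + measure M {\<omega>\<in>space M. \<delta> < \<bar>A n \<omega> - C \<omega>\<bar>}"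
        by (intro measure_Un_le) measurable
      finally show ?thesis .
    qed
    then have "measure M {\<omega>\<in>space M. 2 * \<delta> < \<bar>B \<omega> - C \<omega>\<bar>} \<le> 0"
      using tendsto_add[OF B[OF \<delta>] C[OF \<delta>]] by (intro LIMSEQ_le_const) auto
    then show ?thesis
      by (simp add: measure_le_0_iff)
  qed
  have "AE \<omega> in M. \<bar>B \<omega> - C \<omega>\<bar> \<le> 2 * (1 / real (Suc n))" for n
    using null[of "1 / real (Suc n)"]
    by (subst AE_iff_measurable[OF _ refl]) (auto simp: not_le emeasure_eq_measure)
  then have "AE \<omega> in M. \<forall>n. \<bar>B \<omega> - C \<omega>\<bar> \<le> 2 * (1 / real (Suc n))"
    by (simp add: AE_all_countable)
  then show ?thesis
  proof eventually_elim
    case (elim \<omega>)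
    have "(\<lambda>n. 2 * (1 / real (Suc n))) \<longlonglongrightarrow> 2 * 0"
      using LIMSEQ_inverse_real_of_nat by (intro tendsto_mult tendsto_const) (simp add: inverse_eq_divide)
    then have "\<bar>B \<omega> - C \<omega>\<bar> \<le> 2 * 0"
      using elim by (intro LIMSEQ_le_const) auto
    then show ?case
      by simp
  qed
qed

context bernoulli_ustat
begin

section \<open>Almost sure expansion of the kernel values into increments\<close>

definition pair_value :: "nat \<Rightarrow> nat \<Rightarrow> 'a \<Rightarrow> real" where
  "pair_value i j \<omega> = h (shift_process eps f (int i) \<omega>) (shift_process eps f (int j) \<omega>)"

lemma measurable_shift_process_coord [measurable]: "shift_process coord f j \<in> borel_measurable seq_space"
  unfolding shift_process_def
  by (rule measurable_compose[OF measurable_reindex_coord f_measurable])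

lemma measurable_shift_process [measurable]: "shift_process eps f j \<in> borel_measurable M"
  using measurable_compose[OF measurable_path_0 measurable_shift_process_coord[of j]]
  by (simp add: shift_process_path[of eps f j 0, simplified, symmetric] cong: measurable_cong)

lemma measurable_pair_value [measurable]: "pair_value i j \<in> borel_measurable M"
  unfolding pair_value_def by measurable

text \<open>\<open>kernel_approximable\<close> speaks of pairs \<open>(0, d)\<close>. The event for
  \<open>(i, d + i)\<close> asks that the path shifted by \<open>i\<close> lie in the same set,
  hence it has the same probability.\<close>

lemma pair_approx_tendsto_in_measure:
  assumes approx: "kernel_approximable M eps f h fl" and "i < j" "0 < \<delta>"
  shows "(\<lambda>l. measure M {\<omega>\<in>space M. \<delta> < \<bar>pair_approx eps h fl l (int i) (int j) \<omega> - pair_value i j \<omega>\<bar>}) \<longlonglongrightarrow> 0"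
proof -
  define d where "d = j - i"
  have d: "1 \<le> d" "j = d + i"
    using assms by (auto simp: d_def)
  define A where "A l = {x\<in>space seq_space. \<delta> < \<bar>pair_approx coord h fl l 0 (int d) x
      - h (shift_process coord f 0 x) (shift_process coord f (int d) x)\<bar>}" for l
  have [measurable]: "A l \<in> sets seq_space" for l
    unfolding A_def by measurable
  have shifted: "{\<omega>\<in>space M. \<delta> < \<bar>pair_approx eps h fl l (int i) (int (d + i)) \<omega> - pair_value i (d + i) \<omega>\<bar>}
      = {\<omega>\<in>space M. (\<lambda>u. eps (u + int i) \<omega>) \<in> A l}" for l i
    using pair_approx_path[of eps h fl l 0 "int i" "int d"] shift_process_path[of eps f 0 "int i"]
      shift_process_path[of eps f "int d" "int i"]
    by (auto simp: A_def pair_value_def space_PiM)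
  have "measure M {\<omega>\<in>space M. \<delta> < \<bar>pair_approx eps h fl l (int i) (int j) \<omega> - pair_value i j \<omega>\<bar>}
      = measure M {\<omega>\<in>space M. \<delta> < \<bar>pair_approx eps h fl l (int 0) (int (d + 0)) \<omega> - pair_value 0 (d + 0) \<omega>\<bar>}" for l
    unfolding d(2) shifted by (simp add: measure_shift)
  moreover have "(\<lambda>l. measure M {\<omega>\<in>space M. \<delta> < \<bar>pair_approx eps h fl l (int 0) (int (d + 0)) \<omega> - pair_value 0 (d + 0) \<omega>\<bar>}) \<longlonglongrightarrow> 0"
    using approx d(1) \<open>0 < \<delta>\<close> by (simp add: kernel_approximable_def kernel_approx_eq pair_value_def)
  ultimately show ?thesis
    by simp
qed

text \<open>The norms of the increments are summable, so their series converges absolutely almost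
  surely and in mean to some \<open>G\<close>. Its partial sums are the approximations, which tend
  to \<open>pair_value i j\<close> in probability; therefore \<open>G\<close> is that value.
  Convergence in mean exchanges series and expectation.\<close>

lemma pair_incr_sums:
  assumes approx: "kernel_approximable M eps f h fl"
    and t: "\<And>l. theta2 M eps h fl l \<le> ennreal (t l)" "\<And>l. 0 \<le> t l" "summable t"
    and ij: "i < j"
  shows "AE \<omega> in M. (\<lambda>l. pair_incr eps h fl l (int i) (int j) \<omega>) sums pair_value i j \<omega>"
    and "integrable M (pair_value i j)"
    and "(\<lambda>l. expectation (pair_incr eps h fl l (int i) (int j))) sums expectation (pair_value i j)"
proof -
  define D where "D l = pair_incr eps h fl l (int i) (int j)" for l
  have [measurable]: "D l \<in> borel_measurable M" for l
    by (simp add: D_def)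
  have D2: "integrable M (\<lambda>\<omega>. (D l \<omega>)\<^sup>2)" "expectation (\<lambda>\<omega>. (D l \<omega>)\<^sup>2) \<le> (t l)\<^sup>2" for l
    using order_trans[OF pair_incr_L2_le[OF ij] t(1)] t(2)
    by (subst (asm) L2_norm_le_iff_integral, auto simp: D_def)+
  have int: "integrable M (D l)" for l
    by (rule square_integrable_imp_integrable[OF _ D2(1)]) measurable
  have abs_le: "expectation (\<lambda>\<omega>. \<bar>D l \<omega>\<bar>) \<le> t l" for l
  proof -
    have "(expectation (\<lambda>\<omega>. \<bar>D l \<omega>\<bar>))\<^sup>2 \<le> expectation (\<lambda>\<omega>. \<bar>D l \<omega>\<bar>\<^sup>2)"
      using D2(1) by (intro square_expectation_le) auto
    also have "\<dots> \<le> (t l)\<^sup>2"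
      using D2(2) by simp
    finally show ?thesis
      using t(2) by (rule power2_le_imp_le)
  qed
  have summable_E: "summable (\<lambda>l. expectation (\<lambda>\<omega>. norm (D l \<omega>)))"
    by (rule summable_comparison_test'[OF t(3), of 0]) (simp add: abs_le)
  have AE_summable: "AE \<omega> in M. summable (\<lambda>l. norm (D l \<omega>))"
  proof -
    have "(\<integral>\<^sup>+\<omega>. (\<Sum>l. ennreal (norm (D l \<omega>))) \<partial>M) = (\<Sum>l. \<integral>\<^sup>+\<omega>. ennreal (norm (D l \<omega>)) \<partial>M)"
      by (intro nn_integral_suminf) measurable
    also have "\<dots> = (\<Sum>l. ennreal (expectation (\<lambda>\<omega>. norm (D l \<omega>))))"
      using int by (intro suminf_cong nn_integral_eq_integral) auto
    also have "\<dots> = ennreal (\<Sum>l. expectation (\<lambda>\<omega>. norm (D l \<omega>)))"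
      using summable_E by (intro suminf_ennreal2) auto
    finally have "(\<integral>\<^sup>+\<omega>. (\<Sum>l. ennreal (norm (D l \<omega>))) \<partial>M) \<noteq> \<infinity>"
      by simp
    then have "AE \<omega> in M. (\<Sum>l. ennreal (norm (D l \<omega>))) \<noteq> \<infinity>"
      by (intro nn_integral_PInf_AE) measurable
    then show ?thesis
      by eventually_elim (auto intro: summable_suminf_not_top)
  qed
  define G where "G \<omega> = (\<Sum>l. D l \<omega>)" for \<omega>
  have [measurable]: "G \<in> borel_measurable M"
    unfolding G_def by measurable
  have eq: "AE \<omega> in M. G \<omega> = pair_value i j \<omega>"
  proof (rule AE_eq_of_limits_in_measure[where A = "\<lambda>l. pair_approx eps h fl l (int i) (int j)"])
    have "AE \<omega> in M. (\<lambda>n. pair_approx eps h fl n (int i) (int j) \<omega>) \<longlonglongrightarrow> G \<omega>"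
      using AE_summable
    proof eventually_elim
      case (elim \<omega>)
      then have "(\<lambda>n. \<Sum>l<n. D l \<omega>) \<longlonglongrightarrow> G \<omega>"
        unfolding G_def by (rule summable_LIMSEQ[OF summable_norm_cancel])
      then have "(\<lambda>n. \<Sum>l<Suc n. D l \<omega>) \<longlonglongrightarrow> G \<omega>"
        by (rule LIMSEQ_Suc)
      then show ?case
        unfolding D_def sum_pair_incr .
    qed
    then show "(\<lambda>n. measure M {\<omega>\<in>space M. \<delta> < \<bar>pair_approx eps h fl n (int i) (int j) \<omega> - G \<omega>\<bar>}) \<longlonglongrightarrow> 0"
      if "0 < \<delta>" for \<delta>
      using that by (intro measure_dist_gt_tendsto_0) measurable
    show "(\<lambda>n. measure M {\<omega>\<in>space M. \<delta> < \<bar>pair_approx eps h fl n (int i) (int j) \<omega> - pair_value i j \<omega>\<bar>}) \<longlonglongrightarrow> 0"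
      if "0 < \<delta>" for \<delta>
      by (rule pair_approx_tendsto_in_measure[OF approx ij that])
  qed measurable
  show "AE \<omega> in M. (\<lambda>l. pair_incr eps h fl l (int i) (int j) \<omega>) sums pair_value i j \<omega>"
    using eq AE_summable
  proof eventually_elim
    case (elim \<omega>)
    have "(\<lambda>l. D l \<omega>) sums G \<omega>"
      unfolding G_def by (rule summable_sums[OF summable_norm_cancel[OF elim(2)]])
    then show ?case
      by (simp add: elim(1) D_def)
  qed
  have "integrable M G"
    unfolding G_def by (rule integrable_suminf[OF int AE_summable summable_E])
  then show "integrable M (pair_value i j)"
    using eq by (subst (asm) integrable_cong_AE) auto
  have "(\<lambda>l. expectation (D l)) sums expectation G"
    unfolding G_def by (rule sums_integral[OF int AE_summable summable_E])
  also have "expectation G = expectation (pair_value i j)"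
    using eq by (intro integral_cong_AE) auto
  finally show "(\<lambda>l. expectation (pair_incr eps h fl l (int i) (int j))) sums expectation (pair_value i j)"
    by (simp add: D_def)
qed

lemma ustat_eq: "ustat eps f h n \<omega> = (\<Sum>j=1..n. \<Sum>i\<in>{1..<j}. pair_value i j \<omega>)"
proof -
  have "ustat eps f h n \<omega> = (\<Sum>(j, i)\<in>(SIGMA j:{1..n}. {1..<j}). pair_value i j \<omega>)"
    unfolding ustat_def pair_value_def
    by (rule sum.reindex_bij_witness[where i = "\<lambda>(j, i). (i, j)" and j = "\<lambda>(i, j). (j, i)"]) auto
  also have "\<dots> = (\<Sum>j=1..n. \<Sum>i\<in>{1..<j}. pair_value i j \<omega>)"
    by (rule sum.Sigma[symmetric]) auto
  finally show ?thesis .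
qed

text \<open>There are countably many pairs, so one null set serves all of them. Off it, each centred
  U-statistic is the series of the centred level sums, and every level is bounded by its own
  supremum over \<open>n\<close>.\<close>

lemma centred_ustat_sup_le:
  assumes approx: "kernel_approximable M eps f h fl"
    and t: "\<And>l. theta2 M eps h fl l \<le> ennreal (t l)" "\<And>l. 0 \<le> t l" "summable t"
  shows "AE \<omega> in M. (SUP n\<in>{1..}. ennreal (1 / (real n powr (3 / 2) * sqrt (LL (real n)))
    * \<bar>ustat eps f h n \<omega> - expectation (ustat eps f h n)\<bar>)) \<le> (\<Sum>l. level_sup l \<omega>)"
proof -
  note sums = pair_incr_sums[OF approx t]
  have "AE \<omega> in M. i < j \<longrightarrow> (\<lambda>l. pair_incr eps h fl l (int i) (int j) \<omega>) sums pair_value i j \<omega>" for i j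
    using sums(1)[of i j] by (cases "i < j") auto
  then have "AE \<omega> in M. \<forall>i j. i < j \<longrightarrow> (\<lambda>l. pair_incr eps h fl l (int i) (int j) \<omega>) sums pair_value i j \<omega>"
    by (simp add: AE_all_countable)
  then show ?thesis
  proof eventually_elim
    case (elim \<omega>)
    show ?case
    proof (rule SUP_least)
      fix n :: nat assume n: "n \<in> {1..}"
      define a where "a = 1 / (real n powr (3 / 2) * sqrt (LL (real n)))"
      define x where "x l = (\<Sum>j=1..n. \<Sum>i\<in>{1..<j}. pair_incr eps h fl l (int i) (int j) \<omega>
          - expectation (pair_incr eps h fl l (int i) (int j)))" for l
      have a: "0 \<le> a"
        using LL_ge_1[of "real n"] by (simp add: a_def)
      have "expectation (ustat eps f h n) = (\<Sum>j=1..n. \<Sum>i\<in>{1..<j}. expectation (pair_value i j))"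
        unfolding ustat_eq[abs_def] using sums(2)
        by (subst Bochner_Integration.integral_sum)
          (auto intro!: sum.cong Bochner_Integration.integral_sum Bochner_Integration.integrable_sum)
      then have "ustat eps f h n \<omega> - expectation (ustat eps f h n)
          = (\<Sum>j=1..n. \<Sum>i\<in>{1..<j}. pair_value i j \<omega> - expectation (pair_value i j))"
        by (simp add: ustat_eq sum_subtractf)
      moreover have "x sums (\<Sum>j=1..n. \<Sum>i\<in>{1..<j}. pair_value i j \<omega> - expectation (pair_value i j))"
        unfolding x_def[abs_def] using elim sums(3) by (intro sums_sum sums_diff) auto
      ultimately have "ennreal \<bar>ustat eps f h n \<omega> - expectation (ustat eps f h n)\<bar> \<le> (\<Sum>l. ennreal \<bar>x l\<bar>)"
        by (simp add: ennreal_abs_le_suminf_abs)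
      then have "ennreal a * ennreal \<bar>ustat eps f h n \<omega> - expectation (ustat eps f h n)\<bar>
          \<le> ennreal a * (\<Sum>l. ennreal \<bar>x l\<bar>)"
        by (rule mult_left_mono) simp
      also have "\<dots> = (\<Sum>l. ennreal (a * \<bar>x l\<bar>))"
        using a by (simp add: ennreal_mult)
      also have "\<dots> \<le> (\<Sum>l. level_sup l \<omega>)"
        unfolding level_sup_def a_def x_def using n by (intro suminf_le SUP_upper summableI) auto
      finally show "ennreal (1 / (real n powr (3 / 2) * sqrt (LL (real n)))
          * \<bar>ustat eps f h n \<omega> - expectation (ustat eps f h n)\<bar>) \<le> (\<Sum>l. level_sup l \<omega>)"
        unfolding a_def[symmetric] using a by (simp add: ennreal_mult)
    qed
  qed
qed

text \<open>If \<open>T\<close> is infinite, positivity of the constant makes the bound trivial.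
  Otherwise all \<open>\<theta> l\<close> are finite and summable, since the weights are at least 1,
  and the expansion into levels is available.\<close>

theorem maximal_bound_ustat_const:
  assumes p: "1 \<le> p" "p < 2" and approx: "kernel_approximable M eps f h fl"
  shows "maximal_bound M eps f h fl p (2 * ustat_const p)"
proof -
  define \<theta> where "\<theta> = theta2 M eps h fl"
  define T where "T = \<theta> 0 + (\<Sum>l. ennreal (real (Suc l) powr (1 / 2)) * \<theta> (Suc l))"
  have C: "0 < ustat_const p"
    using ustat_const_pos[OF p(2)] .
  have split: "(\<Sum>l. g l) = g 0 + (\<Sum>l. g (Suc l))" for g :: "nat \<Rightarrow> ennreal"
    using suminf_offset[OF summableI, of g 1] by (simp add: add.commute)
  define S where "S \<omega> = (SUP n\<in>{1..}. ennreal (1 / (real n powr (3 / 2) * sqrt (LL (real n)))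
    * \<bar>ustat eps f h n \<omega> - expectation (ustat eps f h n)\<bar>))" for \<omega>
  have "Lp_norm M p S \<le> ennreal (2 * ustat_const p) * T"
  proof (cases "T = \<infinity>")
    case True
    then show ?thesis
      using C by (simp add: ennreal_mult_top)
  next
    case False
    have "(\<Sum>l. \<theta> l) \<le> T"
      unfolding split[of \<theta>] T_def
    proof (intro add_left_mono suminf_le summableI)
      fix l
      have "1 * \<theta> (Suc l) \<le> ennreal (real (Suc l) powr (1 / 2)) * \<theta> (Suc l)"
        by (intro mult_right_mono) (auto simp: ennreal_1[symmetric] simp del: ennreal_1 intro!: ennreal_leI ge_one_powr_ge_zero)
      then show "\<theta> (Suc l) \<le> ennreal (real (Suc l) powr (1 / 2)) * \<theta> (Suc l)"
        by simp
    qed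
    then have fin: "(\<Sum>l. \<theta> l) \<noteq> top"
      using False by (auto simp: top_unique)
    define t where "t l = enn2real (\<theta> l)" for l
    have \<theta>_eq: "\<theta> l = ennreal (t l)" for l
    proof -
      have "\<theta> l \<noteq> top"
        using ennreal_le_suminf[of \<theta> l] fin by (auto simp: top_unique)
      then show ?thesis
        by (simp add: t_def less_top)
    qed
    have t: "0 \<le> t l" for l
      by (simp add: t_def)
    have "summable t"
      using fin t by (intro summable_suminf_not_top) (auto simp: \<theta>_eq)
    then have "AE \<omega> in M. S \<omega> \<le> (\<Sum>l. level_sup l \<omega>)"
      unfolding S_def using t by (intro centred_ustat_sup_le[OF approx, of t]) (auto simp: \<theta>_eq[symmetric] \<theta>_def)
    then have "Lp_norm M p S \<le> Lp_norm M p (\<lambda>\<omega>. \<Sum>l. level_sup l \<omega>)"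
      using p by (intro Lp_norm_mono_AE) auto
    also have "\<dots> \<le> (\<Sum>l. Lp_norm M p (level_sup l))"
      using p by (intro Lp_norm_suminf_le) auto
    also have "\<dots> \<le> (\<Sum>l. ennreal (ustat_const p * sqrt (real (2 * l + 1))) * \<theta> l)"
      unfolding \<theta>_def by (intro suminf_le level_sup_le p summableI)
    also have "\<dots> \<le> ennreal (2 * ustat_const p) * \<theta> 0
        + (\<Sum>l. ennreal (2 * ustat_const p) * (ennreal (real (Suc l) powr (1 / 2)) * \<theta> (Suc l)))"
      unfolding split[of "\<lambda>l. ennreal (ustat_const p * sqrt (real (2 * l + 1))) * \<theta> l"]
    proof (intro add_mono suminf_le summableI)
      show "ennreal (ustat_const p * sqrt (real (2 * 0 + 1))) * \<theta> 0 \<le> ennreal (2 * ustat_const p) * \<theta> 0"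
        using C by (intro mult_right_mono ennreal_leI) auto
      fix l
      \<comment> \<open>The range \<open>2 * l + 3\<close> of level \<open>Suc l\<close> is at most
        \<open>4 * (l + 1)\<close>: the source of the factor 2 in the constant.\<close>
      have "sqrt (real (2 * Suc l + 1)) \<le> sqrt (4 * real (Suc l))"
        by (intro real_sqrt_le_mono) simp
      also have "\<dots> = 2 * sqrt (real (Suc l))"
        by (simp only: real_sqrt_mult real_sqrt_four)
      finally have "ustat_const p * sqrt (real (2 * Suc l + 1)) \<le> ustat_const p * (2 * sqrt (real (Suc l)))"
        using C by (intro mult_left_mono) auto
      then have "ennreal (ustat_const p * sqrt (real (2 * Suc l + 1))) \<le> ennreal (2 * ustat_const p * real (Suc l) powr (1 / 2))"
        by (intro ennreal_leI) (simp add: powr_half_sqrt)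
      also have "\<dots> = ennreal (2 * ustat_const p) * ennreal (real (Suc l) powr (1 / 2))"
        using C by (intro ennreal_mult) auto
      finally show "ennreal (ustat_const p * sqrt (real (2 * Suc l + 1))) * \<theta> (Suc l)
          \<le> ennreal (2 * ustat_const p) * (ennreal (real (Suc l) powr (1 / 2)) * \<theta> (Suc l))"
        unfolding mult.assoc[symmetric] by (rule mult_right_mono) simp
    qed
    also have "\<dots> = ennreal (2 * ustat_const p) * T"
      by (simp only: T_def ennreal_suminf_cmult distrib_left)
    finally show ?thesis .
  qed
  then show ?thesis
    by (simp only: maximal_bound_def S_def[abs_def] T_def \<theta>_def)
qed

end

section \<open>Transfer to the law of the path\<close>

lemma window_path_eq: "window coord j l (\<lambda>u. eps u \<omega>) = window eps j l \<omega>"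
  using window_path[of eps j 0] by simp

lemma shift_process_path_eq: "shift_process coord f j (\<lambda>u. eps u \<omega>) = shift_process eps f j \<omega>"
  using shift_process_path[of eps f j 0] by simp

lemma kernel_approx_path_eq: "kernel_approx coord h fl l j (\<lambda>u. eps u \<omega>) = kernel_approx eps h fl l j \<omega>"
  by (simp add: kernel_approx_def window_path_eq)

lemma ustat_path_eq: "ustat coord f h n (\<lambda>u. eps u \<omega>) = ustat eps f h n \<omega>"
  by (simp add: ustat_def shift_process_path_eq)

lemma (in iid_field) subalgebra_window_sigma: "finite_measure_subalgebra M (window_sigma M eps j l)"
proof unfold_locales
  have "window eps j l -` A \<inter> space M \<in> sets M" if "A \<in> sets (window_space l)" for A
    using that by measurable
  then have "sets (window_sigma M eps j l) \<subseteq> sets M"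
    unfolding window_sigma_def
    by (subst sets_vimage_algebra) (auto intro!: sets.sigma_sets_subset)
  then show "subalgebra M (window_sigma M eps j l)"
    by (simp add: subalgebra_def window_sigma_def)
qed

lemma (in iid_field) sets_window_sigma:
  "sets (window_sigma M eps j l) = {window eps j l -` B \<inter> space M | B. B \<in> sets (window_space l)}"
  unfolding window_sigma_def
  by (rule sets_vimage_algebra2) (auto dest: measurable_space[OF measurable_window])

lemma (in iid_field) measurable_window_sigma:
  "window eps j l \<in> measurable (window_sigma M eps j l) (window_space l)"
  unfolding window_sigma_def
  by (rule measurable_vimage_algebra1) (auto dest: measurable_space[OF measurable_window])

context bernoulli_ustat
begin

text \<open>Hypotheses and both sides of the bound depend on the process only through this law,
  which lives on a fixed type whatever the sample space is.\<close>

definition path_law :: "(int \<Rightarrow> real) measure" where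
  "path_law = distr M seq_space (\<lambda>\<omega> u. eps u \<omega>)"

lemma sets_path_law [measurable_cong, simp]: "sets path_law = sets seq_space"
  by (simp add: path_law_def)

lemma space_path_law [simp]: "space path_law = UNIV"
  by (simp add: path_law_def space_PiM)

lemma integrable_path_law:
  fixes \<Phi> :: "(int \<Rightarrow> real) \<Rightarrow> real"
  assumes [measurable]: "\<Phi> \<in> borel_measurable seq_space"
  shows "integrable path_law \<Phi> \<longleftrightarrow> integrable M (\<lambda>\<omega>. \<Phi> (\<lambda>u. eps u \<omega>))"
  unfolding path_law_def by (simp add: integrable_distr_eq)

lemma integral_path_law:
  fixes \<Phi> :: "(int \<Rightarrow> real) \<Rightarrow> real"
  assumes [measurable]: "\<Phi> \<in> borel_measurable seq_space"
  shows "(\<integral>x. \<Phi> x \<partial>path_law) = (\<integral>\<omega>. \<Phi> (\<lambda>u. eps u \<omega>) \<partial>M)"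
  unfolding path_law_def by (simp add: integral_distr)

lemma Lp_norm_path_law:
  assumes [measurable]: "\<Phi> \<in> borel_measurable seq_space"
  shows "Lp_norm path_law p \<Phi> = Lp_norm M p (\<lambda>\<omega>. \<Phi> (\<lambda>u. eps u \<omega>))"
  unfolding Lp_norm_def path_law_def by (simp add: nn_integral_distr)

lemma measurable_kernel_approx_coord [measurable]: "kernel_approx coord h fl l j \<in> borel_measurable seq_space"
  unfolding kernel_approx_eq by measurable

lemma measurable_ustat_coord [measurable]: "ustat coord f h n \<in> borel_measurable seq_space"
  unfolding ustat_def split_beta' by measurable

text \<open>The law of the path is a product measure, and the coordinates on path space form the
  identity map, whose law is that same product.\<close>

lemma iid_field_path_law: "iid_field path_law coord"
proof -
  interpret N: prob_space path_law
    unfolding path_law_def by (rule prob_space_distr) measurable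
  have coord_distr: "distr path_law borel (coord u) = distr M borel (eps u)" for u
    unfolding path_law_def by (subst distr_distr) (auto simp: comp_def)
  show ?thesis
  proof
    have "PiM UNIV (\<lambda>i. distr path_law borel (coord i)) = PiM UNIV (\<lambda>_. distr M borel (eps 0))"
      unfolding coord_distr by (intro PiM_cong refl eps_ident)
    also have "\<dots> = path_law"
      using distr_path[of 0] by (simp add: path_law_def)
    also have "\<dots> = distr path_law seq_space (\<lambda>x. \<lambda>i\<in>UNIV. coord i x)"
      using distr_id2[of seq_space path_law] by (simp add: restrict_UNIV)
    finally show "N.indep_vars (\<lambda>_. borel) coord UNIV"
      by (subst N.indep_vars_iff_distr_eq_PiM) auto
    show "distr path_law borel (coord u) = distr path_law borel (coord v)" for u v
      unfolding coord_distr by (rule eps_ident)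
  qed
qed

text \<open>Integrability is a property of the law of the variable alone, and that law is the same
  for all \<open>j\<close>.\<close>

lemma integrable_shift_process: "integrable M (shift_process eps f j)"
proof -
  have "integrable M (\<lambda>\<omega>. shift_process coord f 0 (\<lambda>u. eps (u + s) \<omega>))
      \<longleftrightarrow> integrable (distr M borel (\<lambda>\<omega>. shift_process coord f 0 (\<lambda>u. eps (u + s) \<omega>))) (\<lambda>x. x)" for s
    by (subst integrable_distr_eq) auto
  from this[of j] this[of 0]
  have "integrable M (\<lambda>\<omega>. shift_process coord f 0 (\<lambda>u. eps (u + j) \<omega>))
      \<longleftrightarrow> integrable M (\<lambda>\<omega>. shift_process coord f 0 (\<lambda>u. eps (u + 0) \<omega>))"
    by (simp only: distr_shift[OF measurable_shift_process_coord] add_0_right)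
  moreover have "shift_process eps f s = (\<lambda>\<omega>. shift_process coord f 0 (\<lambda>u. eps (u + s) \<omega>))" for s
    using shift_process_path[of eps f 0 s] by auto
  ultimately show ?thesis
    using X0_integrable by (simp only:)
qed

text \<open>The delicate hypothesis is the conditional expectation. It is carried over by its
  defining property: integrals over window events on path space equal those over the corresponding
  events in \<open>M\<close>.\<close>

lemma bernoulli_ustat_path_law: "bernoulli_ustat path_law coord f h fl"
proof -
  interpret N: iid_field path_law coord
    by (rule iid_field_path_law)
  show ?thesis
  proof
    show "integrable path_law (shift_process coord f 0)"
      using X0_integrable by (simp add: integrable_path_law shift_process_path_eq)
    show "AE x in path_law. real_cond_exp path_law (window_sigma path_law coord j l) (shift_process coord f j) x
        = fl l (window coord j l x)" for j l
    proof -
      interpret A: finite_measure_subalgebra M "window_sigma M eps j l"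
        by (rule subalgebra_window_sigma)
      interpret B: finite_measure_subalgebra path_law "window_sigma path_law coord j l"
        by (rule N.subalgebra_window_sigma)
      have int_g: "integrable M (\<lambda>\<omega>. fl l (window eps j l \<omega>))"
        using A.real_cond_exp_int(1)[OF integrable_shift_process[of j]]
        by (subst (asm) integrable_cong_AE[OF _ _ fl_cond_exp[of j l]]) auto
      show ?thesis
      proof (rule B.real_cond_exp_charact)
        show "integrable path_law (shift_process coord f j)"
          using integrable_shift_process by (simp add: integrable_path_law shift_process_path_eq)
        show "integrable path_law (\<lambda>x. fl l (window coord j l x))"
          using int_g by (simp add: integrable_path_law window_path_eq)
        show "(\<lambda>x. fl l (window coord j l x)) \<in> borel_measurable (window_sigma path_law coord j l)"
          by (rule measurable_compose[OF N.measurable_window_sigma fl_measurable])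
        fix S assume "S \<in> sets (window_sigma path_law coord j l)"
        then obtain B where B [measurable]: "B \<in> sets (window_space l)" and S: "S = window coord j l -` B \<inter> space path_law"
          by (auto simp: N.sets_window_sigma)
        \<comment> \<open>The event in \<open>M\<close> given by the same set \<open>B\<close> of
          window values; the path lies in \<open>S\<close> exactly on \<open>S'\<close>.\<close>
        define S' where "S' = window eps j l -` B \<inter> space M"
        have S': "S' \<in> sets (window_sigma M eps j l)"
          using B by (auto simp: sets_window_sigma S'_def)
        have ind: "indicat_real S (\<lambda>u. eps u \<omega>) = indicat_real S' \<omega>" if "\<omega> \<in> space M" for \<omega>
          using that by (simp add: S S'_def indicator_def window_path_eq)
        have [measurable]: "S \<in> sets seq_space"
          using \<open>S \<in> sets (window_sigma path_law coord j l)\<close> B.subalg by (auto simp: subalgebra_def)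
        have [measurable]: "S' \<in> sets M"
          using S' A.subalg by (auto simp: subalgebra_def)
        have "(LINT x:S|path_law. shift_process coord f j x) = (LINT \<omega>:S'|M. shift_process eps f j \<omega>)"
          unfolding set_lebesgue_integral_def
          by (subst integral_path_law) (auto simp: shift_process_path_eq ind intro!: Bochner_Integration.integral_cong)
        also have "\<dots> = (LINT \<omega>:S'|M. real_cond_exp M (window_sigma M eps j l) (shift_process eps f j) \<omega>)"
          by (rule A.real_cond_exp_intA[OF integrable_shift_process S'])
        also have "\<dots> = (LINT \<omega>:S'|M. fl l (window eps j l \<omega>))"
          unfolding set_lebesgue_integral_def
          by (intro integral_cong_AE) (use fl_cond_exp[of j l] in \<open>auto elim!: eventually_mono\<close>)
        also have "\<dots> = (LINT x:S|path_law. fl l (window coord j l x))"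
          unfolding set_lebesgue_integral_def
          by (subst integral_path_law) (auto simp: window_path_eq ind intro!: Bochner_Integration.integral_cong)
        finally show "(LINT x:S|path_law. shift_process coord f j x) = (LINT x:S|path_law. fl l (window coord j l x))" .
      qed
    qed
  qed (rule N.eps_indep N.eps_ident f_measurable h_measurable h_symmetric fl_measurable)+
qed

lemma kernel_approximable_path_law:
  assumes "kernel_approximable M eps f h fl"
  shows "kernel_approximable path_law coord f h fl"
proof -
  define A where "A j \<delta> l = {x\<in>space seq_space. \<delta> < \<bar>kernel_approx coord h fl l j x
      - h (shift_process coord f 0 x) (shift_process coord f (int j) x)\<bar>}" for j \<delta> l
  have [measurable]: "A j \<delta> l \<in> sets seq_space" for j \<delta> l
    unfolding A_def by measurable
  have "measure path_law (A j \<delta> l) = measure M {\<omega>\<in>space M. \<delta> < \<bar>kernel_approx eps h fl l j \<omega>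
      - h (shift_process eps f 0 \<omega>) (shift_process eps f (int j) \<omega>)\<bar>}" for j \<delta> l
  proof -
    have "measure path_law (A j \<delta> l) = measure M ((\<lambda>\<omega> u. eps u \<omega>) -` A j \<delta> l \<inter> space M)"
      unfolding path_law_def by (rule measure_distr) measurable
    also have "(\<lambda>\<omega> u. eps u \<omega>) -` A j \<delta> l \<inter> space M = {\<omega>\<in>space M. \<delta> < \<bar>kernel_approx eps h fl l j \<omega>
      - h (shift_process eps f 0 \<omega>) (shift_process eps f (int j) \<omega>)\<bar>}"
      by (auto simp: A_def space_PiM kernel_approx_path_eq shift_process_path_eq)
    finally show ?thesis .
  qed
  moreover have "A j \<delta> l = {x\<in>space path_law. \<delta> < \<bar>kernel_approx coord h fl l j x
      - h (shift_process coord f 0 x) (shift_process coord f (int j) x)\<bar>}" for j \<delta> l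
    by (simp add: A_def space_PiM)
  ultimately show ?thesis
    using assms by (simp add: kernel_approximable_def)
qed

lemma theta2_path_law: "theta2 path_law coord h fl l = theta2 M eps h fl l"
  by (cases l) (simp_all add: Lp_norm_path_law kernel_approx_path_eq)

lemma maximal_bound_path_law: "maximal_bound path_law coord f h fl p c \<longleftrightarrow> maximal_bound M eps f h fl p c"
  unfolding maximal_bound_def theta2_path_law
  by (subst Lp_norm_path_law) (auto simp: ustat_path_eq integral_path_law)

end

(* A constant that depends only on p must not depend on the type of the sample space either, and
   HOL cannot quantify over types inside a formula. Hence the constant is obtained for sample spaces
   over the fixed type int => real, and each constant that works there is asserted to work for
   sample spaces over an arbitrary type 'a. *)
theorem theorem1p6:
  fixes p :: real
  assumes "1 \<le> p" and "p < 2"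
  shows "(\<exists>c>0. \<forall>(M :: (int \<Rightarrow> real) measure) eps f h fl.
            bernoulli_ustat M eps f h fl \<longrightarrow> kernel_approximable M eps f h fl \<longrightarrow>
              maximal_bound M eps f h fl p c)
       \<and> (\<forall>c>0. (\<forall>(M :: (int \<Rightarrow> real) measure) eps f h fl.
            bernoulli_ustat M eps f h fl \<longrightarrow> kernel_approximable M eps f h fl \<longrightarrow>
              maximal_bound M eps f h fl p c)
          \<longrightarrow> (\<forall>(M :: 'a measure) eps f h fl.
            bernoulli_ustat M eps f h fl \<longrightarrow> kernel_approximable M eps f h fl \<longrightarrow>
              maximal_bound M eps f h fl p c))"
proof (intro conjI allI impI)
  show "\<exists>c>0. \<forall>(M :: (int \<Rightarrow> real) measure) eps f h fl.
      bernoulli_ustat M eps f h fl \<longrightarrow> kernel_approximable M eps f h fl \<longrightarrow>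
        maximal_bound M eps f h fl p c"
    using ustat_const_pos[OF assms(2)] bernoulli_ustat.maximal_bound_ustat_const[OF _ assms]
    by (intro exI[of _ "2 * ustat_const p"]) auto
next
  fix c :: real and M :: "'a measure" and eps f h fl
  assume bound: "\<forall>(M :: (int \<Rightarrow> real) measure) eps f h fl.
      bernoulli_ustat M eps f h fl \<longrightarrow> kernel_approximable M eps f h fl \<longrightarrow>
        maximal_bound M eps f h fl p c"
    and "bernoulli_ustat M eps f h fl" and approx: "kernel_approximable M eps f h fl"
  then interpret bernoulli_ustat M eps f h fl
    by simp
  \<comment> \<open>The constant is applied to the coordinate process under \<open>path_law\<close>,
    and the resulting bound is carried back to \<open>M\<close>.\<close>
  show "maximal_bound M eps f h fl p c"
    using bound bernoulli_ustat_path_law kernel_approximable_path_law[OF approx]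
    by (simp flip: maximal_bound_path_law)
qed

end
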